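(* Let $\nu$ be a prime number or $\infty$ (with $\mathbb{Q}_\infty=\mathbb{R}$). Let $U\subset\mathbb{Q}_\nu^d$ be open, let $\mathbf{f}=(f_1,\dots,f_n):U\to\mathbb{Q}_\nu^n$ be a $C^{l+1}$ map, and let $\mathbf{x}_0\in U$ be such that $\mathbf{f}$ is $l$-nondegenerate at $\mathbf{x}_0$. Let $\mu$ be a locally finite Borel measure which is $D$-Federer and absolutely $(C,\alpha)$-decaying on $U$ for some $D,C,\alpha>0$. Then there exist a neighbourhood $V\subset U$ of $\mathbf{x}_0$ and $C'>0$ such that every $$g\in\mathcal{L}_{\mathbf{f}}:=\Big\{c_0+\sum_{i=1}^nc_if_i: c_0,\dots,c_n\in\mathbb{Q}_\nu\Big\}$$ is absolutely $\left(C',\frac{\alpha}{2^{l+1}-2}\right)$-good on $V$ with respect to $\mu$.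
   Context: $|\cdot|_\nu$ is the standard absolute value on $\mathbb{Q}_\nu$; $l\ge1$. $C^k$ maps. For $\nu=\infty$ this has the usual meaning. For $\nu$ prime: if $V\subset\mathbb{Q}_\nu$ has no isolated points and $f:V\to\mathbb{Q}_\nu$, put $\Phi^0f=f$ and, for pairwise distinct $x_1,\dots,x_{k+1}\in V$, $\Phi^kf(x_1,\dots,x_{k+1})=\frac{\Phi^{k-1}f(x_1,x_3,\dots,x_{k+1})-\Phi^{k-1}f(x_2,x_3,\dots,x_{k+1})}{x_1-x_2}$. For $f$ on $V_1\times\cdots\times V_d$ and a multi-index $\beta=(i_1,\dots,i_d)$ with $|\beta|=i_1+\dots+i_d$, let $\Phi_\beta f=\Phi_1^{i_1}\circ\cdots\circ\Phi_d^{i_d}f$, where $\Phi_j^{i}$ is the $i$-th order difference quotient in the $j$-th variable. $f$ is $C^k$ if for each $|\beta|\le k$ the function $\Phi_\beta f$ extends to a continuous function on $V_1^{i_1+1}\times\cdots\times V_d^{i_d+1}$. On a general open set the notion is local (on product neighbourhoods), and for vector-valued maps it is componentwise. $l$-nondegenerate at $\mathbf{x}_0$: the partial derivatives of $\mathbf{f}$ at $\mathbf{x}_0$ of orders $1,\dots,l$ span $\mathbb{Q}_\nu^n$. $D$-Federer on $U$ (where $\mu(U)>0$): $\sup\{\mu(B(x,3r))/\mu(B(x,r)):x\in\operatorname{supp}\mu,\ r>0,\ B(x,3r)\subset U\}<D$. A function $f$ is absolutely $(C,\alpha)$-good on an open set $U$ with respect to $\mu$ if for every open ball $B\subset U$ centred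 in $\operatorname{supp}\mu$ and every $\varepsilon>0$, $\mu(\{\mathbf{x}\in B:|f(\mathbf{x})|_\nu<\varepsilon\})\le C(\varepsilon/\sup_B|f|_\nu)^\alpha\mu(B)$ (vacuous if $\sup_B|f|_\nu=0$). $\mu$ is absolutely $(C,\alpha)$-decaying on $U$ if every affine function $\mathbb{Q}_\nu^d\to\mathbb{Q}_\nu$ is absolutely $(C,\alpha)$-good on $U$ with respect to $\mu$. *)

theory Defs
  imports "HOL-Analysis.Analysis" "HOL-Library.Extended_Nat"
begin

section \<open>The fields \<open>\<rat>\<^sub>\<nu>\<close>\<close>

text \<open>A place \<open>\<nu>\<close> is an element of type \<^typ>\<open>enat\<close>: a prime number or \<open>\<infinity>\<close>.\<close>

definition is_place :: "enat \<Rightarrow> bool" where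
  "is_place \<nu> \<longleftrightarrow> \<nu> = \<infinity> \<or> (\<exists>p. prime p \<and> \<nu> = enat p)"

definition rat_padic_abs :: "nat \<Rightarrow> rat \<Rightarrow> real" where
  "rat_padic_abs p q =
     (if q = 0 then 0
      else real p powi (int (multiplicity (int p) (snd (quotient_of q)))
                        - int (multiplicity (int p) (fst (quotient_of q)))))"

definition rat_abs_at :: "enat \<Rightarrow> rat \<Rightarrow> real" where
  "rat_abs_at \<nu> q = (case \<nu> of enat p \<Rightarrow> rat_padic_abs p q | \<infinity> \<Rightarrow> of_rat \<bar>q\<bar>)"

definition qabs :: "'k::{zero, metric_space} \<Rightarrow> real" where
  "qabs x = dist x 0"

text \<open>
  \<open>is_Q_nu \<nu> TYPE('k)\<close>: the field \<open>'k\<close> with the absolute value \<^const>\<open>qabs\<close>, whose induced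
  metric is \<^const>\<open>dist\<close>, is the completion of \<open>\<rat>\<close> with respect to \<open>|\<cdot>|\<^sub>\<nu>\<close>. (The sort supplies
  completeness, and that \<^const>\<open>dist\<close> induces the topology of \<open>'k\<close>; the triangle inequality
  of \<^const>\<open>qabs\<close> is that of \<^const>\<open>dist\<close>.) This determines \<open>'k\<close> up to a unique isometric
  isomorphism. Theory \<open>Defs\<close> ends with models for all places: \<^typ>\<open>real\<close> for \<open>\<nu> = \<infinity>\<close> and
  a type \<open>'p padic\<close> for \<open>\<nu> = p\<close> prime.
\<close>

definition is_Q_nu :: "enat \<Rightarrow> 'k::{field_char_0, complete_space} itself \<Rightarrow> bool" where
  "is_Q_nu \<nu> T \<longleftrightarrow>
     is_place \<nu> \<and>
     (\<forall>x y :: 'k. dist x y = qabs (x - y)) \<and>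
     (\<forall>x y :: 'k. qabs (x * y) = qabs x * qabs y) \<and>
     (\<forall>q. qabs (of_rat q :: 'k) = rat_abs_at \<nu> q) \<and>
     closure (range (of_rat :: rat \<Rightarrow> 'k)) = UNIV"

section \<open>Norms and balls on \<open>\<rat>\<^sub>\<nu>\<^sup>d\<close>\<close>

text \<open>
  The maximum norm is the customary norm at every place; at \<open>\<nu> = \<infinity>\<close> the Euclidean
  norm is customary too, and both are admitted there. The metric of the class instance
  for \<^typ>\<open>'k ^ 'd\<close> is not used: it is always the Euclidean one, which is not ultrametric
  over the \<open>p\<close>-adic numbers. (The topology of the instance is the product topology and is
  the intended one.)
\<close>

definition max_norm :: "'k::{zero, metric_space} ^ 'd \<Rightarrow> real" where
  "max_norm x = Max (range (\<lambda>i. qabs (x $ i)))"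

definition euclid_norm :: "'k::{zero, metric_space} ^ 'd \<Rightarrow> real" where
  "euclid_norm x = L2_set (\<lambda>i. qabs (x $ i)) UNIV"

definition standard_norm :: "enat \<Rightarrow> ('k::{zero, metric_space} ^ 'd \<Rightarrow> real) \<Rightarrow> bool" where
  "standard_norm \<nu> N \<longleftrightarrow> N = max_norm \<or> (\<nu> = \<infinity> \<and> N = euclid_norm)"

definition nball :: "('a::minus \<Rightarrow> real) \<Rightarrow> 'a \<Rightarrow> real \<Rightarrow> 'a set" where
  "nball N x r = {y. N (y - x) < r}"

section \<open>\<open>C\<^sup>k\<close> maps\<close>

subsection \<open>Partial derivatives\<close>

definition has_partial ::
  "('k::{field, topological_space} ^ 'd \<Rightarrow> 'k) \<Rightarrow> 'd \<Rightarrow> 'k ^ 'd \<Rightarrow> 'k \<Rightarrow> bool" where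
  "has_partial f i x D \<longleftrightarrow> ((\<lambda>t. (f (x + axis i t) - f x) / t) \<longlongrightarrow> D) (at 0)"

definition partial ::
  "'d \<Rightarrow> ('k::{field, t2_space} ^ 'd \<Rightarrow> 'k) \<Rightarrow> 'k ^ 'd \<Rightarrow> 'k" where
  "partial i f x = Lim (at 0) (\<lambda>t. (f (x + axis i t) - f x) / t)"

text \<open>The partial derivative of order \<open>length is\<close>, one differentiation for each entry of the list.\<close>

definition iter_partial ::
  "'d list \<Rightarrow> ('k::{field, t2_space} ^ 'd \<Rightarrow> 'k) \<Rightarrow> 'k ^ 'd \<Rightarrow> 'k" where
  "iter_partial is f = foldr partial is f"

subsection \<open>The archimedean case\<close>

fun Ck_arch ::
  "nat \<Rightarrow> ('k::{field, t2_space} ^ 'd) set \<Rightarrow> ('k ^ 'd \<Rightarrow> 'k) \<Rightarrow> bool" where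
  "Ck_arch 0 U f \<longleftrightarrow> continuous_on U f"
| "Ck_arch (Suc k) U f \<longleftrightarrow>
     continuous_on U f \<and>
     (\<forall>i. (\<forall>x\<in>U. \<exists>D. has_partial f i x D) \<and> Ck_arch k U (partial i f))"

subsection \<open>The \<open>p\<close>-adic case: iterated difference quotients\<close>

text \<open>
  A function of \<open>\<beta> j + 1\<close> points in the \<open>j\<close>-th variable (for every \<open>j\<close>) is represented as a
  function of \<open>x :: 'd \<Rightarrow> nat \<Rightarrow> 'k\<close>, where \<open>x j 0, \<dots>, x j (\<beta> j)\<close> are the points of the \<open>j\<close>-th
  variable. \<open>diff_quot j\<close> passes from \<open>\<Phi>\<^sub>j\<^sup>i\<close> to \<open>\<Phi>\<^sub>j\<^sup>i\<^sup>+\<^sup>1\<close>: the defining recursion of \<open>\<Phi>\<^sup>k\<close> drops the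
  second, respectively the first, of the points.
\<close>

definition drop_at :: "nat \<Rightarrow> (nat \<Rightarrow> 'k) \<Rightarrow> nat \<Rightarrow> 'k" where
  "drop_at m s i = (if i < m then s i else s (Suc i))"

definition diff_quot ::
  "'d \<Rightarrow> (('d \<Rightarrow> nat \<Rightarrow> 'k::field) \<Rightarrow> 'k) \<Rightarrow> ('d \<Rightarrow> nat \<Rightarrow> 'k) \<Rightarrow> 'k" where
  "diff_quot j F x =
     (F (x(j := drop_at 1 (x j))) - F (x(j := drop_at 0 (x j)))) / (x j 0 - x j 1)"

text \<open>
  The operators for different variables commute, so the composition over all variables
  below does not depend on an order of the variables.
\<close>

lemma diff_quot_commute: "diff_quot i (diff_quot j F) = diff_quot j (diff_quot i F)"
proof (cases "i = j")
  case False
  show ?thesis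
  proof
    fix x
    show "diff_quot i (diff_quot j F) x = diff_quot j (diff_quot i F) x"
      using False
      by (simp add: diff_quot_def fun_upd_twist[of i j] diff_divide_distrib mult.commute
          divide_divide_eq_left)
  qed
qed simp

lemma diff_quot_funpow_commute:
  "(diff_quot i ^^ a) ((diff_quot j ^^ b) F) = (diff_quot j ^^ b) ((diff_quot i ^^ a) F)"
proof -
  have 1: "diff_quot i ((diff_quot j ^^ b) F) = (diff_quot j ^^ b) (diff_quot i F)" for F
    by (induction b) (simp_all add: diff_quot_commute[of i j])
  show ?thesis
    by (induction a) (simp_all add: 1)
qed

lemma comp_fun_commute_diff_quot: "comp_fun_commute (\<lambda>j. diff_quot j ^^ \<beta> j)"
  by unfold_locales (simp add: fun_eq_iff diff_quot_funpow_commute)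

definition Phi ::
  "('d::finite \<Rightarrow> nat) \<Rightarrow> ('k::field ^ 'd \<Rightarrow> 'k) \<Rightarrow> ('d \<Rightarrow> nat \<Rightarrow> 'k) \<Rightarrow> 'k" where
  "Phi \<beta> f = Finite_Set.fold (\<lambda>j. diff_quot j ^^ \<beta> j) (\<lambda>x. f (\<chi> j. x j 0)) UNIV"

lemma Phi_foldr:
  fixes f :: "'k::field ^ 'd::finite \<Rightarrow> 'k"
  assumes "distinct js" "set js = UNIV"
  shows "Phi \<beta> f = foldr (\<lambda>j. diff_quot j ^^ \<beta> j) js (\<lambda>x. f (\<chi> j. x j 0))"
proof -
  interpret comp_fun_commute "\<lambda>j. diff_quot j ^^ \<beta> j"
    by (rule comp_fun_commute_diff_quot)
  have "Finite_Set.fold (\<lambda>j. diff_quot j ^^ \<beta> j) F (set js)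
      = foldr (\<lambda>j. diff_quot j ^^ \<beta> j) js F" for F :: "('d \<Rightarrow> nat \<Rightarrow> 'k) \<Rightarrow> 'k"
    using assms(1) by (induction js) simp_all
  with assms(2) show ?thesis
    by (simp add: Phi_def)
qed

text \<open>
  The domain \<open>V\<^sub>1\<^bsup>i\<^sub>1+1\<^esup> \<times> \<dots> \<times> V\<^sub>d\<^bsup>i\<^sub>d+1\<^esup>\<close>; coordinates beyond \<open>\<beta> j\<close> are fixed to
  \<^const>\<open>undefined\<close>, so that the topology of \<^typ>\<open>'d \<Rightarrow> nat \<Rightarrow> 'k\<close> restricts to the product topology.
\<close>

definition grid :: "('d \<Rightarrow> nat) \<Rightarrow> ('d \<Rightarrow> 'k set) \<Rightarrow> ('d \<Rightarrow> nat \<Rightarrow> 'k) set" where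
  "grid \<beta> V = (\<Pi>\<^sub>E j\<in>UNIV. \<Pi>\<^sub>E m\<in>{..\<beta> j}. V j)"

definition Ck_product ::
  "nat \<Rightarrow> ('d::finite \<Rightarrow> 'k::{field, topological_space} set) \<Rightarrow> ('k ^ 'd \<Rightarrow> 'k) \<Rightarrow> bool" where
  "Ck_product k V f \<longleftrightarrow>
     (\<forall>\<beta>. (\<Sum>j\<in>UNIV. \<beta> j) \<le> k \<longrightarrow>
        (\<exists>G. continuous_on (grid \<beta> V) G \<and>
             (\<forall>x\<in>grid \<beta> V. (\<forall>j. inj_on (x j) {..\<beta> j}) \<longrightarrow> G x = Phi \<beta> f x)))"

definition Ck_nonarch ::
  "nat \<Rightarrow> ('k::{field, topological_space} ^ 'd::finite) set \<Rightarrow> ('k ^ 'd \<Rightarrow> 'k) \<Rightarrow> bool" where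
  "Ck_nonarch k U f \<longleftrightarrow>
     (\<forall>x\<in>U. \<exists>V. (\<forall>j. open (V j) \<and> x $ j \<in> V j) \<and> {y. \<forall>j. y $ j \<in> V j} \<subseteq> U \<and>
                Ck_product k V f)"

definition Ck_map ::
  "enat \<Rightarrow> nat \<Rightarrow> ('k::{field, t2_space} ^ 'd::finite) set \<Rightarrow> ('k ^ 'd \<Rightarrow> 'k ^ 'n) \<Rightarrow> bool" where
  "Ck_map \<nu> k U f \<longleftrightarrow>
     (\<forall>i. (if \<nu> = \<infinity> then Ck_arch k U (\<lambda>x. f x $ i) else Ck_nonarch k U (\<lambda>x. f x $ i)))"

section \<open>Nondegeneracy\<close>

definition nondegenerate_at ::
  "nat \<Rightarrow> ('k::{field, t2_space} ^ 'd \<Rightarrow> 'k ^ 'n) \<Rightarrow> 'k ^ 'd \<Rightarrow> bool" where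
  "nondegenerate_at l f x \<longleftrightarrow>
     vec.span {(\<chi> i. iter_partial is (\<lambda>y. f y $ i) x) | is. 1 \<le> length is \<and> length is \<le> l} = UNIV"

section \<open>Measures\<close>

definition locally_finite_borel :: "'a::topological_space measure \<Rightarrow> bool" where
  "locally_finite_borel M \<longleftrightarrow>
     sets M = sets borel \<and> (\<forall>x. \<exists>W. open W \<and> x \<in> W \<and> emeasure M W < \<infinity>)"

definition msupp :: "'a::topological_space measure \<Rightarrow> 'a set" where
  "msupp M = {x. \<forall>W. open W \<and> x \<in> W \<longrightarrow> emeasure M W > 0}"

definition Federer_on ::
  "('a::{minus, topological_space} \<Rightarrow> real) \<Rightarrow> 'a measure \<Rightarrow> real \<Rightarrow> 'a set \<Rightarrow> bool" where
  "Federer_on N M D U \<longleftrightarrow>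
     emeasure M U > 0 \<and>
     Sup {emeasure M (nball N x (3 * r)) / emeasure M (nball N x r) | x r.
            x \<in> msupp M \<and> r > 0 \<and> nball N x (3 * r) \<subseteq> U} < ennreal D"

text \<open>
  The supremum \<open>s\<close> of \<open>|f|\<close> over the ball is taken in \<^typ>\<open>ennreal\<close>; if it is infinite, then
  \<open>\<epsilon> / s = 0\<close> and the right-hand side is \<open>0\<close>.
\<close>

definition abs_good ::
  "('a::{minus, topological_space} \<Rightarrow> real) \<Rightarrow> 'a measure \<Rightarrow> real \<Rightarrow> real \<Rightarrow> 'a set
     \<Rightarrow> ('a \<Rightarrow> 'k::{zero, metric_space}) \<Rightarrow> bool" where
  "abs_good N M C \<alpha> U f \<longleftrightarrow>
     (\<forall>x r \<epsilon>. x \<in> msupp M \<and> r > 0 \<and> nball N x r \<subseteq> U \<and> \<epsilon> > 0 \<longrightarrow>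
        (let B = nball N x r; s = (SUP y\<in>B. ennreal (qabs (f y))) in
           s \<noteq> 0 \<longrightarrow>
           emeasure M {y\<in>B. qabs (f y) < \<epsilon>}
             \<le> ennreal (C * enn2real (ennreal \<epsilon> / s) powr \<alpha>) * emeasure M B))"

definition is_affine_function :: "('k::field ^ 'd \<Rightarrow> 'k) \<Rightarrow> bool" where
  "is_affine_function g \<longleftrightarrow> (\<exists>c a. \<forall>x. g x = c + (\<Sum>i\<in>UNIV. a $ i * x $ i))"

definition abs_decaying ::
  "('k::{field, metric_space} ^ 'd \<Rightarrow> real) \<Rightarrow> ('k ^ 'd) measure
     \<Rightarrow> real \<Rightarrow> real \<Rightarrow> ('k ^ 'd) set \<Rightarrow> bool" where
  "abs_decaying N M C \<alpha> U \<longleftrightarrow> (\<forall>g. is_affine_function g \<longrightarrow> abs_good N M C \<alpha> U g)"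

text \<open>\<open>\<L>\<^sub>f\<close>; its elements matter only on the domain of \<open>f\<close>.\<close>

definition affine_combinations :: "('a \<Rightarrow> 'k::field ^ 'n) \<Rightarrow> ('a \<Rightarrow> 'k) set" where
  "affine_combinations f = {\<lambda>x. c0 + (\<Sum>i\<in>UNIV. c $ i * f x $ i) | c0 c. True}"

section \<open>Models\<close>

subsection \<open>The real numbers\<close>

lemma is_Q_nu_real: "is_Q_nu \<infinity> TYPE(real)"
proof -
  have "closure (range (of_rat :: rat \<Rightarrow> real)) = UNIV"
  proof -
    have "x \<in> closure (range (of_rat :: rat \<Rightarrow> real))" for x :: real
      unfolding closure_approachable
    proof (intro allI impI)
      fix e :: real
      assume "e > 0"
      then obtain q where "x - e < of_rat q" "of_rat q < x"
        using of_rat_dense[of "x - e" x] by auto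
      then show "\<exists>y\<in>range (of_rat :: rat \<Rightarrow> real). dist y x < e"
        by (intro bexI[of _ "of_rat q"]) (simp_all add: dist_real_def)
    qed
    then show ?thesis
      by blast
  qed
  moreover have "is_place \<infinity>"
    by (simp add: is_place_def)
  moreover have "qabs x = \<bar>x\<bar>" for x :: real
    by (simp add: qabs_def dist_real_def)
  moreover have "rat_abs_at \<infinity> q = \<bar>of_rat q\<bar>" for q
    by (simp add: rat_abs_at_def)
  ultimately show ?thesis
    by (simp add: is_Q_nu_def dist_real_def abs_mult)
qed

subsection \<open>The \<open>p\<close>-adic absolute value on \<open>\<rat>\<close>\<close>

lemma rat_padic_abs_div:
  assumes "prime p" "a \<noteq> 0" "b \<noteq> 0"
  shows "rat_padic_abs p (of_int a / of_int b) =
           real p powi (int (multiplicity (int p) b) - int (multiplicity (int p) a))"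
proof -
  have "of_int a / of_int b = (0::rat) \<longleftrightarrow> False"
    using assms by simp
  obtain c d where cd: "quotient_of (of_int a / of_int b) = (c, d)"
    by (cases "quotient_of (of_int a / of_int b)")
  have d: "d > 0"
    using cd by (rule quotient_of_denom_pos)
  have eq: "of_int a / of_int b = (of_int c / of_int d :: rat)"
    using cd by (rule quotient_of_div)
  then have c: "c \<noteq> 0"
    using assms d by auto
  have "of_int (a * d) = (of_int (c * b) :: rat)"
    using eq d assms by (simp add: field_simps)
  then have "a * d = c * b"
    by (simp only: of_int_eq_iff)
  then have "multiplicity (int p) (a * d) = multiplicity (int p) (c * b)"
    by simp
  moreover have "prime_elem (int p)"
    using assms(1) by simp
  ultimately have "multiplicity (int p) a + multiplicity (int p) d =
      multiplicity (int p) c + multiplicity (int p) b"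
    using c d assms by (simp add: prime_elem_multiplicity_mult_distrib)
  then have "int (multiplicity (int p) d) - int (multiplicity (int p) c) =
      int (multiplicity (int p) b) - int (multiplicity (int p) a)"
    by linarith
  then show ?thesis
    using assms cd by (simp add: rat_padic_abs_def)
qed

lemma rat_as_quotient:
  fixes q :: rat
  obtains a b :: int where "q = of_int a / of_int b" "b \<noteq> 0"
proof -
  obtain c d where cd: "quotient_of q = (c, d)"
    by (cases "quotient_of q")
  show ?thesis
    using that[of c d] quotient_of_div[OF cd] quotient_of_denom_pos[OF cd] by simp
qed

lemma rat_padic_abs_0 [simp]: "rat_padic_abs p 0 = 0"
  by (simp add: rat_padic_abs_def)

lemma rat_padic_abs_eq_0_iff:
  assumes "prime p"
  shows "rat_padic_abs p q = 0 \<longleftrightarrow> q = 0"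
  using assms by (auto simp: rat_padic_abs_def power_int_eq_0_iff)

lemma rat_padic_abs_nonneg: "rat_padic_abs p q \<ge> 0"
  by (simp add: rat_padic_abs_def)

lemma rat_padic_abs_1: "prime p \<Longrightarrow> rat_padic_abs p 1 = 1"
  using rat_padic_abs_div[of p 1 1] by simp

lemma rat_padic_abs_minus: "prime p \<Longrightarrow> rat_padic_abs p (- q) = rat_padic_abs p q"
proof -
  assume p: "prime p"
  obtain a b where q: "q = of_int a / of_int b" "b \<noteq> 0"
    by (rule rat_as_quotient)
  show ?thesis
    using rat_padic_abs_div[OF p, of a b] rat_padic_abs_div[OF p, of "- a" b] q
      multiplicity_times_unit_right[of "- 1" "int p" a]
    by (cases "a = 0") simp_all
qed

lemma rat_padic_abs_mult:
  assumes p: "prime p"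
  shows "rat_padic_abs p (q * r) = rat_padic_abs p q * rat_padic_abs p r"
proof -
  obtain a b where q: "q = of_int a / of_int b" "b \<noteq> 0"
    by (rule rat_as_quotient)
  obtain c d where r: "r = of_int c / of_int d" "d \<noteq> 0"
    by (rule rat_as_quotient)
  show ?thesis
  proof (cases "a = 0 \<or> c = 0")
    case True
    then show ?thesis
      using q r by auto
  next
    case False
    have "q * r = of_int (a * c) / of_int (b * d)"
      using q r by simp
    then have "rat_padic_abs p (q * r) =
        real p powi (int (multiplicity (int p) (b * d)) - int (multiplicity (int p) (a * c)))"
      using rat_padic_abs_div[OF p, of "a * c" "b * d"] False q r by simp
    also have "\<dots> = real p powi ((int (multiplicity (int p) b) - int (multiplicity (int p) a)) +
          (int (multiplicity (int p) d) - int (multiplicity (int p) c)))"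
      using False q r p by (simp add: prime_elem_multiplicity_mult_distrib algebra_simps)
    also have "\<dots> = rat_padic_abs p q * rat_padic_abs p r"
      using False q r p prime_gt_0_nat[OF p]
      by (simp add: power_int_add rat_padic_abs_div)
    finally show ?thesis .
  qed
qed

lemma rat_padic_abs_add_le_max:
  assumes p: "prime p"
  shows "rat_padic_abs p (q + r) \<le> max (rat_padic_abs p q) (rat_padic_abs p r)"
proof -
  obtain a b where q: "q = of_int a / of_int b" "b \<noteq> 0"
    by (rule rat_as_quotient)
  obtain c d where r: "r = of_int c / of_int d" "d \<noteq> 0"
    by (rule rat_as_quotient)
  define m where "m = multiplicity (int p)"
  have q': "q = of_int (a * d) / of_int (b * d)" and r': "r = of_int (c * b) / of_int (b * d)"
    and s': "q + r = of_int (a * d + c * b) / of_int (b * d)"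
    using q r by (simp_all add: add_frac_eq mult.commute)
  show ?thesis
  proof (cases "q = 0 \<or> r = 0 \<or> q + r = 0")
    case True
    then show ?thesis
      by (elim disjE) (simp_all add: rat_padic_abs_nonneg le_max_iff_disj)
  next
    case False
    have "of_int (a * d + c * b) \<noteq> (0 :: rat)"
      using False s' by (metis div_0)
    then have nz: "a * d \<noteq> 0" "c * b \<noteq> 0" "a * d + c * b \<noteq> 0" "b * d \<noteq> 0"
      using False q r by (auto simp only: of_int_eq_0_iff) auto
    have np: "\<not> is_unit (int p)"
      using p using prime_gt_1_nat[OF p] by auto
    define k where "k = min (m (a * d)) (m (c * b))"
    have "int p ^ k dvd a * d" "int p ^ k dvd c * b"
      unfolding k_def m_def by (auto intro!: multiplicity_dvd')
    then have "int p ^ k dvd a * d + c * b"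
      by simp
    then have "k \<le> m (a * d + c * b)"
      unfolding m_def using nz np by (intro multiplicity_geI) auto
    then have "m (a * d + c * b) \<ge> m (a * d) \<or> m (a * d + c * b) \<ge> m (c * b)"
      unfolding k_def by linarith
    moreover have "real p \<ge> 1"
      using prime_ge_1_nat[OF p] by simp
    ultimately have
      "real p powi (int (m (b * d)) - int (m (a * d + c * b)))
         \<le> real p powi (int (m (b * d)) - int (m (a * d))) \<or>
       real p powi (int (m (b * d)) - int (m (a * d + c * b)))
         \<le> real p powi (int (m (b * d)) - int (m (c * b)))"
      by (auto intro!: power_int_increasing)
    then show ?thesis
      unfolding s' unfolding q' r'
      using rat_padic_abs_div[OF p nz(1) nz(4)] rat_padic_abs_div[OF p nz(2) nz(4)]
        rat_padic_abs_div[OF p nz(3) nz(4)]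
      unfolding m_def le_max_iff_disj by simp
  qed
qed

lemma rat_padic_abs_triangle:
  "prime p \<Longrightarrow> rat_padic_abs p (q + r) \<le> rat_padic_abs p q + rat_padic_abs p r"
  using rat_padic_abs_add_le_max[of p q r] rat_padic_abs_nonneg[of p q] rat_padic_abs_nonneg[of p r]
  by linarith

subsection \<open>The \<open>p\<close>-adic numbers, for \<open>p = CARD('p)\<close>\<close>

class prime_card =
  assumes prime_card: "prime CARD('a)"

definition pabs :: "'p::prime_card itself \<Rightarrow> rat \<Rightarrow> real" where
  "pabs T = rat_padic_abs CARD('p)"

lemma
  shows pabs_0 [simp]: "pabs T 0 = 0"
    and pabs_1 [simp]: "pabs T 1 = 1"
    and pabs_eq_0_iff [simp]: "pabs T q = 0 \<longleftrightarrow> q = 0"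
    and pabs_nonneg [simp]: "pabs T q \<ge> 0"
    and pabs_minus [simp]: "pabs T (- q) = pabs T q"
    and pabs_mult: "pabs T (q * r) = pabs T q * pabs T r"
    and pabs_triangle: "pabs T (q + r) \<le> pabs T q + pabs T r"
  by (simp_all add: pabs_def prime_card rat_padic_abs_1 rat_padic_abs_eq_0_iff
      rat_padic_abs_nonneg rat_padic_abs_minus rat_padic_abs_mult rat_padic_abs_triangle)

lemma pabs_diff_commute: "pabs T (q - r) = pabs T (r - q)"
  using pabs_minus[of T "q - r"] by simp

lemma pabs_diff_triangle: "pabs T (q - s) \<le> pabs T (q - r) + pabs T (r - s)"
  using pabs_triangle[of T "q - r" "r - s"] by simp

lemma pabs_abs_diff: "\<bar>pabs T q - pabs T r\<bar> \<le> pabs T (q - r)"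
  using pabs_triangle[of T "q - r" r] pabs_triangle[of T "r - q" q] pabs_diff_commute[of T q r]
  by auto

lemma pabs_inverse: "pabs T (inverse q) = inverse (pabs T q)"
proof (cases "q = 0")
  case False
  then have "pabs T q * pabs T (inverse q) = 1"
    by (simp flip: pabs_mult)
  then show ?thesis
    by (simp add: inverse_unique)
qed simp

definition pvanish :: "'p::prime_card itself \<Rightarrow> (nat \<Rightarrow> rat) \<Rightarrow> bool" where
  "pvanish T X \<longleftrightarrow> (\<lambda>n. pabs T (X n)) \<longlonglongrightarrow> 0"

definition pcauchy :: "'p::prime_card itself \<Rightarrow> (nat \<Rightarrow> rat) \<Rightarrow> bool" where
  "pcauchy T X \<longleftrightarrow> (\<forall>e>0. \<exists>K. \<forall>m\<ge>K. \<forall>n\<ge>K. pabs T (X m - X n) < e)"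

definition padic_rel ::
  "'p::prime_card itself \<Rightarrow> (nat \<Rightarrow> rat) \<Rightarrow> (nat \<Rightarrow> rat) \<Rightarrow> bool" where
  "padic_rel T X Y \<longleftrightarrow> pcauchy T X \<and> pcauchy T Y \<and> pvanish T (\<lambda>n. X n - Y n)"

lemma pvanish_bound:
  assumes "g \<longlonglongrightarrow> 0" "\<And>n. pabs T (X n) \<le> g n"
  shows "pvanish T X"
  unfolding pvanish_def
  by (rule tendsto_sandwich[OF _ _ tendsto_const assms(1)]) (auto simp: assms(2))

lemma pvanish_add:
  assumes "pvanish T X" "pvanish T Y"
  shows "pvanish T (\<lambda>n. X n + Y n)"
  by (rule pvanish_bound[of "\<lambda>n. pabs T (X n) + pabs T (Y n)"])
    (use tendsto_add[of _ 0 _ _ 0] assms in \<open>auto simp: pvanish_def pabs_triangle\<close>)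

lemma pvanish_minus: "pvanish T X \<Longrightarrow> pvanish T (\<lambda>n. - X n)"
  by (simp add: pvanish_def)

lemma pcauchy_const [simp]: "pcauchy T (\<lambda>n. q)"
  by (simp add: pcauchy_def)

lemma pcauchy_add:
  assumes "pcauchy T X" "pcauchy T Y"
  shows "pcauchy T (\<lambda>n. X n + Y n)"
  unfolding pcauchy_def
proof (intro allI impI)
  fix e :: real
  assume "e > 0"
  then obtain K L where K: "\<And>m n. m \<ge> K \<Longrightarrow> n \<ge> K \<Longrightarrow> pabs T (X m - X n) < e / 2"
    and L: "\<And>m n. m \<ge> L \<Longrightarrow> n \<ge> L \<Longrightarrow> pabs T (Y m - Y n) < e / 2"
    using assms unfolding pcauchy_def by (meson half_gt_zero)
  have "pabs T (X m + Y m - (X n + Y n)) < e" if "m \<ge> max K L" "n \<ge> max K L" for m n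
    using pabs_triangle[of T "X m - X n" "Y m - Y n"] K[of m n] L[of m n] that
    by (simp add: algebra_simps)
  then show "\<exists>K. \<forall>m\<ge>K. \<forall>n\<ge>K. pabs T (X m + Y m - (X n + Y n)) < e"
    by blast
qed

lemma pcauchy_minus: "pcauchy T X \<Longrightarrow> pcauchy T (\<lambda>n. - X n)"
proof -
  have "pabs T (- X m - - X n) = pabs T (X m - X n)" for m n
    using pabs_minus[of T "X m - X n"] by simp
  then show "pcauchy T X \<Longrightarrow> pcauchy T (\<lambda>n. - X n)"
    by (simp only: pcauchy_def)
qed

lemma pcauchy_convergent:
  assumes "pcauchy T X"
  shows "convergent (\<lambda>n. pabs T (X n))"
proof -
  have "Cauchy (\<lambda>n. pabs T (X n))"
    unfolding Cauchy_def dist_real_def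
    using assms unfolding pcauchy_def by (meson pabs_abs_diff order_le_less_trans)
  then show ?thesis
    by (rule real_Cauchy_convergent)
qed

lemma pcauchy_bounded:
  assumes "pcauchy T X"
  obtains B where "B > 0" "\<And>n. pabs T (X n) \<le> B"
proof -
  have "Bseq (\<lambda>n. pabs T (X n))"
    using pcauchy_convergent[OF assms] by (rule convergent_imp_Bseq)
  then show ?thesis
    using that by (auto elim!: BseqE)
qed

lemma pvanish_mult:
  assumes "pcauchy T X" "pvanish T Y"
  shows "pvanish T (\<lambda>n. X n * Y n)"
proof -
  obtain B where B: "B > 0" "\<And>n. pabs T (X n) \<le> B"
    using pcauchy_bounded[OF assms(1)] by metis
  show ?thesis
    by (rule pvanish_bound[of "\<lambda>n. B * pabs T (Y n)"])
      (use assms(2) B tendsto_mult_right_zero in \<open>auto simp: pvanish_def pabs_mult mult_right_mono\<close>)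
qed

lemma pcauchy_mult:
  assumes "pcauchy T X" "pcauchy T Y"
  shows "pcauchy T (\<lambda>n. X n * Y n)"
  unfolding pcauchy_def
proof (intro allI impI)
  fix e :: real
  assume e: "e > 0"
  obtain A where A: "A > 0" "\<And>n. pabs T (X n) \<le> A"
    using pcauchy_bounded[OF assms(1)] by metis
  obtain B where B: "B > 0" "\<And>n. pabs T (Y n) \<le> B"
    using pcauchy_bounded[OF assms(2)] by metis
  have "e / (2 * B) > 0" "e / (2 * A) > 0"
    using A B e by auto
  then obtain K L where K: "\<And>m n. m \<ge> K \<Longrightarrow> n \<ge> K \<Longrightarrow> pabs T (X m - X n) < e / (2 * B)"
    and L: "\<And>m n. m \<ge> L \<Longrightarrow> n \<ge> L \<Longrightarrow> pabs T (Y m - Y n) < e / (2 * A)"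
    using assms unfolding pcauchy_def by meson
  have "pabs T (X m * Y m - X n * Y n) < e" if "m \<ge> max K L" "n \<ge> max K L" for m n
  proof -
    have "X m * Y m - X n * Y n = X m * (Y m - Y n) + (X m - X n) * Y n"
      by (simp add: algebra_simps)
    then have "pabs T (X m * Y m - X n * Y n) \<le>
        pabs T (X m) * pabs T (Y m - Y n) + pabs T (X m - X n) * pabs T (Y n)"
      by (metis pabs_mult pabs_triangle)
    also have "\<dots> \<le> A * pabs T (Y m - Y n) + pabs T (X m - X n) * B"
      using A B by (intro add_mono mult_mono) auto
    also have "\<dots> < A * (e / (2 * A)) + (e / (2 * B)) * B"
      using K[of m n] L[of m n] that A(1) B(1)
      by (intro add_strict_mono mult_strict_left_mono mult_strict_right_mono) auto
    also have "\<dots> = e"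
      using A(1) B(1) by simp
    finally show ?thesis .
  qed
  then show "\<exists>K. \<forall>m\<ge>K. \<forall>n\<ge>K. pabs T (X m * Y m - X n * Y n) < e"
    by blast
qed

lemma pcauchy_not_pvanish:
  assumes "pcauchy T X" "\<not> pvanish T X"
  obtains b K where "b > 0" "\<And>n. n \<ge> K \<Longrightarrow> pabs T (X n) > b"
proof -
  obtain L where L: "(\<lambda>n. pabs T (X n)) \<longlonglongrightarrow> L"
    using pcauchy_convergent[OF assms(1)] by (auto simp: convergent_def)
  have "L \<ge> 0"
    using L by (rule LIMSEQ_le_const) auto
  moreover have "L \<noteq> 0"
    using L assms(2) by (auto simp: pvanish_def)
  ultimately have "L > 0"
    by simp
  then have "eventually (\<lambda>n. pabs T (X n) > L / 2) sequentially"
    using L by (intro order_tendstoD) auto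
  with \<open>L > 0\<close> show ?thesis
    using that[of "L / 2"] by (auto simp: eventually_sequentially)
qed

lemma pcauchy_inverse:
  assumes "pcauchy T X" "\<not> pvanish T X"
  shows "pcauchy T (\<lambda>n. inverse (X n))"
  unfolding pcauchy_def
proof (intro allI impI)
  fix e :: real
  assume e: "e > 0"
  obtain b K where b: "b > 0" "\<And>n. n \<ge> K \<Longrightarrow> pabs T (X n) > b"
    using pcauchy_not_pvanish[OF assms] by metis
  have "b * e * b > 0"
    using b e by simp
  then obtain L where L: "\<And>m n. m \<ge> L \<Longrightarrow> n \<ge> L \<Longrightarrow> pabs T (X m - X n) < b * e * b"
    using assms(1) unfolding pcauchy_def by meson
  have "pabs T (inverse (X m) - inverse (X n)) < e" if "m \<ge> max K L" "n \<ge> max K L" for m n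
  proof -
    have mn: "pabs T (X m) > b" "pabs T (X n) > b"
      using b that by auto
    then have nz: "X m \<noteq> 0" "X n \<noteq> 0"
      using b(1) by auto
    have "inverse (X m) - inverse (X n) = inverse (X m) * (X n - X m) * inverse (X n)"
      using nz by (simp add: field_simps)
    then have "pabs T (inverse (X m) - inverse (X n)) =
        inverse (pabs T (X m)) * pabs T (X n - X m) * inverse (pabs T (X n))"
      by (simp add: pabs_mult pabs_inverse)
    also have "\<dots> \<le> inverse b * pabs T (X n - X m) * inverse b"
      using mn b(1) by (intro mult_mono le_imp_inverse_le) auto
    also have "\<dots> < inverse b * (b * e * b) * inverse b"
      using L[of n m] that b(1) by (intro mult_strict_right_mono mult_strict_left_mono) auto
    also have "\<dots> = e"
      using b(1) by simp
    finally show ?thesis .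
  qed
  then show "\<exists>K. \<forall>m\<ge>K. \<forall>n\<ge>K. pabs T (inverse (X m) - inverse (X n)) < e"
    by blast
qed

lemma padic_rel_refl [simp]: "padic_rel T X X \<longleftrightarrow> pcauchy T X"
  by (simp add: padic_rel_def pvanish_def)

lemma padic_rel_sym: "padic_rel T X Y \<Longrightarrow> padic_rel T Y X"
  by (simp add: padic_rel_def pvanish_def pabs_diff_commute)

lemma padic_rel_trans: "padic_rel T X Y \<Longrightarrow> padic_rel T Y Z \<Longrightarrow> padic_rel T X Z"
  using pvanish_add[of T "\<lambda>n. X n - Y n" "\<lambda>n. Y n - Z n"] by (simp add: padic_rel_def)

lemma padic_rel_pvanish_iff: "padic_rel T X Y \<Longrightarrow> pvanish T X \<longleftrightarrow> pvanish T Y"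
  using pvanish_add[of T "\<lambda>n. X n - Y n" Y] pvanish_add[of T "\<lambda>n. Y n - X n" X] padic_rel_sym[of T X Y]
  by (auto simp: padic_rel_def)

lemma padic_rel_inverse:
  assumes "padic_rel T X Y" "\<not> pvanish T X"
  shows "padic_rel T (\<lambda>n. inverse (X n)) (\<lambda>n. inverse (Y n))"
proof -
  have X: "pcauchy T X" and Y: "pcauchy T Y" and XY: "pvanish T (\<lambda>n. Y n - X n)"
    using assms(1) padic_rel_sym[OF assms(1)] by (auto simp: padic_rel_def)
  have Y': "\<not> pvanish T Y"
    using assms padic_rel_pvanish_iff by blast
  obtain a K where a: "a > 0" "\<And>n. n \<ge> K \<Longrightarrow> pabs T (X n) > a"
    using pcauchy_not_pvanish[OF X assms(2)] by metis
  obtain b L where b: "b > 0" "\<And>n. n \<ge> L \<Longrightarrow> pabs T (Y n) > b"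
    using pcauchy_not_pvanish[OF Y Y'] by metis
  have X': "pcauchy T (\<lambda>n. inverse (X n))" and Y'': "pcauchy T (\<lambda>n. inverse (Y n))"
    using X Y Y' assms(2) by (auto intro: pcauchy_inverse)
  have "pvanish T (\<lambda>n. (inverse (X n) * inverse (Y n)) * (Y n - X n))"
    by (intro pvanish_mult pcauchy_mult X' Y'' XY)
  moreover have "\<forall>\<^sub>F n in sequentially. pabs T ((inverse (X n) * inverse (Y n)) * (Y n - X n)) =
      pabs T (inverse (X n) - inverse (Y n))"
    using eventually_ge_at_top[of "max K L"]
  proof eventually_elim
    case (elim n)
    then have "X n \<noteq> 0" "Y n \<noteq> 0"
      using a(1) a(2)[of n] b(1) b(2)[of n] by auto
    then have "(inverse (X n) * inverse (Y n)) * (Y n - X n) = inverse (X n) - inverse (Y n)"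
      by (simp add: field_simps)
    then show ?case
      by simp
  qed
  ultimately have "pvanish T (\<lambda>n. inverse (X n) - inverse (Y n))"
    unfolding pvanish_def by (rule Lim_transform_eventually)
  with X' Y'' show ?thesis
    by (simp add: padic_rel_def)
qed

text \<open>The argument of type \<^typ>\<open>'p itself\<close> only records the prime in the type.\<close>

definition padic_eq ::
  "('p::prime_card itself \<Rightarrow> nat \<Rightarrow> rat) \<Rightarrow> ('p itself \<Rightarrow> nat \<Rightarrow> rat) \<Rightarrow> bool" where
  "padic_eq X Y \<longleftrightarrow> padic_rel TYPE('p) (X TYPE('p)) (Y TYPE('p))"

quotient_type (overloaded) 'p padic = "'p::prime_card itself \<Rightarrow> nat \<Rightarrow> rat" / partial: padic_eq
proof (rule part_equivpI)
  show "\<exists>X :: 'p itself \<Rightarrow> nat \<Rightarrow> rat. padic_eq X X"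
    by (rule exI[of _ "\<lambda>_ _. 0"]) (simp add: padic_eq_def)
  show "symp (padic_eq :: ('p itself \<Rightarrow> nat \<Rightarrow> rat) \<Rightarrow> _)"
    by (auto intro!: sympI simp: padic_eq_def dest: padic_rel_sym)
  show "transp (padic_eq :: ('p itself \<Rightarrow> nat \<Rightarrow> rat) \<Rightarrow> _)"
    by (auto intro!: transpI simp: padic_eq_def dest: padic_rel_trans)
qed

instantiation padic :: (prime_card) field
begin

lift_definition zero_padic :: "'a padic" is "\<lambda>_ n. 0"
  by (simp add: padic_eq_def)

lift_definition one_padic :: "'a padic" is "\<lambda>_ n. 1"
  by (simp add: padic_eq_def)

lift_definition plus_padic :: "'a padic \<Rightarrow> 'a padic \<Rightarrow> 'a padic" is "\<lambda>X Y T n. X T n + Y T n"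
  subgoal for X X' Y Y'
    using pvanish_add[of "TYPE('a)" "\<lambda>n. X TYPE('a) n - X' TYPE('a) n" "\<lambda>n. Y TYPE('a) n - Y' TYPE('a) n"]
    by (auto simp: padic_eq_def padic_rel_def pcauchy_add add_diff_add)
  done

lift_definition uminus_padic :: "'a padic \<Rightarrow> 'a padic" is "\<lambda>X T n. - X T n"
  subgoal for X Y
    using pvanish_minus[of "TYPE('a)" "\<lambda>n. X TYPE('a) n - Y TYPE('a) n"]
    by (auto simp: padic_eq_def padic_rel_def pcauchy_minus)
  done

lift_definition times_padic :: "'a padic \<Rightarrow> 'a padic \<Rightarrow> 'a padic" is "\<lambda>X Y T n. X T n * Y T n"
  subgoal for X X' Y Y'
    using pvanish_add[OF pvanish_mult[of "TYPE('a)" "X TYPE('a)" "\<lambda>n. Y TYPE('a) n - Y' TYPE('a) n"]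
        pvanish_mult[of "TYPE('a)" "Y' TYPE('a)" "\<lambda>n. X TYPE('a) n - X' TYPE('a) n"]]
    by (auto simp: padic_eq_def padic_rel_def pcauchy_mult algebra_simps)
  done

lift_definition inverse_padic :: "'a padic \<Rightarrow> 'a padic" is
  "\<lambda>X T n. if pvanish TYPE('a) (X TYPE('a)) then 0 else inverse (X T n)"
  subgoal for X Y
    using padic_rel_pvanish_iff[of "TYPE('a)" "X TYPE('a)" "Y TYPE('a)"] padic_rel_inverse[of "TYPE('a)" "X TYPE('a)" "Y TYPE('a)"]
    by (auto simp: padic_eq_def)
  done

definition minus_padic :: "'a padic \<Rightarrow> 'a padic \<Rightarrow> 'a padic" where
  "minus_padic x y = x + - y"

definition divide_padic :: "'a padic \<Rightarrow> 'a padic \<Rightarrow> 'a padic" where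
  "divide_padic x y = x * inverse y"

instance
proof
  fix x y z :: "'a padic"
  show "x * y * z = x * (y * z)"
    by transfer (simp add: padic_eq_def pcauchy_mult mult.assoc)
  show "x * y = y * x"
    by transfer (simp add: padic_eq_def pcauchy_mult mult.commute)
  show "1 * x = x"
    by transfer (simp add: padic_eq_def)
  show "x + y + z = x + (y + z)"
    by transfer (simp add: padic_eq_def pcauchy_add add.assoc)
  show "x + y = y + x"
    by transfer (simp add: padic_eq_def pcauchy_add add.commute)
  show "0 + x = x"
    by transfer (simp add: padic_eq_def)
  show "- x + x = 0"
    by transfer (simp add: padic_eq_def)
  show "(x + y) * z = x * z + y * z"
    by transfer (simp add: padic_eq_def pcauchy_add pcauchy_mult distrib_right)
  show "(0 :: 'a padic) \<noteq> 1"
    by transfer (auto simp: padic_eq_def padic_rel_def pvanish_def LIMSEQ_const_iff)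
  show "inverse (0 :: 'a padic) = 0"
    by transfer (simp add: padic_eq_def pvanish_def)
  show "x - y = x + - y" "x div y = x * inverse y"
    by (rule minus_padic_def divide_padic_def)+
  show "x \<noteq> 0 \<Longrightarrow> inverse x * x = 1"
  proof (transfer, goal_cases)
    case (1 X')
    define X where "X = X' TYPE('a)"
    from 1 have X: "pcauchy TYPE('a) X" and nz: "\<not> pvanish TYPE('a) X"
      by (auto simp: X_def padic_eq_def padic_rel_def)
    obtain b K where b: "b > 0" "\<And>n. n \<ge> K \<Longrightarrow> pabs TYPE('a) (X n) > b"
      using pcauchy_not_pvanish[OF X nz] by metis
    have "\<forall>\<^sub>F n in sequentially. 0 = pabs TYPE('a) (inverse (X n) * X n - 1)"
      using eventually_ge_at_top[of K]
    proof eventually_elim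
      case (elim n)
      then have "X n \<noteq> 0"
        using b(1) b(2)[of n] by auto
      then show ?case
        by simp
    qed
    then have "pvanish TYPE('a) (\<lambda>n. inverse (X n) * X n - 1)"
      unfolding pvanish_def by (rule Lim_transform_eventually[OF tendsto_const])
    then show ?case
      using X nz by (simp add: padic_eq_def X_def[symmetric] padic_rel_def pcauchy_mult pcauchy_inverse)
  qed
qed

end

lift_definition padic_of_rat :: "rat \<Rightarrow> 'p::prime_card padic" is "\<lambda>q _ n. q"
  by (simp add: padic_eq_def)

lift_definition padic_norm :: "'p::prime_card padic \<Rightarrow> real" is
  "\<lambda>X. lim (\<lambda>n. pabs TYPE('p) (X TYPE('p) n))"
proof -
  fix X' Y' :: "'p itself \<Rightarrow> nat \<Rightarrow> rat"
  define X Y where "X = X' TYPE('p)" and "Y = Y' TYPE('p)"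
  assume "padic_eq X' Y'"
  then have rel: "padic_rel TYPE('p) X Y"
    by (simp add: padic_eq_def X_def Y_def)
  then have "convergent (\<lambda>n. pabs TYPE('p) (Y n))"
    by (simp add: padic_rel_def pcauchy_convergent)
  then obtain L where L: "(\<lambda>n. pabs TYPE('p) (Y n)) \<longlonglongrightarrow> L"
    by (auto simp: convergent_def)
  have "(\<lambda>n. pabs TYPE('p) (X n) - pabs TYPE('p) (Y n)) \<longlonglongrightarrow> 0"
  proof (rule Lim_null_comparison)
    show "(\<lambda>n. pabs TYPE('p) (X n - Y n)) \<longlonglongrightarrow> 0"
      using rel by (simp add: padic_rel_def pvanish_def)
  qed (simp add: pabs_abs_diff)
  from tendsto_add[OF this L] have "(\<lambda>n. pabs TYPE('p) (X n)) \<longlonglongrightarrow> L"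
    by simp
  with L show "lim (\<lambda>n. pabs TYPE('p) (X' TYPE('p) n)) = lim (\<lambda>n. pabs TYPE('p) (Y' TYPE('p) n))"
    by (simp add: limI X_def Y_def)
qed

definition padic_lim :: "(nat \<Rightarrow> rat) \<Rightarrow> 'p::prime_card padic" where
  "padic_lim X = abs_padic (\<lambda>_. X)"

lemma padic_exhaust:
  fixes x :: "'p::prime_card padic"
  obtains X where "pcauchy TYPE('p) X" "x = padic_lim X"
proof -
  obtain X where X: "padic_eq X X" "x = abs_padic X"
    by (induction x rule: padic.abs_induct) blast
  then have "padic_eq X (\<lambda>_. X TYPE('p))"
    by (simp add: padic_eq_def)
  then have "x = padic_lim (X TYPE('p))"
    using X(2) Quotient3_rel_abs[OF Quotient3_padic] by (simp add: padic_lim_def)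
  with X(1) show ?thesis
    by (intro that) (simp_all add: padic_eq_def)
qed

lemma padic_norm_tendsto:
  assumes "pcauchy TYPE('p) X"
  shows "(\<lambda>n. pabs TYPE('p) (X n)) \<longlonglongrightarrow> padic_norm (padic_lim X :: 'p::prime_card padic)"
  using pcauchy_convergent[OF assms] assms
  by (simp add: padic_norm.abs_eq padic_lim_def padic_eq_def eq_onp_def convergent_LIMSEQ_iff)

lemma padic_norm_of_rat: "padic_norm (padic_of_rat q :: 'p::prime_card padic) = pabs TYPE('p) q"
  by transfer simp

lemma padic_norm_mult:
  fixes x y :: "'p::prime_card padic"
  shows "padic_norm (x * y) = padic_norm x * padic_norm y"
proof -
  obtain X where X: "pcauchy TYPE('p) X" "x = padic_lim X"
    by (rule padic_exhaust)
  obtain Y where Y: "pcauchy TYPE('p) Y" "y = padic_lim Y"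
    by (rule padic_exhaust)
  have "x * y = padic_lim (\<lambda>n. X n * Y n)"
    using X Y by (simp add: times_padic.abs_eq padic_lim_def padic_eq_def)
  then show ?thesis
    using LIMSEQ_unique[OF padic_norm_tendsto[OF pcauchy_mult[OF X(1) Y(1)]]]
      tendsto_mult[OF padic_norm_tendsto[OF X(1)] padic_norm_tendsto[OF Y(1)]] X Y
    by (simp add: pabs_mult)
qed

lemma padic_norm_triangle:
  fixes x y :: "'p::prime_card padic"
  shows "padic_norm (x + y) \<le> padic_norm x + padic_norm y"
proof -
  obtain X where X: "pcauchy TYPE('p) X" "x = padic_lim X"
    by (rule padic_exhaust)
  obtain Y where Y: "pcauchy TYPE('p) Y" "y = padic_lim Y"
    by (rule padic_exhaust)
  have "x + y = padic_lim (\<lambda>n. X n + Y n)"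
    using X Y by (simp add: plus_padic.abs_eq padic_lim_def padic_eq_def)
  then show ?thesis
    using LIMSEQ_le[OF padic_norm_tendsto[OF pcauchy_add[OF X(1) Y(1)]]
      tendsto_add[OF padic_norm_tendsto[OF X(1)] padic_norm_tendsto[OF Y(1)]]] X Y
    by (auto simp: pabs_triangle)
qed

lemma padic_norm_eq_0_iff:
  fixes x :: "'p::prime_card padic"
  shows "padic_norm x = 0 \<longleftrightarrow> x = 0"
proof -
  obtain X where X: "pcauchy TYPE('p) X" "x = padic_lim X"
    by (rule padic_exhaust)
  have "x = 0 \<longleftrightarrow> padic_rel TYPE('p) X (\<lambda>n. 0)"
    using X(1) Quotient3_rel[OF Quotient3_padic, of "\<lambda>_ :: 'p itself. X" "\<lambda>_ n. 0"]
    by (simp add: X(2) padic_lim_def zero_padic_def padic_eq_def)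
  also have "\<dots> \<longleftrightarrow> padic_norm x = 0"
    using X padic_norm_tendsto[OF X(1)]
    by (auto simp: padic_rel_def pvanish_def intro: LIMSEQ_unique)
  finally show ?thesis
    by simp
qed

lemma padic_of_rat_diff: "padic_of_rat (q - r) = padic_of_rat q - padic_of_rat r"
  unfolding minus_padic_def by transfer (simp add: padic_eq_def)

lemma padic_of_rat_mult: "padic_of_rat (q * r) = padic_of_rat q * padic_of_rat r"
  by transfer (simp add: padic_eq_def)

lemma padic_of_rat_of_nat: "padic_of_rat (of_nat n) = (of_nat n :: 'p::prime_card padic)"
proof (induction n)
  case 0
  show ?case
    by simp (transfer, simp add: padic_eq_def)
next
  case (Suc n)
  have "padic_of_rat (1 + of_nat n) = 1 + (padic_of_rat (of_nat n) :: 'p padic)"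
    by transfer (simp add: padic_eq_def)
  with Suc show ?case
    by simp
qed

lemma padic_norm_minus:
  fixes x :: "'p::prime_card padic"
  shows "padic_norm (- x) = padic_norm x"
proof -
  have "padic_norm (- 1 :: 'p padic) = 1"
    by transfer simp
  then show ?thesis
    using padic_norm_mult[of "- 1" x] by simp
qed

instance padic :: (prime_card) field_char_0
proof
  show "inj (of_nat :: nat \<Rightarrow> 'a padic)"
  proof (rule injI)
    fix m n
    assume "of_nat m = (of_nat n :: 'a padic)"
    then have "padic_of_rat (of_nat m - of_nat n) = (0 :: 'a padic)"
      by (simp add: padic_of_rat_diff padic_of_rat_of_nat)
    then have "pabs TYPE('a) (of_nat m - of_nat n) = 0"
      by (simp flip: padic_norm_of_rat add: padic_norm_eq_0_iff)
    then show "m = n"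
      by simp
  qed
qed

lemma padic_of_rat_eq_of_rat: "padic_of_rat q = (of_rat q :: 'p::prime_card padic)"
proof -
  have int: "padic_of_rat (of_int a) = (of_int a :: 'p padic)" for a
    by (cases a rule: int_diff_cases) (simp add: padic_of_rat_diff padic_of_rat_of_nat)
  obtain a b where q: "q = of_int a / of_int b" "b \<noteq> 0"
    by (rule rat_as_quotient)
  then have "q * of_int b = of_int a"
    by simp
  then have "padic_of_rat q * of_int b = (of_int a :: 'p padic)"
    by (simp flip: int padic_of_rat_mult)
  with q(2) have "padic_of_rat q = (of_int a / of_int b :: 'p padic)"
    by (simp add: eq_divide_eq)
  also have "\<dots> = of_rat q"
    by (simp add: q(1) of_rat_divide)
  finally show ?thesis .
qed

instantiation padic :: (prime_card) metric_space
begin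

definition dist_padic :: "'a padic \<Rightarrow> 'a padic \<Rightarrow> real" where
  "dist_padic x y = padic_norm (x - y)"

definition uniformity_padic :: "('a padic \<times> 'a padic) filter" where
  "uniformity_padic = (INF e\<in>{0 <..}. principal {(x, y). dist x y < e})"

definition open_padic :: "'a padic set \<Rightarrow> bool" where
  "open_padic U \<longleftrightarrow> (\<forall>x\<in>U. eventually (\<lambda>(x', y). x' = x \<longrightarrow> y \<in> U) uniformity)"

instance
proof
  show "uniformity = (INF e\<in>{0 <..}. principal {(x :: 'a padic, y). dist x y < e})"
    by (rule uniformity_padic_def)
  show "open U \<longleftrightarrow> (\<forall>x\<in>U. eventually (\<lambda>(x', y). x' = x \<longrightarrow> y \<in> U) uniformity)" for U :: "'a padic set"
    by (rule open_padic_def)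
  show "dist x y = 0 \<longleftrightarrow> x = y" for x y :: "'a padic"
    by (simp add: dist_padic_def padic_norm_eq_0_iff)
  show "dist x y \<le> dist x z + dist y z" for x y z :: "'a padic"
    using padic_norm_triangle[of "x - z" "z - y"] padic_norm_minus[of "y - z"]
    by (simp add: dist_padic_def)
qed

end

lemma padic_dense_seq:
  assumes "pcauchy TYPE('p::prime_card) X" "e > 0"
  shows "\<exists>K. \<forall>k\<ge>K. padic_norm (padic_lim X - of_rat (X k) :: 'p padic) < e"
proof -
  obtain K where K: "\<And>m n. m \<ge> K \<Longrightarrow> n \<ge> K \<Longrightarrow> pabs TYPE('p) (X m - X n) < e / 2"
    using assms unfolding pcauchy_def by (meson half_gt_zero)
  have "padic_norm (padic_lim X - of_rat (X k) :: 'p padic) < e" if k: "k \<ge> K" for k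
  proof -
    have c: "pcauchy TYPE('p) (\<lambda>n. X n + - X k)"
      using assms(1) by (intro pcauchy_add pcauchy_const)
    have "padic_lim X - of_rat (X k) = (padic_lim (\<lambda>n. X n + - X k) :: 'p padic)"
      using assms(1)
      by (simp add: minus_padic_def plus_padic.abs_eq padic_lim_def uminus_padic.abs_eq padic_lim_def padic_of_rat.abs_eq padic_lim_def
          padic_eq_def flip: padic_of_rat_eq_of_rat)
    then have "(\<lambda>n. pabs TYPE('p) (X n - X k)) \<longlonglongrightarrow>
        padic_norm (padic_lim X - of_rat (X k) :: 'p padic)"
      using padic_norm_tendsto[OF c] by simp
    then have "padic_norm (padic_lim X - of_rat (X k) :: 'p padic) \<le> e / 2"
      using K k by (intro LIMSEQ_le_const2) (auto intro!: exI[of _ K] less_imp_le)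
    then show ?thesis
      using assms(2) by simp
  qed
  then show ?thesis
    by blast
qed

lemma padic_dense:
  fixes x :: "'p::prime_card padic"
  assumes "e > 0"
  shows "\<exists>q. dist x (of_rat q) < e"
proof -
  obtain X where "pcauchy TYPE('p) X" "x = padic_lim X"
    by (rule padic_exhaust)
  then show ?thesis
    using padic_dense_seq[of X e] assms by (auto simp: dist_padic_def)
qed

instance padic :: (prime_card) complete_space
proof
  fix X :: "nat \<Rightarrow> 'a padic"
  assume X: "Cauchy X"
  have "\<forall>n. \<exists>q. dist (X n) (of_rat q) < inverse (real (Suc n))"
    by (intro allI padic_dense) simp
  then obtain q where q: "\<And>n. dist (X n) (of_rat (q n)) < inverse (real (Suc n))"
    by metis
  have q0: "(\<lambda>n. dist (X n) (of_rat (q n))) \<longlonglongrightarrow> 0"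
    using less_imp_le[OF q]
    by (intro tendsto_sandwich[OF _ _ tendsto_const LIMSEQ_inverse_real_of_nat] always_eventually)
      simp_all
  have "pcauchy TYPE('a) q"
    unfolding pcauchy_def
  proof (intro allI impI)
    fix e :: real
    assume "e > 0"
    then have e: "e / 3 > 0"
      by simp
    obtain K where K: "\<And>m n. m \<ge> K \<Longrightarrow> n \<ge> K \<Longrightarrow> dist (X m) (X n) < e / 3"
      using X e unfolding Cauchy_def by meson
    obtain L where L: "\<And>n. n \<ge> L \<Longrightarrow> dist (X n) (of_rat (q n)) < e / 3"
      using order_tendstoD(2)[OF q0 e] by (auto simp: eventually_sequentially)
    have "pabs TYPE('a) (q m - q n) < e" if "m \<ge> max K L" "n \<ge> max K L" for m n
    proof -
      have "pabs TYPE('a) (q m - q n) = dist (of_rat (q m)) (of_rat (q n) :: 'a padic)"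
        by (simp add: dist_padic_def padic_norm_of_rat padic_of_rat_diff
            flip: padic_of_rat_eq_of_rat)
          (simp flip: padic_of_rat_diff add: padic_norm_of_rat)
      also have "\<dots> \<le> dist (X m) (of_rat (q m)) + dist (X m) (X n) + dist (X n) (of_rat (q n))"
        using dist_triangle[of "of_rat (q m)" "of_rat (q n)" "X m"]
          dist_triangle[of "X m" "of_rat (q n)" "X n"]
        by (simp add: dist_commute)
      also have "\<dots> < e"
        using K[of m n] L[of m] L[of n] that by simp
      finally show ?thesis .
    qed
    then show "\<exists>K. \<forall>m\<ge>K. \<forall>n\<ge>K. pabs TYPE('a) (q m - q n) < e"
      by blast
  qed
  then have "(\<lambda>n. of_rat (q n)) \<longlonglongrightarrow> (padic_lim q :: 'a padic)"
    unfolding lim_sequentially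
    using padic_dense_seq[where 'p = 'a and X = q] by (simp add: dist_commute[of "of_rat _"]) (simp add: dist_padic_def)
  then have "(\<lambda>n. dist (of_rat (q n)) (padic_lim q :: 'a padic)) \<longlonglongrightarrow> 0"
    by (simp flip: tendsto_dist_iff)
  from tendsto_add[OF q0 this]
  have "(\<lambda>n. dist (X n) (of_rat (q n)) + dist (of_rat (q n)) (padic_lim q :: 'a padic)) \<longlonglongrightarrow> 0"
    by simp
  then have "(\<lambda>n. dist (X n) (padic_lim q :: 'a padic)) \<longlonglongrightarrow> 0"
  proof (rule Lim_null_comparison[rotated])
    have "norm (dist (X n) (padic_lim q)) \<le> dist (X n) (of_rat (q n)) + dist (of_rat (q n)) (padic_lim q :: 'a padic)"
      for n
      by (simp add: dist_triangle)
    then show "\<forall>\<^sub>F n in sequentially. norm (dist (X n) (padic_lim q)) \<le>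
        dist (X n) (of_rat (q n)) + dist (of_rat (q n)) (padic_lim q :: 'a padic)"
      by (rule always_eventually[OF allI])
  qed
  then have "X \<longlonglongrightarrow> padic_lim q"
    by (rule tendsto_dist_iff[THEN iffD2])
  then show "convergent X"
    by (rule convergentI)
qed

lemma is_Q_nu_padic: "is_Q_nu (enat CARD('p)) TYPE('p::prime_card padic)"
proof -
  have q: "qabs x = padic_norm x" for x :: "'p padic"
    by (simp add: qabs_def dist_padic_def)
  have "x \<in> closure (range of_rat)" for x :: "'p padic"
    unfolding closure_approachable
  proof (intro allI impI)
    fix e :: real
    assume "e > 0"
    then obtain q where "dist x (of_rat q) < e"
      using padic_dense by blast
    then show "\<exists>y\<in>range of_rat. dist y x < e"
      by (auto simp: dist_commute)
  qed
  moreover have "qabs (of_rat q :: 'p padic) = rat_abs_at (enat CARD('p)) q" for q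
    using padic_norm_of_rat[of q, where ?'p = 'p]
    by (simp add: q rat_abs_at_def pabs_def padic_of_rat_eq_of_rat)
  ultimately show ?thesis
    by (auto simp: is_Q_nu_def is_place_def prime_card q dist_padic_def padic_norm_mult)
qed

end

theory Submission
  imports Defs
begin

text \<open>
  At both kinds of places a \<open>C\<^sup>l\<^sup>+\<^sup>1\<close> function has, locally uniformly, a Taylor expansion of
  degree \<open>l\<close> with remainder \<open>O(\<parallel>h\<parallel>\<^sup>l\<^sup>+\<^sup>1)\<close>; this is all that is used of it. Comparing the
  expansions at two points shows that their coefficients \<open>G \<gamma>\<close> have Taylor expansions
  themselves, and hence are the iterated partial derivatives of the function up to factorials. Nondegeneracy bounds
  some \<open>G \<gamma>\<close> from below, uniformly over the normalised elements of \<open>\<L>\<^sub>f\<close>.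

  Now rescale a small ball to radius \<open>1\<close> and \<open>g\<close> to supremum \<open>1\<close>. Then at each point all
  \<open>G \<gamma>\<close> are bounded above, and one of them is bounded below. Choose thresholds
  \<open>\<delta>\<^sub>j = e powr t\<^sub>j\<close> with \<open>t\<^sub>0 = 1\<close> and \<open>t\<^sub>l = 0\<close>. Where \<open>\<bar>g\<bar> < \<delta>\<^sub>0\<close>, some \<open>G \<beta>\<close> with
  \<open>\<bar>\<beta>\<bar> = j < l\<close> is smaller than \<open>\<delta>\<^sub>j\<close> while one of its partial derivatives is larger than
  \<open>\<delta>\<^sub>j\<^sub>+\<^sub>1\<close>. On balls of radius about \<open>sqrt \<delta>\<^sub>j\<close> such a \<open>G \<beta>\<close> is affine up to
  \<open>O(\<delta>\<^sub>j)\<close>, so the decay condition bounds the proportion of bad points there by a constant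
  times \<open>(sqrt \<delta>\<^sub>j / \<delta>\<^sub>j\<^sub>+\<^sub>1) powr \<alpha>\<close>, and a Vitali covering with the Federer condition sums
  these bounds up. All the exponents \<open>t\<^sub>j / 2 - t\<^sub>j\<^sub>+\<^sub>1\<close> can be made equal, namely to
  \<open>1 / (2\<^sup>l\<^sup>+\<^sup>1 - 2)\<close>.
\<close>

section \<open>The absolute value and the maximum norm\<close>

text \<open>The obstacle is uniformity: \<open>V\<close> has to be chosen before \<open>g\<close>,
  and the remainder of \<open>g\<close> must be small against its supremum \<open>s\<close> on the
  ball. Let \<open>m\<close> be the size of \<open>(c_1, ..., c_n)\<close>. The remainder is
  \<open>O(m r^(l+1))\<close>. Nondegeneracy keeps some coefficient of positive degree, which does
  not see \<open>c_0\<close>, at least \<open>c m\<close>; since a polynomial bounded on a ball has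
  bounded coefficients, \<open>s\<close> dominates \<open>m r^l\<close>. So the remainder is
  \<open>O(r)\<close> relative to \<open>s\<close>, for all \<open>g\<close> at once. The radius
  \<open>sqrt \<delta>_j\<close> is the largest scale on which a quadratic error stays within
  \<open>O(\<delta>_j)\<close>. This square root is the source of the powers of 2:
  \<open>t_j + 2 theta\<close> is halved from each degree to the next, and the values at 0 and
  \<open>l\<close> fix \<open>theta\<close>. At a prime place the value group is discrete, a ball
  does not determine its radius, and nonzero integers can be small; this accounts for the factors
  \<open>qabs unif\<close> and \<open>suc_min\<close>, and for a fixed scaling element in place of
  arbitrary real scalings.\<close>

locale Q_nu =
  fixes \<nu> :: enat and T :: "'k::{field_char_0, complete_space} itself"
  assumes is_Q: "is_Q_nu \<nu> T"
begin

lemma dist_eq_qabs: "dist x y = qabs (x - y :: 'k)"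
  using is_Q by (simp add: is_Q_nu_def)

lemma qabs_mult: "qabs (x * y :: 'k) = qabs x * qabs y"
  using is_Q by (simp add: is_Q_nu_def)

lemma qabs_of_rat: "qabs (of_rat q :: 'k) = rat_abs_at \<nu> q"
  using is_Q by (simp add: is_Q_nu_def)

lemma rat_dense:
  assumes "e > 0"
  shows "\<exists>q. qabs (x - of_rat q :: 'k) < e"
proof -
  have "x \<in> closure (range of_rat)"
    using is_Q by (simp add: is_Q_nu_def)
  then show ?thesis
    using assms by (force simp: closure_approachable dist_commute simp flip: dist_eq_qabs)
qed

lemma qabs_zero [simp]: "qabs (0::'k) = 0"
  by (simp add: qabs_def)

lemma qabs_nonneg [simp]: "qabs (x::'k) \<ge> 0"
  by (simp add: qabs_def)

lemma qabs_eq_0_iff [simp]: "qabs (x::'k) = 0 \<longleftrightarrow> x = 0"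
  by (simp add: qabs_def)

lemma qabs_pos_iff [simp]: "qabs (x::'k) > 0 \<longleftrightarrow> x \<noteq> 0"
  by (simp add: qabs_def)

lemma qabs_one [simp]: "qabs (1::'k) = 1"
  using qabs_mult[of 1 1] by simp

lemma qabs_minus [simp]: "qabs (- x::'k) = qabs x"
proof -
  have "qabs (-1 :: 'k) ^ 2 = 1"
    using qabs_mult[of "-1" "-1"] by (simp add: power2_eq_square)
  then have "qabs (-1 :: 'k) = 1"
    using qabs_nonneg[of "-1"] unfolding power2_eq_1_iff by linarith
  then show ?thesis
    using qabs_mult[of "-1" x] by simp
qed

lemma qabs_minus_commute: "qabs (x - y::'k) = qabs (y - x)"
  by (metis minus_diff_eq qabs_minus)

lemma qabs_triangle: "qabs (x + y :: 'k) \<le> qabs x + qabs y"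
  using dist_triangle[of x "-y" 0] by (simp add: dist_eq_qabs)

lemma qabs_diff_triangle: "qabs (x - y :: 'k) \<le> qabs x + qabs y"
  using qabs_triangle[of x "-y"] by simp

lemma qabs_power: "qabs (x ^ n :: 'k) = qabs x ^ n"
  by (induction n) (simp_all add: qabs_mult)

lemma qabs_prod: "qabs (prod f I :: 'k) = (\<Prod>i\<in>I. qabs (f i))"
  by (induction I rule: infinite_finite_induct) (simp_all add: qabs_mult)

lemma qabs_divide: "qabs (x / y :: 'k) = qabs x / qabs y"
  using qabs_mult[of "x / y" y] by (cases "y = 0") (simp_all add: field_simps)

lemma qabs_sum: "qabs (sum f I :: 'k) \<le> (\<Sum>i\<in>I. qabs (f i))"
  by (induction I rule: infinite_finite_induct)
    (simp_all add: order_trans[OF qabs_triangle])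

lemma qabs_sum_bound:
  assumes "\<And>i. i \<in> I \<Longrightarrow> qabs (f i :: 'k) \<le> B"
  shows "qabs (sum f I) \<le> real (card I) * B"
  using qabs_sum[of f I] sum_bounded_above[of I "\<lambda>i. qabs (f i)" B] assms by simp

lemma exists_small: "\<exists>a::'k. 0 < qabs a \<and> qabs a < 1"
proof (cases \<nu>)
  case (enat p)
  then have p: "prime p"
    using is_Q by (simp add: is_Q_nu_def is_place_def)
  have "quotient_of (of_nat p) = (int p, 1)"
    using quotient_of_int[of "int p"] by simp
  moreover have "multiplicity (int p) (int p) = 1"
    using p by (intro multiplicity_self) auto
  ultimately have "rat_padic_abs p (of_nat p) = inverse (real p)"
    using p by (simp add: rat_padic_abs_def power_int_def)
  then have *: "qabs (of_rat (of_nat p) :: 'k) = inverse (real p)"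
    using enat by (simp only: qabs_of_rat rat_abs_at_def enat.case)
  have "1 < p"
    using p prime_gt_1_nat by blast
  then show ?thesis
    by (intro exI[of _ "of_rat (of_nat p)"]) (simp only: *, simp add: field_simps)
next
  case infinity
  have "qabs (of_rat (1 / 2) :: 'k) = 1 / 2"
    unfolding qabs_of_rat by (simp add: infinity rat_abs_at_def of_rat_divide)
  then show ?thesis
    by (intro exI[of _ "of_rat (1 / 2)"]) auto
qed

text \<open>A fixed scaling element serves both places: the value group may be discrete, so radii
  are matched by absolute values only up to the factor \<open>qabs unif\<close>.\<close>

definition unif :: 'k where
  "unif = (SOME a. 0 < qabs a \<and> qabs a < 1)"

lemma unif: "unif \<noteq> 0" "0 < qabs unif" "qabs unif < 1"
  using someI_ex[OF exists_small] unfolding unif_def by auto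

text \<open>The quotients \<open>unif ^ k / unif ^ m\<close> have absolute values in geometric
  progression; for a fixed large \<open>m\<close>, the first one below \<open>r\<close> satisfies
  the lower bound because its predecessor is still at least \<open>r\<close>.\<close>

lemma exists_of_size:
  assumes "r > 0"
  shows "\<exists>z::'k. qabs unif * r \<le> qabs z \<and> qabs z < r"
proof -
  have ex_k: "\<exists>k. qabs unif ^ k / qabs unif ^ m < r" for m
  proof -
    have "r * qabs unif ^ m > 0" using assms unif by simp
    from real_arch_pow_inv[OF this unif(3)] obtain k where "qabs unif ^ k < r * qabs unif ^ m"
      by blast
    then show ?thesis
      using unif(2) by (intro exI[of _ k]) (simp add: pos_divide_less_eq)
  qed
  obtain m where m: "(1 / qabs unif) ^ m > r"
    using real_arch_pow[of "1 / qabs unif" r] unif(2,3) by auto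
  obtain k0 where k0: "qabs unif ^ k0 / qabs unif ^ m < r"
    using ex_k by blast
  define k where "k = (LEAST k. qabs unif ^ k / qabs unif ^ m < r)"
  have k: "qabs unif ^ k / qabs unif ^ m < r"
    unfolding k_def using k0 by (rule LeastI)
  have "k \<noteq> 0"
  proof
    assume "k = 0"
    with k m show False by (simp add: power_one_over)
  qed
  then obtain k' where k': "k = Suc k'" by (cases k) auto
  then have "\<not> qabs unif ^ k' / qabs unif ^ m < r"
    unfolding k_def by (metis lessI not_less_Least)
  then have "qabs unif * r \<le> qabs unif * (qabs unif ^ k' / qabs unif ^ m)"
    by (intro mult_left_mono) auto
  then have "qabs unif * r \<le> qabs unif ^ k / qabs unif ^ m"
    by (simp add: k')
  with k show ?thesis
    by (intro exI[of _ "unif ^ k / unif ^ m"]) (simp add: qabs_divide qabs_power)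
qed

section \<open>The maximum norm\<close>

lemma qabs_le_max_norm: "qabs (x $ i :: 'k) \<le> max_norm x"
  by (simp add: max_norm_def)

lemma max_norm_le_iff: "max_norm x \<le> B \<longleftrightarrow> (\<forall>i. qabs (x $ i :: 'k) \<le> B)"
  by (auto simp: max_norm_def)

lemma max_norm_less_iff: "max_norm x < B \<longleftrightarrow> (\<forall>i. qabs (x $ i :: 'k) < B)"
  by (auto simp: max_norm_def)

lemma max_norm_nonneg [simp]: "max_norm (x :: 'k ^ 'd::finite) \<ge> 0"
  by (rule order_trans[OF qabs_nonneg qabs_le_max_norm])

lemma max_norm_zero [simp]: "max_norm (0 :: 'k ^ 'd::finite) = 0"
  by (simp add: max_norm_def)

lemma max_norm_eq_0_iff [simp]: "max_norm (x :: 'k ^ 'd::finite) = 0 \<longleftrightarrow> x = 0"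
proof
  assume "max_norm x = 0"
  then show "x = 0"
    using qabs_le_max_norm[of x] by (auto simp: vec_eq_iff order_antisym_conv[OF qabs_nonneg])
qed simp

lemma max_norm_triangle: "max_norm (x + y :: 'k ^ 'd::finite) \<le> max_norm x + max_norm y"
  unfolding max_norm_le_iff
  by (auto intro!: order_trans[OF qabs_triangle] add_mono qabs_le_max_norm)

lemma max_norm_minus_commute: "max_norm (x - y :: 'k ^ 'd::finite) = max_norm (y - x)"
  unfolding max_norm_def by (simp add: qabs_minus_commute)

lemma max_norm_triangle_via:
  "max_norm (x - z :: 'k ^ 'd::finite) \<le> max_norm (x - y) + max_norm (y - z)"
  using max_norm_triangle[of "x - y" "y - z"] by simp

lemma max_norm_axis [simp]: "max_norm (axis i z :: 'k ^ 'd::finite) = qabs z"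
proof (rule antisym)
  show "max_norm (axis i z :: 'k ^ 'd) \<le> qabs z"
    by (simp add: max_norm_le_iff axis_def)
  show "qabs z \<le> max_norm (axis i z :: 'k ^ 'd)"
    using qabs_le_max_norm[of "axis i z :: 'k ^ 'd" i] by (simp add: axis_def)
qed

end

section \<open>Polynomials in several variables\<close>

definition mdeg :: "('d::finite \<Rightarrow> nat) \<Rightarrow> nat" where
  "mdeg \<gamma> = (\<Sum>i\<in>UNIV. \<gamma> i)"

definition MI :: "nat \<Rightarrow> ('d::finite \<Rightarrow> nat) set" where
  "MI n = {\<gamma>. mdeg \<gamma> \<le> n}"

definition monom_at :: "'k::comm_monoid_mult ^ 'd \<Rightarrow> ('d::finite \<Rightarrow> nat) \<Rightarrow> 'k" where
  "monom_at h \<gamma> = (\<Prod>i\<in>UNIV. h $ i ^ \<gamma> i)"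

lemma mdeg_component_le: "\<gamma> i \<le> mdeg \<gamma>"
  unfolding mdeg_def by (rule member_le_sum) auto

lemma finite_MI [simp]: "finite (MI n :: ('d::finite \<Rightarrow> nat) set)"
proof (rule finite_subset)
  show "MI n \<subseteq> (PiE UNIV (\<lambda>_. {..n}) :: ('d \<Rightarrow> nat) set)"
    by (auto simp: MI_def intro!: order_trans[OF mdeg_component_le])
qed (simp add: finite_PiE)

lemma mdeg_zero [simp]: "mdeg (\<lambda>_. 0) = 0"
  by (simp add: mdeg_def)

lemma mdeg_eq_0_iff: "mdeg \<gamma> = 0 \<longleftrightarrow> \<gamma> = (\<lambda>_. 0)"
  by (auto simp: mdeg_def)

lemma mdeg_add: "mdeg (\<lambda>i. \<beta> i + \<gamma> i) = mdeg \<beta> + mdeg \<gamma>"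
  by (simp add: mdeg_def sum.distrib)

lemma monom_at_zero [simp]: "monom_at h (\<lambda>_. 0) = 1"
  by (simp add: monom_at_def)

context Q_nu
begin

lemma qabs_monom_at_le: "qabs (monom_at (h :: 'k ^ 'd::finite) \<gamma>) \<le> max_norm h ^ mdeg \<gamma>"
proof -
  have "qabs (monom_at h \<gamma>) \<le> (\<Prod>i\<in>UNIV. max_norm h ^ \<gamma> i)"
    unfolding monom_at_def qabs_prod qabs_power
    by (intro prod_mono) (simp add: power_mono qabs_le_max_norm)
  then show ?thesis
    by (simp add: mdeg_def power_sum)
qed

text \<open>Every monomial is an eigenvector of this substitution, with eigenvalue
  \<open>unif ^ \<gamma> j\<close>, and cubes about 0 are mapped into themselves. Distinct exponents
  give distinct eigenvalues, so monomials can be separated without differentiating or dividing by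
  integers.\<close>

definition dilate :: "'d \<Rightarrow> 'k ^ 'd \<Rightarrow> 'k ^ 'd::finite" where
  "dilate j h = (\<chi> i. if i = j then unif * h $ i else h $ i)"

lemma monom_at_dilate: "monom_at (dilate j h) \<gamma> = unif ^ \<gamma> j * monom_at h \<gamma>"
proof -
  have "monom_at (dilate j h) \<gamma> = (\<Prod>i\<in>UNIV. (if i = j then unif ^ \<gamma> i else 1) * h $ i ^ \<gamma> i)"
    unfolding monom_at_def by (intro prod.cong) (auto simp: dilate_def power_mult_distrib)
  then show ?thesis
    by (simp add: prod.distrib monom_at_def)
qed

lemma max_norm_dilate_le: "max_norm (dilate j h) \<le> max_norm h"
  unfolding max_norm_le_iff
proof
  fix i
  have "qabs (unif * h $ j) \<le> qabs (h $ j)"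
    using unif by (simp add: qabs_mult mult_left_le_one_le)
  then show "qabs (dilate j h $ i) \<le> max_norm h"
    using qabs_le_max_norm[of h i] by (auto simp: dilate_def)
qed

lemma unif_power_inj: "unif ^ m = unif ^ n \<longleftrightarrow> m = n"
proof
  assume "unif ^ m = unif ^ n"
  then have "qabs unif ^ m = qabs unif ^ n"
    by (simp flip: qabs_power)
  then show "m = n"
    using unif power_strict_decreasing[of m n "qabs unif"] power_strict_decreasing[of n m "qabs unif"]
    by (cases m n rule: linorder_cases) auto
qed simp

text \<open>A monomial \<open>\<eta>\<close> is eliminated by \<open>P(h) \<mapsto> P(dilate j h) - unif ^ \<eta> j P(h)\<close>.\<close>

lemma coeff_bound_one:
  fixes S :: "('d::finite \<Rightarrow> nat) set"
  assumes "finite S" "\<gamma> \<in> S"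
  shows "\<exists>K>0. \<forall>(c :: ('d \<Rightarrow> nat) \<Rightarrow> 'k) r M. r > 0 \<longrightarrow>
           (\<forall>h. max_norm h < r \<longrightarrow> qabs (\<Sum>\<delta>\<in>S. c \<delta> * monom_at h \<delta>) \<le> M) \<longrightarrow>
           qabs (c \<gamma>) * r ^ mdeg \<gamma> \<le> K * M"
  using assms
proof (induction "card S" arbitrary: S rule: less_induct)
  case less
  show ?case
  proof (cases "S = {\<gamma>}")
    case True
    show ?thesis
    proof (intro exI[of _ "1 / qabs unif ^ mdeg \<gamma>"] conjI allI impI)
      fix c :: "('d \<Rightarrow> nat) \<Rightarrow> 'k" and r M
      assume r: "r > 0" and b: "\<forall>h. max_norm h < r \<longrightarrow> qabs (\<Sum>\<delta>\<in>S. c \<delta> * monom_at h \<delta>) \<le> M"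
      \<comment> \<open>All coordinates of the test point have the same size, within a factor
        \<open>qabs unif\<close> of \<open>r\<close>; this is the origin of the constant.\<close>
      obtain z :: 'k where z: "qabs unif * r \<le> qabs z" "qabs z < r"
        using exists_of_size[OF r] by blast
      have "max_norm (\<chi> i::'d. z) < r"
        using z by (simp add: max_norm_less_iff)
      with b have "qabs (c \<gamma>) * qabs z ^ mdeg \<gamma> \<le> M"
        by (auto simp: True qabs_mult monom_at_def qabs_power mdeg_def simp flip: power_sum)
      moreover have "qabs (c \<gamma>) * (qabs unif * r) ^ mdeg \<gamma> \<le> qabs (c \<gamma>) * qabs z ^ mdeg \<gamma>"
        using z r unif by (intro mult_left_mono power_mono) auto
      ultimately show "qabs (c \<gamma>) * r ^ mdeg \<gamma> \<le> 1 / qabs unif ^ mdeg \<gamma> * M"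
        using unif by (simp add: field_simps power_mult_distrib)
    qed (use unif in auto)
  next
    case False
    then obtain \<eta> where \<eta>: "\<eta> \<in> S" "\<eta> \<noteq> \<gamma>"
      using less.prems by blast
    then obtain j where j: "\<eta> j \<noteq> \<gamma> j"
      by (auto simp: fun_eq_iff)
    have "card (S - {\<eta>}) < card S" "finite (S - {\<eta>})" "\<gamma> \<in> S - {\<eta>}"
      using \<eta> less.prems card_Diff1_less[of S \<eta>] by auto
    from less.hyps[OF this] obtain K where K: "K > 0"
      and *: "\<And>(c :: ('d \<Rightarrow> nat) \<Rightarrow> 'k) r M. r > 0 \<Longrightarrow>
           (\<forall>h. max_norm h < r \<longrightarrow> qabs (\<Sum>\<delta>\<in>S - {\<eta>}. c \<delta> * monom_at h \<delta>) \<le> M) \<Longrightarrow>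
           qabs (c \<gamma>) * r ^ mdeg \<gamma> \<le> K * M"
      by blast
    define q where "q = qabs (unif ^ \<gamma> j - unif ^ \<eta> j)"
    have q: "q > 0"
      using j by (simp add: q_def unif_power_inj)
    \<comment> \<open>The difference that eliminates \<open>\<eta>\<close> is at most
      \<open>2 * M\<close>, and \<open>q\<close> is the size of the factor it puts on the
      coefficient of \<open>\<gamma>\<close>.\<close>
    show ?thesis
    proof (intro exI[of _ "2 * K / q"] conjI allI impI)
      fix c :: "('d \<Rightarrow> nat) \<Rightarrow> 'k" and r M
      assume r: "r > 0" and b: "\<forall>h. max_norm h < r \<longrightarrow> qabs (\<Sum>\<delta>\<in>S. c \<delta> * monom_at h \<delta>) \<le> M"
      have "qabs (c \<gamma> * (unif ^ \<gamma> j - unif ^ \<eta> j)) * r ^ mdeg \<gamma> \<le> K * (2 * M)"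
      proof (rule *[OF r], intro allI impI)
        fix h :: "'k ^ 'd"
        assume h: "max_norm h < r"
        have "(\<Sum>\<delta>\<in>S - {\<eta>}. c \<delta> * (unif ^ \<delta> j - unif ^ \<eta> j) * monom_at h \<delta>)
            = (\<Sum>\<delta>\<in>S. c \<delta> * (unif ^ \<delta> j - unif ^ \<eta> j) * monom_at h \<delta>)"
          using less.prems by (intro sum.mono_neutral_left) auto
        also have "\<dots> = (\<Sum>\<delta>\<in>S. c \<delta> * monom_at (dilate j h) \<delta>)
            - unif ^ \<eta> j * (\<Sum>\<delta>\<in>S. c \<delta> * monom_at h \<delta>)"
          by (simp add: monom_at_dilate sum_distrib_left algebra_simps flip: sum_subtractf)
        finally have eq: "(\<Sum>\<delta>\<in>S - {\<eta>}. c \<delta> * (unif ^ \<delta> j - unif ^ \<eta> j) * monom_at h \<delta>)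
            = (\<Sum>\<delta>\<in>S. c \<delta> * monom_at (dilate j h) \<delta>)
            - unif ^ \<eta> j * (\<Sum>\<delta>\<in>S. c \<delta> * monom_at h \<delta>)" .
        have 1: "qabs (\<Sum>\<delta>\<in>S. c \<delta> * monom_at (dilate j h) \<delta>) \<le> M"
          using b h max_norm_dilate_le[of j h] by simp
        have 2: "qabs (\<Sum>\<delta>\<in>S. c \<delta> * monom_at h \<delta>) \<le> M"
          using b h by simp
        have "qabs (unif ^ \<eta> j * (\<Sum>\<delta>\<in>S. c \<delta> * monom_at h \<delta>)) \<le> 1 * M"
          unfolding qabs_mult using 2 unif
          by (intro mult_mono) (auto simp: qabs_power power_le_one)
        with 1 show "qabs (\<Sum>\<delta>\<in>S - {\<eta>}. c \<delta> * (unif ^ \<delta> j - unif ^ \<eta> j) * monom_at h \<delta>) \<le> 2 * M"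
          unfolding eq using qabs_diff_triangle[of "\<Sum>\<delta>\<in>S. c \<delta> * monom_at (dilate j h) \<delta>"] 
          by (smt (verit))
      qed
      then show "qabs (c \<gamma>) * r ^ mdeg \<gamma> \<le> 2 * K / q * M"
        using q unfolding qabs_mult q_def[symmetric] by (simp add: field_simps)
    qed (use K q in auto)
  qed
qed

text \<open>Equivalence of the supremum norm and the coefficient norm on polynomials of degree at
  most \<open>l\<close>. The weights \<open>r ^ mdeg \<gamma>\<close> make the constant independent
  of the radius, on which the later rescaling arguments rely.\<close>

lemma coeff_bound:
  "\<exists>K>0. \<forall>(c :: ('d::finite \<Rightarrow> nat) \<Rightarrow> 'k) r M. r > 0 \<longrightarrow>
     (\<forall>h. max_norm h < r \<longrightarrow> qabs (\<Sum>\<delta>\<in>MI l. c \<delta> * monom_at h \<delta>) \<le> M) \<longrightarrow>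
     (\<forall>\<gamma>\<in>MI l. qabs (c \<gamma>) * r ^ mdeg \<gamma> \<le> K * M)"
proof -
  have "\<forall>\<gamma>\<in>MI l. \<exists>K>0. \<forall>(c :: ('d \<Rightarrow> nat) \<Rightarrow> 'k) r M. r > 0 \<longrightarrow>
     (\<forall>h. max_norm h < r \<longrightarrow> qabs (\<Sum>\<delta>\<in>MI l. c \<delta> * monom_at h \<delta>) \<le> M) \<longrightarrow>
     qabs (c \<gamma>) * r ^ mdeg \<gamma> \<le> K * M"
    using coeff_bound_one[OF finite_MI] by blast
  from bchoice[OF this] obtain K where K: "\<And>\<gamma>. \<gamma> \<in> MI l \<Longrightarrow> K \<gamma> > 0"
    "\<And>(c :: ('d \<Rightarrow> nat) \<Rightarrow> 'k) r M \<gamma>. \<gamma> \<in> MI l \<Longrightarrow> r > 0 \<Longrightarrow>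
     (\<forall>h. max_norm h < r \<longrightarrow> qabs (\<Sum>\<delta>\<in>MI l. c \<delta> * monom_at h \<delta>) \<le> M) \<Longrightarrow>
     qabs (c \<gamma>) * r ^ mdeg \<gamma> \<le> K \<gamma> * M"
    by blast
  have K0: "sum K (MI l) \<ge> 0"
    using K(1) by (intro sum_nonneg) (auto intro: less_imp_le)
  show ?thesis
  proof (intro exI[of _ "1 + sum K (MI l)"] conjI allI impI ballI)
    fix c :: "('d \<Rightarrow> nat) \<Rightarrow> 'k" and r M and \<gamma> :: "'d \<Rightarrow> nat"
    assume r: "r > 0" and \<gamma>: "\<gamma> \<in> MI l"
      and b: "\<forall>h. max_norm h < r \<longrightarrow> qabs (\<Sum>\<delta>\<in>MI l. c \<delta> * monom_at h \<delta>) \<le> M"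
    have "M \<ge> 0"
      using order_trans[OF qabs_nonneg b[rule_format, of 0]] r by simp
    moreover have "K \<gamma> \<le> 1 + sum K (MI l)"
      using member_le_sum[of \<gamma> "MI l" K] \<gamma> K(1) by (force intro: less_imp_le)
    ultimately show "qabs (c \<gamma>) * r ^ mdeg \<gamma> \<le> (1 + sum K (MI l)) * M"
      by (intro order_trans[OF K(2)[OF \<gamma> r b]] mult_right_mono)
  qed (use K0 in auto)
qed

text \<open>A fixed choice, so that the constants built from it visibly do not depend on
  \<open>g\<close> or on the ball.\<close>

definition coeff_const :: "'d::finite itself \<Rightarrow> nat \<Rightarrow> real" where
  "coeff_const t l = (SOME K. K > 0 \<and> (\<forall>(c :: ('d \<Rightarrow> nat) \<Rightarrow> 'k) r M. r > 0 \<longrightarrow>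
     (\<forall>h. max_norm h < r \<longrightarrow> qabs (\<Sum>\<delta>\<in>MI l. c \<delta> * monom_at h \<delta>) \<le> M) \<longrightarrow>
     (\<forall>\<gamma>\<in>MI l. qabs (c \<gamma>) * r ^ mdeg \<gamma> \<le> K * M)))"

lemma coeff_const:
  shows "coeff_const TYPE('d::finite) l > 0"
    and "\<And>(c :: ('d \<Rightarrow> nat) \<Rightarrow> 'k) r M \<gamma>. r > 0 \<Longrightarrow>
     (\<And>h. max_norm h < r \<Longrightarrow> qabs (\<Sum>\<delta>\<in>MI l. c \<delta> * monom_at h \<delta>) \<le> M) \<Longrightarrow>
     \<gamma> \<in> MI l \<Longrightarrow> qabs (c \<gamma>) * r ^ mdeg \<gamma> \<le> coeff_const TYPE('d) l * M"
  using someI_ex[OF coeff_bound[where 'd = 'd and l = l], folded coeff_const_def[of "TYPE('d)"]] by blast+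

end

section \<open>Taylor expansions and jets\<close>

definition bump :: "('d \<Rightarrow> nat) \<Rightarrow> 'd \<Rightarrow> 'd \<Rightarrow> nat" where
  "bump \<beta> i = \<beta>(i := Suc (\<beta> i))"

text \<open>For \<open>F \<gamma> = D^\<gamma> g / \<gamma>!\<close>, the Taylor coefficient of
  order \<open>\<gamma>\<close> of the function \<open>F \<beta>\<close> is
  \<open>mbinom \<beta> \<gamma>\<close> times \<open>F (\<beta> + \<gamma>)\<close>.\<close>

definition mbinom :: "('d::finite \<Rightarrow> nat) \<Rightarrow> ('d \<Rightarrow> nat) \<Rightarrow> nat" where
  "mbinom \<beta> \<gamma> = (\<Prod>i\<in>UNIV. (\<beta> i + \<gamma> i) choose \<beta> i)"

lemma mdeg_bump [simp]: "mdeg (bump \<beta> i) = Suc (mdeg \<beta>)"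
proof -
  have "bump \<beta> i = (\<lambda>k. \<beta> k + (if k = i then 1 else 0))"
    by (auto simp: bump_def)
  then show ?thesis
    by (simp add: mdeg_def sum.distrib)
qed

lemma zero_in_MI [simp]: "(\<lambda>_. 0) \<in> MI n"
  by (simp add: MI_def)

lemma mbinom_0 [simp]: "mbinom \<beta> (\<lambda>_. 0) = 1"
  by (simp add: mbinom_def)

lemma mbinom_bump [simp]: "mbinom \<beta> (bump (\<lambda>_. 0) i) = Suc (\<beta> i)"
proof -
  have "mbinom \<beta> (bump (\<lambda>_. 0) i) = (\<Prod>k\<in>UNIV. if k = i then Suc (\<beta> i) else 1)"
    unfolding mbinom_def by (intro prod.cong) (auto simp: bump_def)
  then show ?thesis
    by simp
qed

lemma add_bump [simp]: "(\<lambda>k. \<beta> k + bump (\<lambda>_. 0) i k) = bump \<beta> i"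
  by (auto simp: bump_def)

lemma monom_at_bump [simp]: "monom_at h (bump (\<lambda>_. 0) i) = h $ i"
proof -
  have "monom_at h (bump (\<lambda>_. 0) i) = (\<Prod>k\<in>UNIV. if k = i then h $ i else 1)"
    unfolding monom_at_def by (intro prod.cong) (auto simp: bump_def)
  then show ?thesis
    by simp
qed

lemma monom_at_0: "monom_at (0 :: 'k::comm_semiring_1 ^ 'd::finite) \<gamma> = (if \<gamma> = (\<lambda>_. 0) then 1 else 0)"
proof (cases "\<gamma> = (\<lambda>_. 0)")
  case False
  then obtain i where "\<gamma> i \<noteq> 0"
    by auto
  then show ?thesis
    using False unfolding monom_at_def by (simp add: exI[of _ i] power_0_left prod_zero)
qed simp

lemma mdeg_eq_1E:
  assumes "mdeg \<gamma> = 1"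
  obtains i where "\<gamma> = bump (\<lambda>_. 0) i"
proof -
  obtain i where i: "\<gamma> i \<noteq> 0"
    using assms mdeg_eq_0_iff[of \<gamma>] by auto
  have "\<gamma> = bump (\<gamma>(i := \<gamma> i - 1)) i"
    using i by (auto simp: bump_def)
  then have "mdeg (\<gamma>(i := \<gamma> i - 1)) = 0"
    using assms mdeg_bump[of "\<gamma>(i := \<gamma> i - 1)" i] by simp
  then have "\<gamma>(i := \<gamma> i - 1) = (\<lambda>_. 0)"
    by (simp only: mdeg_eq_0_iff)
  with \<open>\<gamma> = bump (\<gamma>(i := \<gamma> i - 1)) i\<close> show ?thesis
    using that[of i] by simp
qed

lemma mdeg_SucE:
  assumes "mdeg \<gamma> = Suc n"
  obtains \<beta> i where "\<gamma> = bump \<beta> i" "mdeg \<beta> = n"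
proof -
  obtain i where i: "\<gamma> i \<noteq> 0"
    using assms mdeg_eq_0_iff[of \<gamma>] by auto
  have *: "\<gamma> = bump (\<gamma>(i := \<gamma> i - 1)) i"
    using i by (auto simp: bump_def)
  then have "mdeg (\<gamma>(i := \<gamma> i - 1)) = n"
    using assms mdeg_bump[of "\<gamma>(i := \<gamma> i - 1)" i] by simp
  with * that show ?thesis by blast
qed

lemma bump_zero_inj: "bump (\<lambda>_. 0) i = bump (\<lambda>_. 0) j \<longleftrightarrow> i = j"
  by (auto simp: bump_def fun_eq_iff split: if_splits)

section \<open>Splitting and recentring polynomials\<close>

lemma sum_MI_split:
  fixes c :: "('d::finite \<Rightarrow> nat) \<Rightarrow> 'k::comm_ring_1"
  assumes "n \<ge> 1"
  shows "(\<Sum>\<gamma>\<in>MI n. c \<gamma> * monom_at h \<gamma>) = c (\<lambda>_. 0) + (\<Sum>i\<in>UNIV. c (bump (\<lambda>_. 0) i) * h $ i)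
           + (\<Sum>\<gamma>\<in>{\<gamma>\<in>MI n. mdeg \<gamma> \<ge> 2}. c \<gamma> * monom_at h \<gamma>)"
proof -
  let ?E = "range (bump (\<lambda>_::'d. 0))"
  have MI: "MI n = insert (\<lambda>_. 0) ?E \<union> {\<gamma>\<in>MI n. mdeg \<gamma> \<ge> 2}" (is "_ = ?R")
  proof (rule set_eqI)
    fix \<gamma> :: "'d \<Rightarrow> nat"
    consider "mdeg \<gamma> = 0" | "mdeg \<gamma> = 1" | "mdeg \<gamma> \<ge> 2"
      by linarith
    then show "\<gamma> \<in> MI n \<longleftrightarrow> \<gamma> \<in> ?R"
    proof cases
      case 1
      then show ?thesis by (auto simp: mdeg_eq_0_iff MI_def)
    next
      case 2
      then show ?thesis using assms by (auto simp: MI_def intro: mdeg_eq_1E[OF 2])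
    next
      case 3
      then have "\<gamma> \<noteq> (\<lambda>_. 0)" "\<gamma> \<notin> ?E" by auto
      with 3 show ?thesis by auto
    qed
  qed
  have 0: "(\<lambda>_. 0) \<notin> ?E"
    by (auto simp: bump_def fun_eq_iff split: if_splits)
  have "(\<Sum>\<gamma>\<in>MI n. c \<gamma> * monom_at h \<gamma>) = (\<Sum>\<gamma>\<in>insert (\<lambda>_. 0) ?E. c \<gamma> * monom_at h \<gamma>)
      + (\<Sum>\<gamma>\<in>{\<gamma>\<in>MI n. mdeg \<gamma> \<ge> 2}. c \<gamma> * monom_at h \<gamma>)"
    by (subst MI, subst sum.union_disjoint) auto
  also have "(\<Sum>\<gamma>\<in>insert (\<lambda>_. 0) ?E. c \<gamma> * monom_at h \<gamma>)
      = c (\<lambda>_. 0) + (\<Sum>\<gamma>\<in>?E. c \<gamma> * monom_at h \<gamma>)"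
    using 0 by simp
  also have "(\<Sum>\<gamma>\<in>?E. c \<gamma> * monom_at h \<gamma>) = (\<Sum>i\<in>UNIV. c (bump (\<lambda>_. 0) i) * h $ i)"
    by (subst sum.reindex) (auto simp: inj_on_def bump_zero_inj)
  finally show ?thesis .
qed

lemma monom_at_add:
  fixes h d :: "'k::comm_ring_1 ^ 'd::finite"
  shows "monom_at (h + d) \<gamma> =
    (\<Sum>\<beta>\<in>{\<beta>. \<forall>i. \<beta> i \<le> \<gamma> i}. of_nat (mbinom \<beta> (\<lambda>i. \<gamma> i - \<beta> i)) * monom_at h \<beta> * monom_at d (\<lambda>i. \<gamma> i - \<beta> i))"
proof -
  have "monom_at (h + d) \<gamma> = (\<Prod>i\<in>UNIV. \<Sum>k\<in>{..\<gamma> i}. of_nat (\<gamma> i choose k) * h $ i ^ k * d $ i ^ (\<gamma> i - k))"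
    unfolding monom_at_def by (simp add: binomial_ring)
  also have "\<dots> = (\<Sum>\<beta>\<in>PiE UNIV (\<lambda>i. {..\<gamma> i}). \<Prod>i\<in>UNIV. of_nat (\<gamma> i choose \<beta> i) * h $ i ^ \<beta> i * d $ i ^ (\<gamma> i - \<beta> i))"
    by (rule prod_sum_PiE) auto
  also have "PiE UNIV (\<lambda>i. {..\<gamma> i}) = {\<beta>. \<forall>i. \<beta> i \<le> \<gamma> i}"
    by auto
  also have "(\<Sum>\<beta>\<in>{\<beta>. \<forall>i. \<beta> i \<le> \<gamma> i}. \<Prod>i\<in>UNIV. of_nat (\<gamma> i choose \<beta> i) * h $ i ^ \<beta> i * d $ i ^ (\<gamma> i - \<beta> i))
      = (\<Sum>\<beta>\<in>{\<beta>. \<forall>i. \<beta> i \<le> \<gamma> i}. of_nat (mbinom \<beta> (\<lambda>i. \<gamma> i - \<beta> i)) * monom_at h \<beta> * monom_at d (\<lambda>i. \<gamma> i - \<beta> i))"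
    by (intro sum.cong) (simp_all add: mbinom_def monom_at_def prod.distrib)
  finally show ?thesis .
qed

lemma finite_le_fun [simp]: "finite {\<beta>::'d::finite \<Rightarrow> nat. \<forall>i. \<beta> i \<le> \<gamma> i}"
proof -
  have "{\<beta>. \<forall>i. \<beta> i \<le> \<gamma> i} = PiE UNIV (\<lambda>i. {..\<gamma> i})"
    by auto
  then show ?thesis
    by (simp add: finite_PiE)
qed

text \<open>The pairs \<open>(\<gamma>, \<beta>)\<close> with \<open>\<beta> \<le> \<gamma>\<close>
  are reindexed by \<open>(\<beta>, \<gamma> - \<beta>)\<close>; the bound on the total degree
  leaves degree \<open>l - mdeg \<beta>\<close> for the inner sums. These are the sums in
  \<open>jet\<close>.\<close>

lemma sum_MI_shift:
  fixes h d :: "'k::comm_ring_1 ^ 'd::finite"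
  shows "(\<Sum>\<gamma>\<in>MI l. c \<gamma> * monom_at (h + d) \<gamma>) =
    (\<Sum>\<beta>\<in>MI l. (\<Sum>\<gamma>\<in>MI (l - mdeg \<beta>). of_nat (mbinom \<beta> \<gamma>) * c (\<lambda>i. \<beta> i + \<gamma> i) * monom_at d \<gamma>) * monom_at h \<beta>)"
proof -
  have "(\<Sum>\<gamma>\<in>MI l. c \<gamma> * monom_at (h + d) \<gamma>) =
     (\<Sum>\<gamma>\<in>MI l. \<Sum>\<beta>\<in>{\<beta>. \<forall>i. \<beta> i \<le> \<gamma> i}. c \<gamma> * (of_nat (mbinom \<beta> (\<lambda>i. \<gamma> i - \<beta> i)) * monom_at h \<beta> * monom_at d (\<lambda>i. \<gamma> i - \<beta> i)))"
    by (simp add: monom_at_add sum_distrib_left)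
  also have "\<dots> = (\<Sum>(\<gamma>, \<beta>)\<in>(SIGMA \<gamma>:MI l. {\<beta>. \<forall>i. \<beta> i \<le> \<gamma> i}).
      c \<gamma> * (of_nat (mbinom \<beta> (\<lambda>i. \<gamma> i - \<beta> i)) * monom_at h \<beta> * monom_at d (\<lambda>i. \<gamma> i - \<beta> i)))"
    by (subst sum.Sigma) auto
  also have "\<dots> = (\<Sum>(\<beta>, \<gamma>)\<in>(SIGMA \<beta>:MI l. MI (l - mdeg \<beta>)).
      of_nat (mbinom \<beta> \<gamma>) * c (\<lambda>i. \<beta> i + \<gamma> i) * monom_at d \<gamma> * monom_at h \<beta>)"
  proof (rule sum.reindex_bij_witness[where j = "\<lambda>(\<gamma>, \<beta>). (\<beta>, \<lambda>i. \<gamma> i - \<beta> i)"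
        and i = "\<lambda>(\<beta>, \<gamma>). (\<lambda>i. \<beta> i + \<gamma> i, \<beta>)"], goal_cases)
    case (1 a)
    then show ?case by (auto simp: fun_eq_iff)
  next
    case (2 a)
    obtain \<gamma> \<beta> where a: "a = (\<gamma>, \<beta>)" by (cases a)
    have "\<gamma> = (\<lambda>i. \<beta> i + (\<gamma> i - \<beta> i))"
      using 2 a by (auto simp: fun_eq_iff)
    then have "mdeg \<gamma> = mdeg \<beta> + mdeg (\<lambda>i. \<gamma> i - \<beta> i)"
      by (metis mdeg_add)
    then show ?case using 2 a by (auto simp: MI_def)
  next
    case (3 b)
    then show ?case by auto
  next
    case (4 b)
    then show ?case by (auto simp: MI_def mdeg_add)
  next
    case (5 a)
    obtain \<gamma> \<beta> where a: "a = (\<gamma>, \<beta>)" by (cases a)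
    have "\<gamma> = (\<lambda>i. \<beta> i + (\<gamma> i - \<beta> i))"
      using 5 a by (auto simp: fun_eq_iff)
    with a show ?case by (auto simp: algebra_simps simp del: add_diff_inverse)
  qed
  also have "\<dots> = (\<Sum>\<beta>\<in>MI l. \<Sum>\<gamma>\<in>MI (l - mdeg \<beta>). of_nat (mbinom \<beta> \<gamma>) * c (\<lambda>i. \<beta> i + \<gamma> i) * monom_at d \<gamma> * monom_at h \<beta>)"
    by (subst sum.Sigma) auto
  finally show ?thesis
    by (simp add: sum_distrib_right)
qed

definition mbinom_total :: "'d::finite itself \<Rightarrow> nat \<Rightarrow> real" where
  "mbinom_total T l = (\<Sum>\<beta>\<in>(MI l :: ('d \<Rightarrow> nat) set). \<Sum>\<gamma>\<in>(MI l :: ('d \<Rightarrow> nat) set). real (mbinom \<beta> \<gamma>))"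

text \<open>The factor 3 allows displacements up to \<open>3 * r\<close>; the summand 1 accounts for
  the remainder, \<open>mbinom_total\<close> for the Taylor terms.\<close>

definition jet_const :: "'d::finite itself \<Rightarrow> nat \<Rightarrow> real" where
  "jet_const T l = (mbinom_total T l + 1) * 3 ^ (l + 1)"

lemma mbinom_total_nonneg: "mbinom_total T l \<ge> 0"
  by (simp add: mbinom_total_def sum_nonneg)

lemma jet_const_pos: "jet_const T l > 0"
  using mbinom_total_nonneg[of T l] by (simp add: jet_const_def)

lemma sum_mbinom_le:
  fixes \<beta> :: "'d::finite \<Rightarrow> nat"
  assumes "\<beta> \<in> MI l" "I \<subseteq> MI (l - mdeg \<beta>)"
  shows "(\<Sum>\<gamma>\<in>I. real (mbinom \<beta> \<gamma>)) \<le> mbinom_total TYPE('d) l"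
proof -
  have "I \<subseteq> MI l"
    using assms by (auto simp: MI_def)
  then have "(\<Sum>\<gamma>\<in>I. real (mbinom \<beta> \<gamma>)) \<le> (\<Sum>\<gamma>\<in>MI l. real (mbinom \<beta> \<gamma>))"
    by (intro sum_mono2) auto
  also have "\<dots> \<le> mbinom_total TYPE('d) l"
    unfolding mbinom_total_def using assms(1)
    by (intro member_le_sum[of \<beta> _ "\<lambda>\<beta>. \<Sum>\<gamma>\<in>MI l. real (mbinom \<beta> \<gamma>)"] sum_nonneg) auto
  finally show ?thesis .
qed
lemma power_le_square:
  fixes q :: real
  assumes "2 \<le> n" "n \<le> l + 1" "0 \<le> q" "q \<le> 3"
  shows "q ^ n \<le> q\<^sup>2 * 3 ^ l"
proof -
  have "q ^ n = q\<^sup>2 * q ^ (n - 2)"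
    using assms(1) by (metis le_add_diff_inverse power_add)
  also have "\<dots> \<le> q\<^sup>2 * 3 ^ (n - 2)"
    using assms by (intro mult_left_mono power_mono) auto
  also have "\<dots> \<le> q\<^sup>2 * 3 ^ l"
    using assms by (intro mult_left_mono power_increasing) auto
  finally show ?thesis .
qed
lemma power_split_MI: "\<beta> \<in> MI l \<Longrightarrow> (r::real) ^ (l + 1) = r ^ (l + 1 - mdeg \<beta>) * r ^ mdeg \<beta>"
  by (simp add: MI_def flip: power_add)

context Q_nu
begin

definition cube :: "'k ^ 'd::finite \<Rightarrow> real \<Rightarrow> ('k ^ 'd) set" where
  "cube x r = {y. max_norm (y - x) < r}"

text \<open>\<open>F\<close> is an arbitrary family of functions; that it consists of partial
  derivatives divided by factorials is a consequence, not part of the notion.\<close>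

definition taylor :: "nat \<Rightarrow> ('k ^ 'd::finite) set \<Rightarrow> (('d \<Rightarrow> nat) \<Rightarrow> 'k ^ 'd \<Rightarrow> 'k) \<Rightarrow> real \<Rightarrow> ('k ^ 'd \<Rightarrow> 'k) \<Rightarrow> bool" where
  "taylor l W F A g \<longleftrightarrow> (\<forall>x\<in>W. \<forall>y\<in>W.
     qabs (g y - (\<Sum>\<gamma>\<in>MI l. F \<gamma> x * monom_at (y - x) \<gamma>)) \<le> A * max_norm (y - x) ^ (l + 1))"

text \<open>Whitney's compatibility condition for a field of jets of order \<open>l\<close>: every
  coefficient has its own expansion, with the order reduced by its degree.\<close>

definition jet :: "nat \<Rightarrow> ('k ^ 'd::finite) set \<Rightarrow> (('d \<Rightarrow> nat) \<Rightarrow> 'k ^ 'd \<Rightarrow> 'k) \<Rightarrow> real \<Rightarrow> bool" where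
  "jet l W F A \<longleftrightarrow> (\<forall>\<beta>\<in>MI l. \<forall>x\<in>W. \<forall>y\<in>W.
     qabs (F \<beta> y - (\<Sum>\<gamma>\<in>MI (l - mdeg \<beta>). of_nat (mbinom \<beta> \<gamma>) * F (\<lambda>i. \<beta> i + \<gamma> i) x * monom_at (y - x) \<gamma>))
       \<le> A * max_norm (y - x) ^ (l + 1 - mdeg \<beta>))"

lemma qabs_of_nat_le: "qabs (of_nat n :: 'k) \<le> real n"
  by (induction n) (simp_all add: order_trans[OF qabs_triangle])

text \<open>
  A converse of Taylor's theorem: the expansions at two points \<open>x\<close> and \<open>y\<close> differ by
  \<open>O(\<parallel>y - x\<parallel> ^ (l + 1))\<close> on the ball of radius \<open>\<parallel>y - x\<parallel>\<close> about \<open>y\<close>, hence so do,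
  after rescaling, their coefficients.
\<close>

lemma taylor_imp_jet:
  fixes F :: "('d::finite \<Rightarrow> nat) \<Rightarrow> 'k ^ 'd \<Rightarrow> 'k"
  assumes A: "A \<ge> 0" and t: "taylor l (cube x0 (3 * R)) F A g"
  shows "jet l (cube x0 R) F (coeff_const TYPE('d) l * (2 * 2 ^ (l + 1)) * A)"
  unfolding jet_def
proof (intro ballI)
  define K where "K = coeff_const TYPE('d) l"
  have K: "K > 0"
    by (simp add: K_def coeff_const)
  fix \<beta> :: "'d \<Rightarrow> nat" and x y
  assume \<beta>: "\<beta> \<in> MI l" and xy: "x \<in> cube x0 R" "y \<in> cube x0 R"
  define r where "r = max_norm (y - x)"
  define G where "G \<beta> = (\<Sum>\<gamma>\<in>MI (l - mdeg \<beta>). of_nat (mbinom \<beta> \<gamma>) * F (\<lambda>i. \<beta> i + \<gamma> i) x * monom_at (y - x) \<gamma>)" for \<beta>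
  have "qabs (F \<beta> y - G \<beta>) \<le> K * (2 * 2 ^ (l + 1)) * A * r ^ (l + 1 - mdeg \<beta>)"
  proof (cases "x = y")
    case True
    have "G \<beta> = (\<Sum>\<gamma>\<in>MI (l - mdeg \<beta>). if \<gamma> = (\<lambda>_::'d. 0) then F \<beta> x else 0)"
      unfolding G_def by (intro sum.cong) (auto simp: True monom_at_0)
    then have "G \<beta> = F \<beta> x"
      by simp
    then show ?thesis
      using True A K by (simp add: r_def)
  next
    case False
    then have r: "r > 0"
      by (simp add: r_def less_le)
    have tri: "max_norm (y - x) < 2 * R"
      using xy max_norm_triangle_via[of y x x0] max_norm_minus_commute[of x0 x] by (simp add: cube_def)
    have "qabs (G \<beta> - F \<beta> y) * r ^ mdeg \<beta> \<le> K * (2 * 2 ^ (l + 1) * (A * r ^ (l + 1)))"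
      unfolding K_def
    proof (rule coeff_const(2)[OF r _ \<beta>])
      fix h :: "'k ^ 'd"
      assume h: "max_norm h < r"
      have "max_norm (y + h - x0) \<le> max_norm (y - x0) + max_norm h"
        using max_norm_triangle[of "y - x0" h] by (simp add: algebra_simps)
      \<comment> \<open>Here the larger cube is used: \<open>max_norm (y - x0) < R\<close> and
        \<open>max_norm h < max_norm (y - x) < 2 * R\<close>.\<close>
      then have mem: "x \<in> cube x0 (3 * R)" "y \<in> cube x0 (3 * R)" "y + h \<in> cube x0 (3 * R)"
        using xy h tri max_norm_nonneg[of "x - x0"] max_norm_nonneg[of "y - x0"]
        unfolding cube_def mem_Collect_eq r_def by linarith+
      have 1: "qabs (g (y + h) - (\<Sum>\<gamma>\<in>MI l. F \<gamma> x * monom_at (h + (y - x)) \<gamma>)) \<le> A * max_norm (h + (y - x)) ^ (l + 1)"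
        using t[unfolded taylor_def, rule_format, OF mem(1,3)] by (simp add: algebra_simps)
      have 2: "qabs (g (y + h) - (\<Sum>\<gamma>\<in>MI l. F \<gamma> y * monom_at h \<gamma>)) \<le> A * max_norm h ^ (l + 1)"
        using t[unfolded taylor_def, rule_format, OF mem(2,3)] by simp
      have "max_norm (h + (y - x)) \<le> 2 * r"
        using max_norm_triangle[of h "y - x"] h by (simp add: r_def)
      then have 3: "A * max_norm (h + (y - x)) ^ (l + 1) \<le> A * (2 * r) ^ (l + 1)"
        using A by (intro mult_left_mono power_mono) auto
      have 4: "A * max_norm h ^ (l + 1) \<le> A * (2 * r) ^ (l + 1)"
        using A h r by (intro mult_left_mono power_mono) auto
      \<comment> \<open>Both expansions approximate the same value \<open>g (y + h)\<close>;
        recentring the one at \<open>x\<close> turns their difference into a polynomial in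
        \<open>h\<close>.\<close>
      have eq: "(\<Sum>\<delta>\<in>MI l. (G \<delta> - F \<delta> y) * monom_at h \<delta>)
          = (g (y + h) - (\<Sum>\<gamma>\<in>MI l. F \<gamma> y * monom_at h \<gamma>))
          - (g (y + h) - (\<Sum>\<gamma>\<in>MI l. F \<gamma> x * monom_at (h + (y - x)) \<gamma>))"
        unfolding sum_MI_shift G_def by (simp add: left_diff_distrib sum_subtractf)
      have "qabs (\<Sum>\<delta>\<in>MI l. (G \<delta> - F \<delta> y) * monom_at h \<delta>) \<le> 2 * (A * (2 * r) ^ (l + 1))"
        unfolding eq using qabs_diff_triangle[of "g (y + h) - (\<Sum>\<gamma>\<in>MI l. F \<gamma> y * monom_at h \<gamma>)"
            "g (y + h) - (\<Sum>\<gamma>\<in>MI l. F \<gamma> x * monom_at (h + (y - x)) \<gamma>)"] 1 2 3 4 by linarith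
      then show "qabs (\<Sum>\<delta>\<in>MI l. (G \<delta> - F \<delta> y) * monom_at h \<delta>) \<le> 2 * 2 ^ (l + 1) * (A * r ^ (l + 1))"
        by (simp only: power_mult_distrib mult.assoc mult.left_commute)
    qed
    moreover have "r ^ (l + 1) = r ^ (l + 1 - mdeg \<beta>) * r ^ mdeg \<beta>"
      using \<beta> by (simp add: MI_def flip: power_add)
    ultimately have "qabs (G \<beta> - F \<beta> y) * r ^ mdeg \<beta> \<le> (K * (2 * 2 ^ (l + 1)) * A * r ^ (l + 1 - mdeg \<beta>)) * r ^ mdeg \<beta>"
      by (simp only: mult.assoc)
    then show ?thesis
      using r by (simp add: qabs_minus_commute)
  qed
  then show "qabs (F \<beta> y - (\<Sum>\<gamma>\<in>MI (l - mdeg \<beta>). of_nat (mbinom \<beta> \<gamma>) * F (\<lambda>i. \<beta> i + \<gamma> i) x * monom_at (y - x) \<gamma>))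
   \<le> K * (2 * 2 ^ (l + 1)) * A * max_norm (y - x) ^ (l + 1 - mdeg \<beta>)"
    by (simp add: G_def r_def)
qed

text \<open>Degrees add up: the weight \<open>r ^ mdeg \<beta>\<close> and the bound
  \<open>(q * r) ^ mdeg \<gamma>\<close> for the monomial together make the weight of the
  coefficient \<open>\<beta> + \<gamma>\<close>, leaving only
  \<open>q ^ mdeg \<gamma>\<close>.\<close>

lemma jet_term_bound:
  fixes F :: "('d::finite \<Rightarrow> nat) \<Rightarrow> 'k ^ 'd \<Rightarrow> 'k"
  assumes "\<beta> \<in> MI l" "\<gamma> \<in> MI (l - mdeg \<beta>)" "r > 0"
    and S: "\<And>\<gamma>. \<gamma> \<in> MI l \<Longrightarrow> qabs (F \<gamma> x) * r ^ mdeg \<gamma> \<le> S" and q: "max_norm (y - x) \<le> q * r"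
  shows "qabs (of_nat (mbinom \<beta> \<gamma>) * F (\<lambda>i. \<beta> i + \<gamma> i) x * monom_at (y - x) \<gamma>) * r ^ mdeg \<beta>
      \<le> real (mbinom \<beta> \<gamma>) * (S * q ^ mdeg \<gamma>)"
proof -
  have m: "(\<lambda>i. \<beta> i + \<gamma> i) \<in> MI l"
    using assms by (simp add: MI_def mdeg_add)
  have q0: "q \<ge> 0"
    using order_trans[OF max_norm_nonneg q] \<open>r > 0\<close> by (simp add: zero_le_mult_iff)
  have "qabs (of_nat (mbinom \<beta> \<gamma>) * F (\<lambda>i. \<beta> i + \<gamma> i) x * monom_at (y - x) \<gamma>) * r ^ mdeg \<beta>
      = qabs (of_nat (mbinom \<beta> \<gamma>) :: 'k) * (qabs (F (\<lambda>i. \<beta> i + \<gamma> i) x) * r ^ mdeg \<beta> * qabs (monom_at (y - x) \<gamma>))"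
    by (simp add: qabs_mult)
  also have "\<dots> \<le> real (mbinom \<beta> \<gamma>) * (qabs (F (\<lambda>i. \<beta> i + \<gamma> i) x) * r ^ mdeg \<beta> * (q * r) ^ mdeg \<gamma>)"
  proof (intro mult_mono mult_left_mono qabs_of_nat_le)
    show "qabs (monom_at (y - x) \<gamma>) \<le> (q * r) ^ mdeg \<gamma>"
      by (rule order_trans[OF qabs_monom_at_le]) (intro power_mono q max_norm_nonneg)
  qed (use assms in auto)
  also have "\<dots> = real (mbinom \<beta> \<gamma>) * ((qabs (F (\<lambda>i. \<beta> i + \<gamma> i) x) * r ^ mdeg (\<lambda>i. \<beta> i + \<gamma> i)) * q ^ mdeg \<gamma>)"
    by (simp add: mdeg_add power_add power_mult_distrib)
  also have "\<dots> \<le> real (mbinom \<beta> \<gamma>) * (S * q ^ mdeg \<gamma>)"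
    using q0 by (intro mult_left_mono mult_right_mono S m) auto
  finally show ?thesis .
qed

text \<open>In the next two lemmas, \<open>S\<close> bounds the jet at \<open>x\<close> on the scale \<open>r\<close>.\<close>

lemma jet_second_order:
  fixes F :: "('d::finite \<Rightarrow> nat) \<Rightarrow> 'k ^ 'd \<Rightarrow> 'k"
  assumes "jet l W F B" "mdeg \<beta> < l" "x \<in> W" "y \<in> W" "r > 0"
    "\<And>\<gamma>. \<gamma> \<in> MI l \<Longrightarrow> qabs (F \<gamma> x) * r ^ mdeg \<gamma> \<le> S" "B \<ge> 0" "B * r ^ (l + 1) \<le> S"
    "max_norm (y - x) \<le> q * r" "q \<le> 3"
  shows "qabs (F \<beta> y - F \<beta> x - (\<Sum>i\<in>UNIV. of_nat (Suc (\<beta> i)) * F (bump \<beta> i) x * (y - x) $ i)) * r ^ mdeg \<beta>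
    \<le> jet_const TYPE('d) l * S * q\<^sup>2"
proof -
  have \<beta>: "\<beta> \<in> MI l" using assms(2) by (simp add: MI_def)
  have q0: "q \<ge> 0"
    using order_trans[OF max_norm_nonneg assms(9)] assms(5) by (simp add: zero_le_mult_iff)
  have S0: "S \<ge> 0"
    by (rule order_trans[OF _ assms(8)]) (use assms(5,7) in simp)
  let ?I = "{\<gamma>\<in>MI (l - mdeg \<beta>). mdeg \<gamma> \<ge> 2}"
  let ?t = "\<lambda>\<gamma>. of_nat (mbinom \<beta> \<gamma>) * F (\<lambda>i. \<beta> i + \<gamma> i) x * monom_at (y - x) \<gamma>"
  let ?P = "\<Sum>\<gamma>\<in>MI (l - mdeg \<beta>). ?t \<gamma>"
  have P: "?P = F \<beta> x + (\<Sum>i\<in>UNIV. of_nat (Suc (\<beta> i)) * F (bump \<beta> i) x * (y - x) $ i) + sum ?t ?I"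
    using sum_MI_split[of "l - mdeg \<beta>" "\<lambda>\<gamma>. of_nat (mbinom \<beta> \<gamma>) * F (\<lambda>i. \<beta> i + \<gamma> i) x" "y - x"] assms(2)
    by simp
  have "qabs (F \<beta> y - F \<beta> x - (\<Sum>i\<in>UNIV. of_nat (Suc (\<beta> i)) * F (bump \<beta> i) x * (y - x) $ i)) * r ^ mdeg \<beta>
    = qabs ((F \<beta> y - ?P) + sum ?t ?I) * r ^ mdeg \<beta>"
    unfolding P by (simp add: algebra_simps)
  also have "\<dots> \<le> (qabs (F \<beta> y - ?P) + (\<Sum>\<gamma>\<in>?I. qabs (?t \<gamma>))) * r ^ mdeg \<beta>"
    using assms(5) by (intro mult_right_mono order_trans[OF qabs_triangle] add_left_mono qabs_sum) auto
  also have "\<dots> = qabs (F \<beta> y - ?P) * r ^ mdeg \<beta> + (\<Sum>\<gamma>\<in>?I. qabs (?t \<gamma>) * r ^ mdeg \<beta>)"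
    by (simp add: distrib_right sum_distrib_right)
  \<comment> \<open>Since \<open>mdeg \<beta> < l\<close>, the remainder has order
    \<open>l + 1 - mdeg \<beta>\<close>, at least 2, so it is quadratic in \<open>q\<close> like the
    terms of degree at least 2.\<close>
  also have "qabs (F \<beta> y - ?P) * r ^ mdeg \<beta> \<le> S * (q\<^sup>2 * 3 ^ l)"
  proof -
    have "qabs (F \<beta> y - ?P) * r ^ mdeg \<beta> \<le> B * max_norm (y - x) ^ (l + 1 - mdeg \<beta>) * r ^ mdeg \<beta>"
      using assms(1)[unfolded jet_def, rule_format, OF \<beta> assms(3,4)] assms(5)
      by (intro mult_right_mono) simp_all
    also have "\<dots> \<le> B * (q * r) ^ (l + 1 - mdeg \<beta>) * r ^ mdeg \<beta>"
      using assms(5,7,9) by (intro mult_right_mono mult_left_mono power_mono) simp_all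
    also have "\<dots> = (B * r ^ (l + 1)) * q ^ (l + 1 - mdeg \<beta>)"
      unfolding power_split_MI[OF \<beta>] by (simp add: power_mult_distrib mult_ac)
    also have "\<dots> \<le> S * (q\<^sup>2 * 3 ^ l)"
      using assms(2,5,7,8,10) q0 S0 by (intro mult_mono power_le_square) simp_all
    finally show ?thesis .
  qed
  also have "(\<Sum>\<gamma>\<in>?I. qabs (?t \<gamma>) * r ^ mdeg \<beta>) \<le> (\<Sum>\<gamma>\<in>?I. real (mbinom \<beta> \<gamma>) * (S * (q\<^sup>2 * 3 ^ l)))"
  proof (rule sum_mono)
    fix \<gamma> :: "'d \<Rightarrow> nat" assume \<gamma>: "\<gamma> \<in> ?I"
    then have "qabs (?t \<gamma>) * r ^ mdeg \<beta> \<le> real (mbinom \<beta> \<gamma>) * (S * q ^ mdeg \<gamma>)"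
      by (intro jet_term_bound[OF \<beta>] assms(5,6,9)) auto
    also have "\<dots> \<le> real (mbinom \<beta> \<gamma>) * (S * (q\<^sup>2 * 3 ^ l))"
      using \<gamma> q0 S0 assms(2,10) by (intro mult_left_mono power_le_square) (auto simp: MI_def)
    finally show "qabs (?t \<gamma>) * r ^ mdeg \<beta> \<le> real (mbinom \<beta> \<gamma>) * (S * (q\<^sup>2 * 3 ^ l))" .
  qed
  also have "\<dots> = (\<Sum>\<gamma>\<in>?I. real (mbinom \<beta> \<gamma>)) * (S * (q\<^sup>2 * 3 ^ l))"
    by (simp add: sum_distrib_right)
  also have "\<dots> \<le> mbinom_total TYPE('d) l * (S * (q\<^sup>2 * 3 ^ l))"
    using S0 \<beta> by (intro mult_right_mono sum_mbinom_le) auto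
  also have "S * (q\<^sup>2 * 3 ^ l) + mbinom_total TYPE('d) l * (S * (q\<^sup>2 * 3 ^ l)) = (mbinom_total TYPE('d) l + 1) * 3 ^ l * (S * q\<^sup>2)"
    by (simp add: algebra_simps)
  also have "\<dots> \<le> (mbinom_total TYPE('d) l + 1) * 3 ^ (l + 1) * (S * q\<^sup>2)"
    using mbinom_total_nonneg[of "TYPE('d)" l] S0 by (intro mult_right_mono mult_left_mono) auto
  finally show ?thesis
    by (simp add: jet_const_def mult.assoc)
qed

lemma jet_bound:
  fixes F :: "('d::finite \<Rightarrow> nat) \<Rightarrow> 'k ^ 'd \<Rightarrow> 'k"
  assumes "jet l W F B" "\<beta> \<in> MI l" "x \<in> W" "y \<in> W" "r > 0"
    "\<And>\<gamma>. \<gamma> \<in> MI l \<Longrightarrow> qabs (F \<gamma> x) * r ^ mdeg \<gamma> \<le> S" "B \<ge> 0" "B * r ^ (l + 1) \<le> S"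
    "max_norm (y - x) \<le> 3 * r"
  shows "qabs (F \<beta> y) * r ^ mdeg \<beta> \<le> jet_const TYPE('d) l * S"
proof -
  note \<beta> = assms(2)
  have S0: "S \<ge> 0"
    by (rule order_trans[OF _ assms(8)]) (use assms(5,7) in simp)
  let ?I = "MI (l - mdeg \<beta>) :: ('d \<Rightarrow> nat) set"
  let ?t = "\<lambda>\<gamma>. of_nat (mbinom \<beta> \<gamma>) * F (\<lambda>i. \<beta> i + \<gamma> i) x * monom_at (y - x) \<gamma>"
  let ?P = "sum ?t ?I"
  have "qabs (F \<beta> y) * r ^ mdeg \<beta> = qabs ((F \<beta> y - ?P) + ?P) * r ^ mdeg \<beta>"
    by simp
  also have "\<dots> \<le> (qabs (F \<beta> y - ?P) + (\<Sum>\<gamma>\<in>?I. qabs (?t \<gamma>))) * r ^ mdeg \<beta>"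
    using assms(5) by (intro mult_right_mono order_trans[OF qabs_triangle] add_left_mono qabs_sum) auto
  also have "\<dots> = qabs (F \<beta> y - ?P) * r ^ mdeg \<beta> + (\<Sum>\<gamma>\<in>?I. qabs (?t \<gamma>) * r ^ mdeg \<beta>)"
    by (simp add: distrib_right sum_distrib_right)
  also have "qabs (F \<beta> y - ?P) * r ^ mdeg \<beta> \<le> S * 3 ^ (l + 1)"
  proof -
    have "qabs (F \<beta> y - ?P) * r ^ mdeg \<beta> \<le> B * max_norm (y - x) ^ (l + 1 - mdeg \<beta>) * r ^ mdeg \<beta>"
      using assms(1)[unfolded jet_def, rule_format, OF \<beta> assms(3,4)] assms(5)
      by (intro mult_right_mono) simp_all
    also have "\<dots> \<le> B * (3 * r) ^ (l + 1 - mdeg \<beta>) * r ^ mdeg \<beta>"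
      using assms(5,7,9) by (intro mult_right_mono mult_left_mono power_mono) simp_all
    also have "\<dots> = (B * r ^ (l + 1)) * 3 ^ (l + 1 - mdeg \<beta>)"
      unfolding power_split_MI[OF \<beta>] by (simp add: power_mult_distrib mult_ac)
    also have "\<dots> \<le> S * 3 ^ (l + 1)"
      using assms(5,7,8) S0 by (intro mult_mono power_increasing) simp_all
    finally show ?thesis .
  qed
  also have "(\<Sum>\<gamma>\<in>?I. qabs (?t \<gamma>) * r ^ mdeg \<beta>) \<le> (\<Sum>\<gamma>\<in>?I. real (mbinom \<beta> \<gamma>) * (S * 3 ^ (l + 1)))"
  proof (rule sum_mono)
    fix \<gamma> :: "'d \<Rightarrow> nat" assume \<gamma>: "\<gamma> \<in> ?I"
    then have "qabs (?t \<gamma>) * r ^ mdeg \<beta> \<le> real (mbinom \<beta> \<gamma>) * (S * 3 ^ mdeg \<gamma>)"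
      by (intro jet_term_bound[OF \<beta>] assms(5,6,9)) auto
    also have "\<dots> \<le> real (mbinom \<beta> \<gamma>) * (S * 3 ^ (l + 1))"
      using \<gamma> S0 by (intro mult_left_mono power_increasing) (auto simp: MI_def)
    finally show "qabs (?t \<gamma>) * r ^ mdeg \<beta> \<le> real (mbinom \<beta> \<gamma>) * (S * 3 ^ (l + 1))" .
  qed
  also have "\<dots> = (\<Sum>\<gamma>\<in>?I. real (mbinom \<beta> \<gamma>)) * (S * 3 ^ (l + 1))"
    by (simp add: sum_distrib_right)
  also have "\<dots> \<le> mbinom_total TYPE('d) l * (S * 3 ^ (l + 1))"
    using S0 \<beta> by (intro mult_right_mono sum_mbinom_le) auto
  also have "S * 3 ^ (l + 1) + mbinom_total TYPE('d) l * (S * 3 ^ (l + 1)) = jet_const TYPE('d) l * S"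
    by (simp add: jet_const_def algebra_simps)
  finally show ?thesis
    by simp
qed

end

section \<open>Partial derivatives and nondegeneracy\<close>

definition mfact :: "('d::finite \<Rightarrow> nat) \<Rightarrow> nat" where
  "mfact \<gamma> = (\<Prod>i\<in>UNIV. fact (\<gamma> i))"

lemma mfact_zero [simp]: "mfact (\<lambda>_. 0) = 1"
  by (simp add: mfact_def)

lemma mfact_bump: "mfact (bump \<gamma> i) = Suc (\<gamma> i) * mfact \<gamma>"
proof -
  have "mfact (bump \<gamma> i) = (\<Prod>k\<in>UNIV. (if k = i then Suc (\<gamma> i) else 1) * fact (\<gamma> k))"
    unfolding mfact_def by (intro prod.cong) (auto simp: bump_def)
  then show ?thesis
    by (simp add: prod.distrib mfact_def)
qed

lemma count_list_Cons_bump: "count_list (i # w) = bump (count_list w) i"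
  by (auto simp: bump_def fun_eq_iff)

lemma mdeg_count_list: "mdeg (count_list w) = length w"
proof (induction w)
  case Nil
  then show ?case by (simp add: mdeg_def)
next
  case (Cons i w)
  have "mdeg (count_list (i # w)) = Suc (mdeg (count_list w))"
    unfolding count_list_Cons_bump by (rule mdeg_bump)
  then show ?case
    using Cons.IH by (simp del: count_list.simps)
qed

context Q_nu
begin

text \<open>A limit determines \<open>Lim\<close>, and hence \<open>partial\<close>, only along a
  proper filter: 0 must not be isolated.\<close>

lemma at_0_neq_bot: "at (0::'k) \<noteq> bot"
proof -
  have "\<exists>y\<in>UNIV. y \<noteq> (0::'k) \<and> dist y 0 < e" if e: "e > 0" for e
  proof -
    obtain z :: 'k where z: "qabs unif * e \<le> qabs z" "qabs z < e"
      using exists_of_size[OF e] by blast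
    have "0 < qabs unif * e"
      using unif e by simp
    with z have "z \<noteq> 0"
      by auto
    with z(2) show ?thesis
      by (auto simp: qabs_def)
  qed
  then have "(0::'k) islimpt UNIV"
    by (simp add: islimpt_approachable)
  then show ?thesis
    by (simp add: trivial_limit_within)
qed

lemma taylor_at_0:
  assumes "taylor l W F A g" "x \<in> W"
  shows "F (\<lambda>_. 0) x = g x"
proof -
  have "(\<Sum>\<gamma>\<in>MI l. F \<gamma> x * monom_at 0 \<gamma>) = F (\<lambda>_. 0) x"
    by (simp add: monom_at_0 if_distrib[of "\<lambda>z. _ * z"] cong: if_cong)
  then show ?thesis
    using assms(1)[unfolded taylor_def, rule_format, OF assms(2,2)]
    by (simp add: order_antisym_conv[OF qabs_nonneg])
qed

text \<open>The second order expansion bounds the difference quotient minus its limit by a multiple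
  of \<open>qabs t\<close>, at either place. The factor \<open>c\<close> and the restriction of the
  equation to \<open>W\<close> are the form in which the induction over a word supplies
  \<open>u\<close>.\<close>

lemma partial_jet:
  fixes F :: "('d::finite \<Rightarrow> nat) \<Rightarrow> 'k ^ 'd \<Rightarrow> 'k"
  assumes jet: "jet l W F B" and \<beta>: "mdeg \<beta> < l" and B: "B \<ge> 0"
    and W: "open W" "x \<in> W"
    and u: "\<And>y. y \<in> W \<Longrightarrow> u y = c * F \<beta> y"
  shows "partial i u x = c * of_nat (Suc (\<beta> i)) * F (bump \<beta> i) x"
proof -
  define K where "K = jet_const TYPE('d) l"
  have K: "K > 0"
    by (simp add: K_def jet_const_pos)
  define S where "S = B + (\<Sum>\<gamma>\<in>MI l. qabs (F \<gamma> x))"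
  have S: "qabs (F \<gamma> x) \<le> S" if "\<gamma> \<in> MI l" for \<gamma>
    using member_le_sum[OF that, of "\<lambda>\<gamma>. qabs (F \<gamma> x)"] B by (simp add: S_def)
  have SB: "B \<le> S"
    by (simp add: S_def sum_nonneg)
  obtain e where e: "e > 0" and eW: "\<And>y. dist y x < e \<Longrightarrow> y \<in> W"
    using W unfolding open_dist by blast
  have mem: "x + axis i t \<in> W" if "qabs t < e" for t
  proof (rule eW)
    have "dist (x + axis i t) x = L2_set (\<lambda>k. dist ((x + axis i t) $ k) (x $ k)) UNIV"
      by (simp add: dist_vec_def)
    also have "\<dots> = L2_set (\<lambda>k. qabs (axis i t $ k)) UNIV"
      by (simp add: dist_eq_qabs)
    also have "\<dots> \<le> (\<Sum>k\<in>UNIV. \<bar>qabs (axis i t $ k)\<bar>)"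
      by (rule L2_set_le_sum_abs)
    also have "\<dots> = (\<Sum>k\<in>UNIV. if k = i then qabs t else 0)"
      by (intro sum.cong) (auto simp: axis_def)
    finally show "dist (x + axis i t) x < e"
      using that by simp
  qed
  have quot: "qabs ((u (x + axis i t) - u x) / t - c * of_nat (Suc (\<beta> i)) * F (bump \<beta> i) x) \<le> qabs c * (K * S) * qabs t"
    if t: "t \<noteq> 0" "qabs t < e" "qabs t < 1" for t
  proof -
    have sum: "(\<Sum>k\<in>UNIV. of_nat (Suc (\<beta> k)) * F (bump \<beta> k) x * axis i t $ k) = of_nat (Suc (\<beta> i)) * F (bump \<beta> i) x * t"
    proof -
      have "(\<Sum>k\<in>UNIV. of_nat (Suc (\<beta> k)) * F (bump \<beta> k) x * axis i t $ k)
        = (\<Sum>k\<in>UNIV. if k = i then of_nat (Suc (\<beta> i)) * F (bump \<beta> i) x * t else 0)"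
        by (intro sum.cong) (auto simp: axis_def)
      then show ?thesis
        by simp
    qed
    \<comment> \<open>The expansion is used at scale 1, with \<open>q = qabs t\<close>.\<close>
    have "qabs (F \<beta> (x + axis i t) - F \<beta> x - of_nat (Suc (\<beta> i)) * F (bump \<beta> i) x * t) \<le> K * S * (qabs t)\<^sup>2"
      using jet_second_order[OF jet \<beta> W(2) mem[OF t(2)] zero_less_one, where S = S and q = "qabs t"] S SB B t sum
      by (simp add: K_def)
    then have "qabs c * qabs (F \<beta> (x + axis i t) - F \<beta> x - of_nat (Suc (\<beta> i)) * F (bump \<beta> i) x * t) / qabs t
        \<le> qabs c * (K * S * (qabs t)\<^sup>2) / qabs t"
      by (intro divide_right_mono mult_left_mono) auto
    also have "qabs c * qabs (F \<beta> (x + axis i t) - F \<beta> x - of_nat (Suc (\<beta> i)) * F (bump \<beta> i) x * t) / qabs t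
        = qabs (c * (F \<beta> (x + axis i t) - F \<beta> x - of_nat (Suc (\<beta> i)) * F (bump \<beta> i) x * t) / t)"
      by (simp only: qabs_divide qabs_mult)
    also have "c * (F \<beta> (x + axis i t) - F \<beta> x - of_nat (Suc (\<beta> i)) * F (bump \<beta> i) x * t) / t
        = (u (x + axis i t) - u x) / t - c * of_nat (Suc (\<beta> i)) * F (bump \<beta> i) x"
      using t u[OF mem[OF t(2)]] u[OF W(2)] by (simp add: field_simps)
    also have "qabs c * (K * S * (qabs t)\<^sup>2) / qabs t = qabs c * (K * S) * qabs t"
      using t by (simp add: power2_eq_square)
    finally show ?thesis .
  qed
  have "((\<lambda>t. (u (x + axis i t) - u x) / t) \<longlongrightarrow> c * of_nat (Suc (\<beta> i)) * F (bump \<beta> i) x) (at 0)"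
  proof (rule tendstoI)
    fix \<epsilon> :: real
    assume \<epsilon>: "\<epsilon> > 0"
    define M where "M = qabs c * (K * S) + 1"
    have M: "M > 0"
      using K B SB by (simp add: M_def add_nonneg_pos)
    show "\<forall>\<^sub>F t in at 0. dist ((u (x + axis i t) - u x) / t) (c * of_nat (Suc (\<beta> i)) * F (bump \<beta> i) x) < \<epsilon>"
      unfolding eventually_at
    proof (intro exI[of _ "min (min e 1) (\<epsilon> / M)"] conjI ballI impI)
      show "min (min e 1) (\<epsilon> / M) > 0"
        using e \<epsilon> M by simp
      fix t :: 'k
      assume t: "t \<noteq> 0 \<and> dist t 0 < min (min e 1) (\<epsilon> / M)"
      then have t': "qabs t < e" "qabs t < 1" "qabs t < \<epsilon> / M"
        by (simp_all add: qabs_def)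
      have "qabs c * (K * S) * qabs t \<le> M * qabs t"
        by (intro mult_right_mono) (simp_all add: M_def)
      also have "\<dots> < \<epsilon>"
        using t'(3) M by (simp add: field_simps)
      finally show "dist ((u (x + axis i t) - u x) / t) (c * of_nat (Suc (\<beta> i)) * F (bump \<beta> i) x) < \<epsilon>"
        using quot[of t] t t' by (simp add: dist_eq_qabs)
    qed
  qed
  then show ?thesis
    unfolding partial_def by (rule tendsto_Lim[OF at_0_neq_bot])
qed

text \<open>Each differentiation contributes the factor \<open>Suc (\<gamma> i)\<close>, and these
  multiply up to the factorial. Thus the order of differentiation drops out with no separate
  symmetry theorem.\<close>

lemma iter_partial_jet:
  assumes jet: "jet l W F B" and B: "B \<ge> 0" and W: "open W"
    and F0: "\<And>y. y \<in> W \<Longrightarrow> F (\<lambda>_. 0) y = f y"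
  shows "length w \<le> l \<Longrightarrow> x \<in> W \<Longrightarrow>
    iter_partial w f x = of_nat (mfact (count_list w)) * F (count_list w) x"
proof (induction w arbitrary: x)
  case Nil
  then show ?case
    using F0 by (simp add: iter_partial_def)
next
  case (Cons i w)
  have "iter_partial (i # w) f x = partial i (iter_partial w f) x"
    by (simp add: iter_partial_def)
  also have "\<dots> = of_nat (mfact (count_list w)) * of_nat (Suc (count_list w i)) * F (bump (count_list w) i) x"
    using Cons by (intro partial_jet[OF jet _ B W]) (simp_all add: mdeg_count_list)
  finally show ?case
    by (simp only: count_list_Cons_bump mfact_bump of_nat_mult mult_ac)
qed

text \<open>Spanning is made quantitative without compactness: if all pairings of \<open>c\<close>
  with the derivatives are at most \<open>M\<close>, then so, up to a constant, are its pairings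
  with the unit vectors, that is, the entries of \<open>c\<close>.\<close>

lemma nondegenerate_lower_bound:
  fixes F :: "'n::finite \<Rightarrow> ('d::finite \<Rightarrow> nat) \<Rightarrow> 'k ^ 'd \<Rightarrow> 'k"
  assumes l: "l \<ge> 1" and nd: "nondegenerate_at l f x0"
    and jet: "\<And>k. jet l W (F k) B" and B: "B \<ge> 0" and W: "open W" "x0 \<in> W"
    and F0: "\<And>k y. y \<in> W \<Longrightarrow> F k (\<lambda>_. 0) y = f y $ k"
  shows "\<exists>c1>0. \<forall>c :: 'k ^ 'n. \<exists>\<gamma>\<in>MI l. mdeg \<gamma> \<ge> 1 \<and>
    qabs (\<Sum>k\<in>UNIV. c $ k * F k \<gamma> x0) \<ge> c1 * max_norm c"
proof -
  let ?S = "{(\<chi> i. iter_partial is (\<lambda>y. f y $ i) x0) | is. 1 \<le> length is \<and> length is \<le> l}"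
  define dp where "dp c v = (\<Sum>k\<in>UNIV. c $ k * v $ k)" for c v :: "'k ^ 'n"
  \<comment> \<open>\<open>c\<close> and \<open>M\<close> are quantified inside, so that the
    constant depends on \<open>v\<close> alone.\<close>
  have span: "\<exists>K\<ge>0. \<forall>c M. (\<forall>s\<in>?S. qabs (dp c s) \<le> M) \<longrightarrow> qabs (dp c v) \<le> K * M" if "v \<in> vec.span ?S" for v
    using that
  proof (induction rule: vec.span_induct_alt)
    case base
    show ?case by (auto simp: dp_def)
  next
    case (step a x y)
    then obtain K where K: "K \<ge> 0" "\<And>c M. (\<forall>s\<in>?S. qabs (dp c s) \<le> M) \<Longrightarrow> qabs (dp c y) \<le> K * M"
      by blast
    show ?case
    proof (intro exI[of _ "qabs a + K"] conjI allI impI)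
      fix c M
      assume M: "\<forall>s\<in>?S. qabs (dp c s) \<le> M"
      have "dp c (a *s x + y) = a * dp c x + dp c y"
        by (simp add: dp_def sum.distrib sum_distrib_left algebra_simps)
      then have "qabs (dp c (a *s x + y)) \<le> qabs a * qabs (dp c x) + qabs (dp c y)"
        using qabs_triangle[of "a * dp c x" "dp c y"] by (simp add: qabs_mult)
      also have "\<dots> \<le> qabs a * M + K * M"
        using M step(1) K(2)[OF M] by (intro add_mono mult_left_mono) auto
      finally show "qabs (dp c (a *s x + y)) \<le> (qabs a + K) * M"
        by (simp add: distrib_right)
    qed (use K in auto)
  qed
  have "\<forall>k. \<exists>K\<ge>0. \<forall>c M. (\<forall>s\<in>?S. qabs (dp c s) \<le> M) \<longrightarrow> qabs (dp c (axis k 1)) \<le> K * M"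
    using nd unfolding nondegenerate_at_def by (intro allI span) simp
  from choice[OF this] obtain K where K: "\<And>k. K k \<ge> 0"
    "\<And>k c M. (\<forall>s\<in>?S. qabs (dp c s) \<le> M) \<Longrightarrow> qabs (dp c (axis k 1)) \<le> K k * M"
    by blast
  have dp_axis: "dp c (axis k 1) = c $ k" for c k
  proof -
    have "dp c (axis k 1) = (\<Sum>j\<in>UNIV. if j = k then c $ k else 0)"
      unfolding dp_def by (intro sum.cong) (auto simp: axis_def)
    then show ?thesis by simp
  qed
  define L where "L = (\<Sum>\<gamma>\<in>(MI l :: ('d \<Rightarrow> nat) set). real (mfact \<gamma>))"
  have L: "real (mfact \<gamma>) \<le> L" if "\<gamma> \<in> MI l" for \<gamma> :: "'d \<Rightarrow> nat"
    unfolding L_def using that by (intro member_le_sum[where f = "\<lambda>\<gamma>. real (mfact \<gamma>)"]) auto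
  have L0: "L \<ge> 0"
    by (simp add: L_def sum_nonneg)
  \<comment> \<open>Strictly larger than \<open>sum K UNIV * L\<close>, which yields the
    contradiction below.\<close>
  define Q where "Q = (1 + sum K UNIV) * (1 + L)"
  have sK: "sum K UNIV \<ge> 0"
    using K(1) by (simp add: sum_nonneg)
  have Q: "Q > 0"
    using sK L0 by (simp add: Q_def add_pos_nonneg)
  show ?thesis
  proof (intro exI[of _ "1 / Q"] conjI allI)
    fix c :: "'k ^ 'n"
    show "\<exists>\<gamma>\<in>MI l. mdeg \<gamma> \<ge> 1 \<and> qabs (\<Sum>k\<in>UNIV. c $ k * F k \<gamma> x0) \<ge> 1 / Q * max_norm c"
    proof (rule ccontr)
      assume neg: "\<not> ?thesis"
      then have small: "qabs (\<Sum>k\<in>UNIV. c $ k * F k \<gamma> x0) < 1 / Q * max_norm c" if "\<gamma> \<in> MI l" "mdeg \<gamma> \<ge> 1" for \<gamma>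
        using that by (meson not_le)
      have m: "max_norm c > 0"
      proof (rule ccontr)
        assume "\<not> ?thesis"
        then have "max_norm c = 0"
          using max_norm_nonneg[of c] by linarith
        \<comment> \<open>For \<open>c = 0\<close> both sides vanish, and any multi-index of degree
          1 contradicts the assumption; it lies in \<open>MI l\<close> because
          \<open>l \<ge> 1\<close>.\<close>
        then show False
          using small[of "bump (\<lambda>_. 0) undefined"] l by (simp add: MI_def not_less)
      qed
      have "qabs (dp c s) \<le> L * (1 / Q * max_norm c)" if s: "s \<in> ?S" for s
      proof -
        obtain w where w: "s = (\<chi> i. iter_partial w (\<lambda>y. f y $ i) x0)" "1 \<le> length w" "length w \<le> l"
          using s by blast
        have mem: "count_list w \<in> MI l" "mdeg (count_list w) \<ge> 1"
          using w by (simp_all add: MI_def mdeg_count_list)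
        have "dp c s = of_nat (mfact (count_list w)) * (\<Sum>k\<in>UNIV. c $ k * F k (count_list w) x0)"
          unfolding dp_def w(1) sum_distrib_left
          by (intro sum.cong refl) (simp add: iter_partial_jet[OF jet B W(1) F0 w(3) W(2)] mult_ac)
        then have "qabs (dp c s) = qabs (of_nat (mfact (count_list w)) :: 'k) * qabs (\<Sum>k\<in>UNIV. c $ k * F k (count_list w) x0)"
          by (simp add: qabs_mult)
        also have "\<dots> \<le> L * (1 / Q * max_norm c)"
          using small[OF mem] L[OF mem(1)] qabs_of_nat_le[of "mfact (count_list w)"] L0
          by (intro mult_mono) auto
        finally show ?thesis .
      qed
      then have "qabs (c $ k) \<le> K k * (L * (1 / Q * max_norm c))" for k
        using K(2)[of c "L * (1 / Q * max_norm c)" k] by (simp add: dp_axis)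
      also have "K k * (L * (1 / Q * max_norm c)) \<le> sum K UNIV * (L * (1 / Q * max_norm c))" for k
        using K(1) L0 Q m by (intro mult_right_mono member_le_sum) auto
      finally have "max_norm c \<le> sum K UNIV * (L * (1 / Q * max_norm c))"
        by (simp add: max_norm_le_iff)
      then have "Q * max_norm c \<le> sum K UNIV * L * max_norm c"
        using Q by (simp add: field_simps)
      then have "Q \<le> sum K UNIV * L"
        using m by simp
      then show False
        using sK L0 by (simp add: Q_def algebra_simps)
    qed
  qed (use Q in simp)
qed

end

section \<open>Taylor expansions one variable at a time\<close>

definition MI_on :: "'d set \<Rightarrow> nat \<Rightarrow> ('d::finite \<Rightarrow> nat) set" where
  "MI_on S n = {\<gamma>. (\<forall>i. i \<notin> S \<longrightarrow> \<gamma> i = 0) \<and> mdeg \<gamma> \<le> n}"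

lemma MI_on_UNIV [simp]: "MI_on UNIV n = MI n"
  by (simp add: MI_on_def MI_def)

lemma MI_on_empty [simp]: "MI_on {} n = {\<lambda>_. 0}"
  by (auto simp: MI_on_def)

lemma finite_MI_on [simp]: "finite (MI_on S n)"
  by (rule finite_subset[OF _ finite_MI[of n]]) (auto simp: MI_on_def MI_def)

lemma mdeg_fun_upd: "\<gamma> j = 0 \<Longrightarrow> mdeg (\<gamma>(j := m)) = mdeg \<gamma> + m"
proof -
  assume "\<gamma> j = 0"
  then have "\<gamma>(j := m) = (\<lambda>i. \<gamma> i + (if i = j then m else 0))"
    by auto
  then show ?thesis
    by (simp add: mdeg_add) (simp add: mdeg_def)
qed

lemma mdeg_remove: "mdeg \<gamma> = mdeg (\<gamma>(j := 0)) + \<gamma> j"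
  using mdeg_fun_upd[of "\<gamma>(j := 0)" j "\<gamma> j"] by simp

lemma monom_at_fun_upd: "\<gamma> j = 0 \<Longrightarrow> monom_at h (\<gamma>(j := m)) = monom_at h \<gamma> * h $ j ^ m"
proof -
  assume "\<gamma> j = 0"
  then have "monom_at h (\<gamma>(j := m)) = (\<Prod>i\<in>UNIV. h $ i ^ \<gamma> i * (if i = j then h $ j ^ m else 1))"
    unfolding monom_at_def by (intro prod.cong) auto
  then show ?thesis
    by (simp add: monom_at_def prod.distrib)
qed

lemma monom_at_cong:
  assumes "\<And>i. \<gamma> i \<noteq> 0 \<Longrightarrow> h $ i = h' $ i"
  shows "monom_at h \<gamma> = monom_at h' \<gamma>"
  unfolding monom_at_def
proof (rule prod.cong)
  fix i
  show "h $ i ^ \<gamma> i = h' $ i ^ \<gamma> i"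
    using assms[of i] by (cases "\<gamma> i = 0") auto
qed simp

lemma sum_MI_on_insert:
  fixes c :: "('d::finite \<Rightarrow> nat) \<Rightarrow> 'k::comm_semiring_1"
  assumes "j \<notin> S"
  shows "(\<Sum>\<gamma>\<in>MI_on (insert j S) n. c \<gamma> * monom_at h \<gamma>) =
    (\<Sum>m\<le>n. (\<Sum>\<gamma>\<in>MI_on S (n - m). c (\<gamma>(j := m)) * monom_at h \<gamma>) * h $ j ^ m)"
proof -
  have "(\<Sum>\<gamma>\<in>MI_on (insert j S) n. c \<gamma> * monom_at h \<gamma>) =
    (\<Sum>(m, \<gamma>)\<in>(SIGMA m:{..n}. MI_on S (n - m)). c (\<gamma>(j := m)) * monom_at h \<gamma> * h $ j ^ m)"
  proof (rule sum.reindex_bij_witness[where i = "\<lambda>(m, \<gamma>). \<gamma>(j := m)" and j = "\<lambda>\<gamma>. (\<gamma> j, \<gamma>(j := 0))"], goal_cases)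
    case (1 \<gamma>)
    show ?case by simp
  next
    case (2 \<gamma>)
    then have "mdeg (\<gamma>(j := 0)) + \<gamma> j \<le> n"
      using mdeg_remove[of \<gamma> j] by (simp add: MI_on_def)
    then have "\<gamma> j \<le> n" "mdeg (\<gamma>(j := 0)) \<le> n - \<gamma> j"
      by auto
    then show ?case
      using 2 by (auto simp: MI_on_def)
  next
    case (3 b)
    then show ?case using assms by (auto simp: MI_on_def fun_eq_iff)
  next
    case (4 b)
    obtain m \<gamma> where b: "b = (m, \<gamma>)" by (cases b)
    have "\<gamma> j = 0"
      using 4 b assms by (auto simp: MI_on_def)
    then have "mdeg (\<gamma>(j := m)) = mdeg \<gamma> + m"
      by (rule mdeg_fun_upd)
    then show ?case
      using 4 b by (auto simp: MI_on_def)
  next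
    case (5 \<gamma>)
    have "monom_at h \<gamma> = monom_at h (\<gamma>(j := 0)) * h $ j ^ \<gamma> j"
      using monom_at_fun_upd[of "\<gamma>(j := 0)" j h "\<gamma> j"] by simp
    then show ?case by (simp add: mult.assoc)
  qed
  also have "\<dots> = (\<Sum>m\<le>n. \<Sum>\<gamma>\<in>MI_on S (n - m). c (\<gamma>(j := m)) * monom_at h \<gamma> * h $ j ^ m)"
    by (subst sum.Sigma) auto
  finally show ?thesis
    by (simp add: sum_distrib_right)
qed

context Q_nu
begin

text \<open>
  The coordinates are expanded in the order of the list \<open>ord\<close>. Only coefficients \<open>\<beta>\<close> that vanish
  on the remaining coordinates occur, so partial derivatives need not commute.
\<close>

lemma taylor_coordinatewise:
  fixes D :: "('d::finite \<Rightarrow> nat) \<Rightarrow> 'k ^ 'd \<Rightarrow> 'k"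
  assumes ord: "distinct ord" "set ord = UNIV" and A: "A \<ge> 0"
    and step: "\<And>ps j js \<beta> x y. ord = ps @ j # js \<Longrightarrow> (\<And>i. i \<in> set (j # js) \<Longrightarrow> \<beta> i = 0) \<Longrightarrow>
      \<beta> \<in> MI l \<Longrightarrow> x \<in> cube x0 R \<Longrightarrow> y \<in> cube x0 R \<Longrightarrow> (\<And>i. i \<noteq> j \<Longrightarrow> x $ i = y $ i) \<Longrightarrow>
      qabs (D \<beta> y - (\<Sum>m\<le>l - mdeg \<beta>. D (\<beta>(j := m)) x * (y $ j - x $ j) ^ m))
        \<le> A * qabs (y $ j - x $ j) ^ (l + 1 - mdeg \<beta>)"
  shows "\<exists>A'\<ge>0. taylor l (cube x0 R) D A' (D (\<lambda>_. 0))"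
proof -
  \<comment> \<open>Induction over the suffixes \<open>js\<close> of \<open>ord\<close>: the
    coordinates in \<open>js\<close> may still move, and \<open>\<beta>\<close> is supported on
    those already expanded.\<close>
  have "\<exists>A'\<ge>0. \<forall>\<beta> x y. (\<forall>i\<in>set js. \<beta> i = 0) \<longrightarrow> \<beta> \<in> MI l \<longrightarrow> x \<in> cube x0 R \<longrightarrow> y \<in> cube x0 R \<longrightarrow>
      (\<forall>i. i \<notin> set js \<longrightarrow> x $ i = y $ i) \<longrightarrow>
      qabs (D \<beta> y - (\<Sum>\<gamma>\<in>MI_on (set js) (l - mdeg \<beta>). D (\<lambda>i. \<beta> i + \<gamma> i) x * monom_at (y - x) \<gamma>))
        \<le> A' * max_norm (y - x) ^ (l + 1 - mdeg \<beta>)"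
    if "ord = ps @ js" for ps js
    using that
  proof (induction js arbitrary: ps)
    case Nil
    show ?case
    proof (intro exI[of _ 0] conjI allI impI)
      fix \<beta> :: "'d \<Rightarrow> nat" and x y :: "'k ^ 'd"
      assume "\<forall>i. i \<notin> set [] \<longrightarrow> x $ i = y $ i"
      then have "x = y"
        by (simp add: vec_eq_iff)
      then show "qabs (D \<beta> y - (\<Sum>\<gamma>\<in>MI_on (set []) (l - mdeg \<beta>). D (\<lambda>i. \<beta> i + \<gamma> i) x * monom_at (y - x) \<gamma>))
        \<le> 0 * max_norm (y - x) ^ (l + 1 - mdeg \<beta>)"
        by simp
    qed simp
  next
    case (Cons j js)
    obtain A1 where A1: "A1 \<ge> 0"
      and IH: "\<And>\<beta> x y. (\<forall>i\<in>set js. \<beta> i = 0) \<Longrightarrow> \<beta> \<in> MI l \<Longrightarrow> x \<in> cube x0 R \<Longrightarrow> y \<in> cube x0 R \<Longrightarrow>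
      (\<forall>i. i \<notin> set js \<longrightarrow> x $ i = y $ i) \<Longrightarrow>
      qabs (D \<beta> y - (\<Sum>\<gamma>\<in>MI_on (set js) (l - mdeg \<beta>). D (\<lambda>i. \<beta> i + \<gamma> i) x * monom_at (y - x) \<gamma>))
        \<le> A1 * max_norm (y - x) ^ (l + 1 - mdeg \<beta>)"
      using Cons.IH[of "ps @ [j]"] Cons.prems by auto
    have j: "j \<notin> set js"
      using ord Cons.prems by auto
    \<comment> \<open>The expansion in \<open>j\<close> contributes one error, and the induction
      hypothesis one for each of its at most \<open>l + 1\<close> coefficients.\<close>
    show ?case
    proof (intro exI[of _ "A + real (l + 1) * A1"] conjI allI impI)
      fix \<beta> :: "'d \<Rightarrow> nat" and x y :: "'k ^ 'd"
      assume \<beta>: "\<forall>i\<in>set (j # js). \<beta> i = 0" "\<beta> \<in> MI l"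
        and xy: "x \<in> cube x0 R" "y \<in> cube x0 R" "\<forall>i. i \<notin> set (j # js) \<longrightarrow> x $ i = y $ i"
      \<comment> \<open>The move from \<open>x\<close> to \<open>y\<close> passes through
        \<open>x'\<close>: only the coordinate \<open>j\<close> changes from \<open>x'\<close> to
        \<open>y\<close>, and only those in \<open>js\<close> from \<open>x\<close> to
        \<open>x'\<close>.\<close>
      define x' where "x' = (\<chi> i. if i = j then x $ i else y $ i)"
      define t where "t = y $ j - x $ j"
      define n where "n = l - mdeg \<beta>"
      define H where "H = max_norm (y - x)"
      define E where "E m = D (\<beta>(j := m)) x' -
        (\<Sum>\<gamma>\<in>MI_on (set js) (n - m). D (\<lambda>i. (\<beta>(j := m)) i + \<gamma> i) x * monom_at (x' - x) \<gamma>)" for m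
      have x': "x' \<in> cube x0 R"
        using xy by (auto simp: cube_def max_norm_less_iff x'_def)
      have tH: "qabs t \<le> H"
        using qabs_le_max_norm[of "y - x" j] by (simp add: t_def H_def)
      have x'H: "max_norm (x' - x) \<le> H"
        unfolding max_norm_le_iff H_def
        using qabs_le_max_norm[of "y - x"] by (auto simp: x'_def)
      have H0: "H \<ge> 0"
        by (simp add: H_def)
      \<comment> \<open>The error of the coefficient of \<open>t ^ m\<close> has an order lower by
        \<open>m\<close>, which the factor \<open>qabs t ^ m\<close> restores.\<close>
      have E: "qabs (E m) * qabs t ^ m \<le> A1 * H ^ (l + 1 - mdeg \<beta>)" if m: "m \<le> n" for m
      proof -
        have deg: "mdeg (\<beta>(j := m)) = mdeg \<beta> + m"
          using \<beta> by (simp add: mdeg_fun_upd)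
        have "qabs (E m) \<le> A1 * max_norm (x' - x) ^ (l + 1 - mdeg (\<beta>(j := m)))"
        proof -
          have "n - m = l - mdeg (\<beta>(j := m))"
            by (simp add: deg n_def)
          moreover have "\<beta>(j := m) \<in> MI l"
            using m \<beta> by (simp add: MI_def deg n_def)
          ultimately show ?thesis
            unfolding E_def using IH[of "\<beta>(j := m)" x x'] \<beta> j xy x' by (auto simp: x'_def)
        qed
        also have "\<dots> \<le> A1 * H ^ (l + 1 - mdeg (\<beta>(j := m)))"
          using A1 x'H by (intro mult_left_mono power_mono) auto
        finally have "qabs (E m) * qabs t ^ m \<le> (A1 * H ^ (l + 1 - mdeg (\<beta>(j := m)))) * H ^ m"
          using tH A1 H0 by (intro mult_mono power_mono) auto
        also have "l + 1 - mdeg (\<beta>(j := m)) + m = l + 1 - mdeg \<beta>"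
          using m \<beta> by (simp add: deg n_def MI_def)
        then have "(A1 * H ^ (l + 1 - mdeg (\<beta>(j := m)))) * H ^ m = A1 * H ^ (l + 1 - mdeg \<beta>)"
          by (metis mult.assoc power_add)
        finally show ?thesis .
      qed
      have "(\<Sum>\<gamma>\<in>MI_on (set (j # js)) n. D (\<lambda>i. \<beta> i + \<gamma> i) x * monom_at (y - x) \<gamma>)
          = (\<Sum>m\<le>n. (\<Sum>\<gamma>\<in>MI_on (set js) (n - m). D (\<lambda>i. \<beta> i + (\<gamma>(j := m)) i) x * monom_at (y - x) \<gamma>) * t ^ m)"
        using sum_MI_on_insert[OF j, of "\<lambda>\<gamma>. D (\<lambda>i. \<beta> i + \<gamma> i) x"] by (simp add: t_def)
      also have "\<dots> = (\<Sum>m\<le>n. (D (\<beta>(j := m)) x' - E m) * t ^ m)"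
      proof (intro sum.cong refl arg_cong2[where f = "(*)"])
        fix m
        have "(\<Sum>\<gamma>\<in>MI_on (set js) (n - m). D (\<lambda>i. \<beta> i + (\<gamma>(j := m)) i) x * monom_at (y - x) \<gamma>)
           = (\<Sum>\<gamma>\<in>MI_on (set js) (n - m). D (\<lambda>i. (\<beta>(j := m)) i + \<gamma> i) x * monom_at (x' - x) \<gamma>)"
        proof (intro sum.cong refl arg_cong2[where f = "(*)"])
          fix \<gamma> :: "'d \<Rightarrow> nat"
          assume \<gamma>: "\<gamma> \<in> MI_on (set js) (n - m)"
          have "(\<lambda>i. \<beta> i + (\<gamma>(j := m)) i) = (\<lambda>i. (\<beta>(j := m)) i + \<gamma> i)"
            using \<gamma> \<beta> j by (auto simp: MI_on_def)
          then show "D (\<lambda>i. \<beta> i + (\<gamma>(j := m)) i) x = D (\<lambda>i. (\<beta>(j := m)) i + \<gamma> i) x"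
            by simp
          show "monom_at (y - x) \<gamma> = monom_at (x' - x) \<gamma>"
            using \<gamma> j by (intro monom_at_cong) (auto simp: MI_on_def x'_def)
        qed
        then show "(\<Sum>\<gamma>\<in>MI_on (set js) (n - m). D (\<lambda>i. \<beta> i + (\<gamma>(j := m)) i) x * monom_at (y - x) \<gamma>)
          = D (\<beta>(j := m)) x' - E m"
          by (simp add: E_def)
      qed
      finally have sum: "(\<Sum>\<gamma>\<in>MI_on (set (j # js)) n. D (\<lambda>i. \<beta> i + \<gamma> i) x * monom_at (y - x) \<gamma>)
          = (\<Sum>m\<le>n. D (\<beta>(j := m)) x' * t ^ m) - (\<Sum>m\<le>n. E m * t ^ m)"
        by (simp add: left_diff_distrib sum_subtractf)
      have 1: "qabs (D \<beta> y - (\<Sum>m\<le>n. D (\<beta>(j := m)) x' * t ^ m)) \<le> A * H ^ (l + 1 - mdeg \<beta>)"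
      proof -
        have "qabs (D \<beta> y - (\<Sum>m\<le>l - mdeg \<beta>. D (\<beta>(j := m)) x' * (y $ j - x' $ j) ^ m))
          \<le> A * qabs (y $ j - x' $ j) ^ (l + 1 - mdeg \<beta>)"
          by (rule step[OF Cons.prems _ \<beta>(2) x' xy(2)]) (use \<beta> in \<open>auto simp: x'_def\<close>)
        also have "\<dots> \<le> A * H ^ (l + 1 - mdeg \<beta>)"
          using tH A by (intro mult_left_mono power_mono) (auto simp: x'_def t_def)
        finally show ?thesis
          by (simp add: x'_def t_def n_def)
      qed
      have 2: "qabs (\<Sum>m\<le>n. E m * t ^ m) \<le> real (card {..n}) * (A1 * H ^ (l + 1 - mdeg \<beta>))"
        using E by (intro qabs_sum_bound) (simp add: qabs_mult qabs_power)
      also have "\<dots> \<le> real (l + 1) * (A1 * H ^ (l + 1 - mdeg \<beta>))"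
        using A1 H0 by (intro mult_right_mono) (auto simp: n_def)
      finally have 2: "qabs (\<Sum>m\<le>n. E m * t ^ m) \<le> real (l + 1) * (A1 * H ^ (l + 1 - mdeg \<beta>))" .
      have "qabs (D \<beta> y - (\<Sum>\<gamma>\<in>MI_on (set (j # js)) n. D (\<lambda>i. \<beta> i + \<gamma> i) x * monom_at (y - x) \<gamma>))
          = qabs ((D \<beta> y - (\<Sum>m\<le>n. D (\<beta>(j := m)) x' * t ^ m)) + (\<Sum>m\<le>n. E m * t ^ m))"
        unfolding sum by (simp add: algebra_simps)
      also have "\<dots> \<le> A * H ^ (l + 1 - mdeg \<beta>) + real (l + 1) * (A1 * H ^ (l + 1 - mdeg \<beta>))"
        by (rule order_trans[OF qabs_triangle add_mono[OF 1 2]])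
      finally show "qabs (D \<beta> y - (\<Sum>\<gamma>\<in>MI_on (set (j # js)) (l - mdeg \<beta>). D (\<lambda>i. \<beta> i + \<gamma> i) x * monom_at (y - x) \<gamma>))
        \<le> (A + real (l + 1) * A1) * max_norm (y - x) ^ (l + 1 - mdeg \<beta>)"
        unfolding n_def H_def by (simp only: distrib_right mult.assoc)
    qed (use A A1 in simp)
  qed
  from this[of "[]" ord] obtain A' where "A' \<ge> 0" and A': "\<And>\<beta> x y. (\<forall>i\<in>set ord. \<beta> i = 0) \<Longrightarrow> \<beta> \<in> MI l \<Longrightarrow> x \<in> cube x0 R \<Longrightarrow> y \<in> cube x0 R \<Longrightarrow>
      (\<forall>i. i \<notin> set ord \<longrightarrow> x $ i = y $ i) \<Longrightarrow>
      qabs (D \<beta> y - (\<Sum>\<gamma>\<in>MI_on (set ord) (l - mdeg \<beta>). D (\<lambda>i. \<beta> i + \<gamma> i) x * monom_at (y - x) \<gamma>))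
        \<le> A' * max_norm (y - x) ^ (l + 1 - mdeg \<beta>)"
    by auto
  show ?thesis
  proof (intro exI[of _ A'] conjI)
    show "taylor l (cube x0 R) D A' (D (\<lambda>_. 0))"
      using A'[of "\<lambda>_. 0"] ord(2) by (simp add: taylor_def)
  qed fact
qed

end

section \<open>Taylor expansions from difference quotients\<close>

lemma tendsto_funI:
  fixes f :: "'a \<Rightarrow> 'b \<Rightarrow> 'c::topological_space"
  assumes "\<And>i. ((\<lambda>x. f x i) \<longlongrightarrow> g i) F"
  shows "(f \<longlongrightarrow> g) F"
proof -
  have "limitin (product_topology (\<lambda>_. euclidean) UNIV) f g F"
    using assms by (simp add: limitin_componentwise)
  then show ?thesis
    by (simp add: euclidean_product_topology)
qed

text \<open>The order of the variables in \<open>Phi\<close> is immaterial, so \<open>j\<close> may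
  be put at the head of the list, where its operator is applied last.\<close>

lemma Phi_bump: "Phi (bump \<beta> j) f = diff_quot j (Phi \<beta> f)"
proof -
  obtain js where js: "distinct js" "set js = UNIV - {j}"
    using finite_distinct_list[of "UNIV - {j}"] by auto
  have "foldr (\<lambda>i. diff_quot i ^^ bump \<beta> j i) js F = foldr (\<lambda>i. diff_quot i ^^ \<beta> i) js F" for F :: "('a \<Rightarrow> nat \<Rightarrow> 'b) \<Rightarrow> 'b"
    using js(2) by (intro foldr_cong) (auto simp: bump_def)
  moreover have "distinct (j # js)" "set (j # js) = UNIV"
    using js by auto
  moreover have "bump \<beta> j j = Suc (\<beta> j)"
    by (simp add: bump_def)
  ultimately show ?thesis
    by (simp add: Phi_foldr[of "j # js"])
qed

lemma grid_iff:
  "X \<in> grid \<beta> V \<longleftrightarrow> (\<forall>j m. if m \<le> \<beta> j then X j m \<in> V j else X j m = undefined)"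
  by (auto simp: grid_def PiE_iff extensional_def)

lemma grid_mono: "(\<And>j. V j \<subseteq> V' j) \<Longrightarrow> grid \<beta> V \<subseteq> grid \<beta> V'"
  unfolding grid_def by (intro PiE_mono) auto

lemma grid_drop_at:
  assumes "X \<in> grid (bump \<beta> j) V" "k \<le> 1"
  shows "X(j := drop_at k (X j)) \<in> grid \<beta> V"
  using assms by (auto simp: grid_iff bump_def drop_at_def)

lemma inj_on_drop_at:
  assumes "inj_on s {..Suc n}"
  shows "inj_on (drop_at k s) {..n}"
proof (rule inj_onI)
  fix x y
  assume xy: "x \<in> {..n}" "y \<in> {..n}" "drop_at k s x = drop_at k s y"
  let ?g = "\<lambda>x. if x < k then x else Suc x"
  have "s (?g x) = s (?g y)"
    using xy(3) by (auto simp: drop_at_def split: if_splits)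
  moreover have "?g x \<in> {..Suc n}" "?g y \<in> {..Suc n}"
    using xy by auto
  ultimately have "?g x = ?g y"
    by (rule inj_onD[OF assms])
  then show "x = y"
    by (auto split: if_splits)
qed

context Q_nu
begin

section \<open>Limits of sums and products in the field\<close>

lemma tendsto_qabs_iff: "(f \<longlongrightarrow> (a::'k)) F \<longleftrightarrow> ((\<lambda>x. qabs (f x - a)) \<longlongrightarrow> 0) F"
  by (subst tendsto_dist_iff) (simp add: dist_eq_qabs)

lemma tendsto_qabs_null:
  assumes "(b \<longlongrightarrow> 0) F" "\<And>x. qabs (f x - (a::'k)) \<le> b x"
  shows "(f \<longlongrightarrow> a) F"
  unfolding tendsto_qabs_iff
  by (rule Lim_null_comparison[OF _ assms(1)]) (simp add: assms(2))

text \<open>The sort of \<open>'k\<close> contains no continuity of the operations; it follows from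
  the properties of \<open>qabs\<close>.\<close>

lemma qtendsto_add:
  assumes "(f \<longlongrightarrow> (a::'k)) F" "(g \<longlongrightarrow> b) F"
  shows "((\<lambda>x. f x + g x) \<longlongrightarrow> a + b) F"
proof (rule tendsto_qabs_null)
  show "((\<lambda>x. qabs (f x - a) + qabs (g x - b)) \<longlongrightarrow> 0) F"
    using tendsto_add[OF assms[unfolded tendsto_qabs_iff]] by simp
  show "qabs (f x + g x - (a + b)) \<le> qabs (f x - a) + qabs (g x - b)" for x
    using qabs_triangle[of "f x - a" "g x - b"] by (simp add: algebra_simps)
qed

lemma qtendsto_mult:
  assumes "(f \<longlongrightarrow> (a::'k)) F" "(g \<longlongrightarrow> b) F"
  shows "((\<lambda>x. f x * g x) \<longlongrightarrow> a * b) F"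
proof (rule tendsto_qabs_null)
  note 1 = assms[unfolded tendsto_qabs_iff]
  show "((\<lambda>x. qabs (f x - a) * qabs (g x - b) + qabs (f x - a) * qabs b + qabs a * qabs (g x - b)) \<longlongrightarrow> 0) F"
    using tendsto_add[OF tendsto_add[OF tendsto_mult[OF 1] tendsto_mult_right[OF 1(1), of "qabs b"]] tendsto_mult_left[OF 1(2), of "qabs a"]]
    by simp
  show "qabs (f x * g x - a * b) \<le> qabs (f x - a) * qabs (g x - b) + qabs (f x - a) * qabs b + qabs a * qabs (g x - b)" for x
  proof -
    have "f x * g x - a * b = (f x - a) * (g x - b) + (f x - a) * b + a * (g x - b)"
      by (simp add: algebra_simps)
    then show ?thesis
      using qabs_triangle[of "(f x - a) * (g x - b) + (f x - a) * b" "a * (g x - b)"]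
        qabs_triangle[of "(f x - a) * (g x - b)" "(f x - a) * b"]
      by (simp add: qabs_mult)
  qed
qed

lemma qtendsto_diff:
  assumes "(f \<longlongrightarrow> (a::'k)) F" "(g \<longlongrightarrow> b) F"
  shows "((\<lambda>x. f x - g x) \<longlongrightarrow> a - b) F"
  using qtendsto_add[OF assms(1) qtendsto_mult[OF tendsto_const[of "-1"] assms(2)]] by simp

lemma tendsto_unif_power: "(\<lambda>n. c + a * unif ^ n) \<longlonglongrightarrow> (c::'k)"
proof (rule tendsto_qabs_null)
  have "(\<lambda>n. qabs unif ^ n) \<longlonglongrightarrow> 0"
    using unif by (intro LIMSEQ_realpow_zero) auto
  from tendsto_mult_left[OF this, of "qabs a"]
  show "(\<lambda>n. qabs a * qabs unif ^ n) \<longlonglongrightarrow> 0"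
    by simp
qed (simp add: qabs_mult qabs_power)

text \<open>Distinct multiples of \<open>unif ^ n\<close> move coinciding entries apart, since the
  characteristic is 0. Thus every point of a grid with open factors is a limit of grid points at
  which the extension of the difference quotient is prescribed.\<close>

definition perturb :: "('d \<Rightarrow> nat) \<Rightarrow> ('d \<Rightarrow> nat \<Rightarrow> 'k) \<Rightarrow> nat \<Rightarrow> 'd \<Rightarrow> nat \<Rightarrow> 'k" where
  "perturb \<beta> X n = (\<lambda>j m. if m \<le> \<beta> j then X j m + of_nat (Suc m) * unif ^ n else X j m)"

lemma perturb_tendsto: "perturb \<beta> X \<longlonglongrightarrow> X"
proof (intro tendsto_funI)
  fix j m
  show "(\<lambda>n. perturb \<beta> X n j m) \<longlonglongrightarrow> X j m"
    unfolding perturb_def using tendsto_unif_power by (cases "m \<le> \<beta> j") (auto simp del: of_nat_Suc)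
qed

lemma tendsto_funD: "(f \<longlongrightarrow> g) F \<Longrightarrow> ((\<lambda>x. f x i) \<longlongrightarrow> (g i :: 'c::topological_space)) F"
proof -
  assume "(f \<longlongrightarrow> g) F"
  then have "limitin (product_topology (\<lambda>_. euclidean) UNIV) f g F"
    by (simp add: euclidean_product_topology)
  then show ?thesis
    by (simp add: limitin_componentwise)
qed

lemma perturb_grid:
  fixes \<beta> :: "'d::finite \<Rightarrow> nat"
  assumes V: "\<And>j. open (V j)" and X: "X \<in> grid \<beta> V"
  shows "\<forall>\<^sub>F n in sequentially. perturb \<beta> X n \<in> grid \<beta> V"
proof -
  have "\<forall>\<^sub>F n in sequentially. \<forall>j. \<forall>m\<in>{..\<beta> j}. perturb \<beta> X n j m \<in> V j"
  proof (intro eventually_all_finite eventually_ball_finite ballI)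
    fix j m
    assume "m \<in> {..\<beta> j}"
    then have "X j m \<in> V j"
      using X by (auto simp: grid_iff split: if_splits)
    then show "\<forall>\<^sub>F n in sequentially. perturb \<beta> X n j m \<in> V j"
      by (rule topological_tendstoD[OF tendsto_funD[OF tendsto_funD[OF perturb_tendsto]] V])
  qed simp
  then show ?thesis
    by eventually_elim (use X in \<open>auto simp: grid_iff perturb_def\<close>)
qed

lemma perturb_inj:
  fixes \<beta> :: "'d::finite \<Rightarrow> nat"
  shows "\<forall>\<^sub>F n in sequentially. \<forall>j. inj_on (perturb \<beta> X n j) {..\<beta> j}"
proof -
  have "\<forall>\<^sub>F n in sequentially. \<forall>j. \<forall>m\<in>{..\<beta> j}. \<forall>m'\<in>{..\<beta> j}. m \<noteq> m' \<longrightarrow> perturb \<beta> X n j m \<noteq> perturb \<beta> X n j m'"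
  proof (intro eventually_all_finite eventually_ball_finite ballI)
    fix j m m'
    assume m: "m \<in> {..\<beta> j}" "m' \<in> {..\<beta> j}"
    show "\<forall>\<^sub>F n in sequentially. m \<noteq> m' \<longrightarrow> perturb \<beta> X n j m \<noteq> perturb \<beta> X n j m'"
    proof (cases "X j m = X j m'")
      case True
      then have "m \<noteq> m' \<longrightarrow> perturb \<beta> X n j m \<noteq> perturb \<beta> X n j m'" for n
        using m unif by (simp add: perturb_def del: of_nat_Suc)
      then show ?thesis by simp
    next
      case False
      have "(\<lambda>n. perturb \<beta> X n j m - perturb \<beta> X n j m') \<longlonglongrightarrow> X j m - X j m'"
        by (intro qtendsto_diff tendsto_funD[OF tendsto_funD[OF perturb_tendsto]])
      moreover have "open (- {0::'k})" "X j m - X j m' \<in> - {0}"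
        using False by auto
      ultimately have "\<forall>\<^sub>F n in sequentially. perturb \<beta> X n j m - perturb \<beta> X n j m' \<in> - {0}"
        by (rule topological_tendstoD)
      then show ?thesis
        by eventually_elim auto
    qed
  qed simp_all
  then show ?thesis
    by eventually_elim (auto simp: inj_on_def)
qed

definition extends_Phi :: "nat \<Rightarrow> ('d::finite \<Rightarrow> 'k set) \<Rightarrow> ('k ^ 'd \<Rightarrow> 'k) \<Rightarrow>
    (('d \<Rightarrow> nat) \<Rightarrow> ('d \<Rightarrow> nat \<Rightarrow> 'k) \<Rightarrow> 'k) \<Rightarrow> bool" where
  "extends_Phi k V f G \<longleftrightarrow> (\<forall>\<beta>\<in>MI k. continuous_on (grid \<beta> V) (G \<beta>) \<and>
     (\<forall>X\<in>grid \<beta> V. (\<forall>j. inj_on (X j) {..\<beta> j}) \<longrightarrow> G \<beta> X = Phi \<beta> f X))"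

text \<open>Both sides are continuous on the grid and agree, by the recursion for
  \<open>Phi\<close>, at points with distinct entries, which are dense. Clearing the denominator
  keeps the equation meaningful when \<open>X j 0 = X j 1\<close>.\<close>

lemma extends_Phi_step:
  assumes V: "\<And>j. open (V j)" and G: "extends_Phi k V f G" and \<beta>: "mdeg \<beta> < k"
    and X: "X \<in> grid (bump \<beta> j) V"
  shows "G \<beta> (X(j := drop_at 1 (X j))) - G \<beta> (X(j := drop_at 0 (X j))) = (X j 0 - X j 1) * G (bump \<beta> j) X"
proof -
  let ?b = "bump \<beta> j"
  have mem: "\<beta> \<in> MI k" "?b \<in> MI k"
    using \<beta> by (auto simp: MI_def)
  define P where "P = perturb ?b X"
  define L where "L = (\<lambda>Y. G \<beta> (Y(j := drop_at 1 (Y j))) - G \<beta> (Y(j := drop_at 0 (Y j))))"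
  define R where "R = (\<lambda>Y. (Y j 0 - Y j 1) * G ?b Y)"
  have P: "P \<longlonglongrightarrow> X"
    unfolding P_def by (rule perturb_tendsto)
  have ev: "\<forall>\<^sub>F n in sequentially. P n \<in> grid ?b V"
    unfolding P_def by (rule perturb_grid[OF V X])
  have lim: "(\<lambda>n. G \<beta> ((P n)(j := drop_at k (P n j)))) \<longlonglongrightarrow> G \<beta> (X(j := drop_at k (X j)))" if k: "k \<le> 1" for k
  proof (rule continuous_on_tendsto_compose[of "grid \<beta> V" "G \<beta>" "\<lambda>n. (P n)(j := drop_at k (P n j))"])
    show "continuous_on (grid \<beta> V) (G \<beta>)"
      using G mem by (simp add: extends_Phi_def)
    show "X(j := drop_at k (X j)) \<in> grid \<beta> V"
      using X k by (rule grid_drop_at)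
    show "\<forall>\<^sub>F n in sequentially. (P n)(j := drop_at k (P n j)) \<in> grid \<beta> V"
      using ev by eventually_elim (rule grid_drop_at[OF _ k])
    show "(\<lambda>n. (P n)(j := drop_at k (P n j))) \<longlonglongrightarrow> X(j := drop_at k (X j))"
    proof (intro tendsto_funI)
      fix i m
      show "(\<lambda>n. ((P n)(j := drop_at k (P n j))) i m) \<longlonglongrightarrow> (X(j := drop_at k (X j))) i m"
        using tendsto_funD[OF tendsto_funD[OF P]] by (cases "i = j"; cases "m < k") (auto simp: drop_at_def)
    qed
  qed
  have "(\<lambda>n. L (P n)) \<longlonglongrightarrow> L X"
    unfolding L_def by (intro qtendsto_diff lim) auto
  moreover have "(\<lambda>n. R (P n)) \<longlonglongrightarrow> R X"
    unfolding R_def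
  proof (intro qtendsto_mult qtendsto_diff tendsto_funD[OF tendsto_funD[OF P]])
    show "(\<lambda>n. G ?b (P n)) \<longlonglongrightarrow> G ?b X"
      using G mem by (intro continuous_on_tendsto_compose[OF _ P X ev]) (simp add: extends_Phi_def)
  qed
  moreover have "\<forall>\<^sub>F n in sequentially. L (P n) = R (P n)"
    using ev perturb_inj[of ?b X, folded P_def]
  proof eventually_elim
    case (elim n)
    have d: "G \<beta> ((P n)(j := drop_at k (P n j))) = Phi \<beta> f ((P n)(j := drop_at k (P n j)))" if k: "k \<le> 1" for k
    proof -
      have "inj_on (((P n)(j := drop_at k (P n j))) i) {..\<beta> i}" for i
      proof (cases "i = j")
        case True
        have "inj_on (P n j) {..Suc (\<beta> j)}"
          using spec[OF elim(2), of j] by (simp add: bump_def)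
        then show ?thesis
          using True by (simp add: inj_on_drop_at)
      next
        case False
        then show ?thesis
          using spec[OF elim(2), of i] by (simp add: bump_def)
      qed
      then show ?thesis
        using G mem grid_drop_at[OF elim(1) k] by (simp add: extends_Phi_def)
    qed
    have "G ?b (P n) = Phi ?b f (P n)"
      using G mem elim by (simp add: extends_Phi_def)
    also have "\<dots> = L (P n) / (P n j 0 - P n j 1)"
      by (simp add: Phi_bump diff_quot_def L_def d)
    finally have *: "G ?b (P n) = L (P n) / (P n j 0 - P n j 1)" .
    have "P n j 0 \<noteq> P n j 1"
      using spec[OF elim(2), of j] inj_onD[of "P n j" _ 0 1] by (auto simp: bump_def)
    with * show "L (P n) = R (P n)"
      by (simp add: R_def)
  qed
  then have "(\<lambda>n. R (P n)) \<longlonglongrightarrow> L X \<longleftrightarrow> (\<lambda>n. L (P n)) \<longlonglongrightarrow> L X"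
    by (intro tendsto_cong) (simp add: eq_commute)
  ultimately have "L X = R X"
    by (blast intro: LIMSEQ_unique)
  then show ?thesis
    by (simp add: L_def R_def)
qed

section \<open>Newton's formula with coinciding nodes\<close>

definition diag :: "('d \<Rightarrow> nat) \<Rightarrow> 'k ^ 'd \<Rightarrow> 'd \<Rightarrow> nat \<Rightarrow> 'k" where
  "diag \<beta> x = (\<lambda>i m. if m \<le> \<beta> i then x $ i else undefined)"

lemma diag_grid: "diag \<beta> x \<in> grid \<beta> V \<longleftrightarrow> (\<forall>j. x $ j \<in> V j)"
  by (auto simp: grid_iff diag_def)

text \<open>The nodes of Newton's remainder: in the variable \<open>j\<close>, the point
  \<open>z\<close> once and \<open>x $ j\<close> repeated \<open>\<beta> j\<close> times.\<close>

definition diag1 :: "('d \<Rightarrow> nat) \<Rightarrow> 'k ^ 'd \<Rightarrow> 'd \<Rightarrow> 'k \<Rightarrow> 'd \<Rightarrow> nat \<Rightarrow> 'k" where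
  "diag1 \<beta> x j z = (\<lambda>i m. if m \<le> \<beta> i then if i = j \<and> m = 0 then z else x $ i else undefined)"

text \<open>Newton's interpolation formula in the variable \<open>j\<close> with all nodes at
  \<open>x $ j\<close>: each step splits one more diagonal value off the remainder. It is Taylor's
  formula with difference quotients as coefficients, so it contains no factorials.\<close>

lemma extends_Phi_taylor:
  assumes V: "\<And>j. open (V j)" and G: "extends_Phi k V f G"
    and \<beta>: "\<beta> j = 0" "mdeg \<beta> + n \<le> k"
    and xy: "\<And>i. x $ i \<in> V i" "\<And>i. y $ i \<in> V i" "\<And>i. i \<noteq> j \<Longrightarrow> x $ i = y $ i"
  shows "G \<beta> (diag \<beta> y) = (\<Sum>m<n. G (\<beta>(j := m)) (diag (\<beta>(j := m)) x) * (y $ j - x $ j) ^ m)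
    + (y $ j - x $ j) ^ n * G (\<beta>(j := n)) (diag1 (\<beta>(j := n)) x j (y $ j))"
  using \<beta>(2)
proof (induction n)
  case 0
  \<comment> \<open>Since \<open>\<beta> j = 0\<close>, there is a single node in the variable
    \<open>j\<close>, the point \<open>y $ j\<close> itself.\<close>
  have "diag \<beta> y = diag1 (\<beta>(j := 0)) x j (y $ j)" "\<beta>(j := 0) = \<beta>"
    using \<beta> xy by (auto simp: diag_def diag1_def fun_eq_iff)
  then show ?case
    by simp
next
  case (Suc n)
  let ?b = "\<beta>(j := n)"
  have b: "bump ?b j = \<beta>(j := Suc n)"
    by (simp add: bump_def)
  let ?X = "diag1 (\<beta>(j := Suc n)) x j (y $ j)"
  have X: "?X \<in> grid (bump ?b j) V"
    unfolding b using xy by (auto simp: grid_iff diag1_def)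
  have "mdeg ?b < k"
    using Suc.prems \<beta>(1) by (simp add: mdeg_fun_upd)
  note step = extends_Phi_step[OF V G this X]
  have 1: "?X(j := drop_at 1 (?X j)) = diag1 ?b x j (y $ j)"
    by (auto simp: diag1_def drop_at_def fun_eq_iff)
  have 2: "?X(j := drop_at 0 (?X j)) = diag ?b x"
    by (auto simp: diag1_def diag_def drop_at_def fun_eq_iff)
  have 3: "?X j 0 - ?X j 1 = y $ j - x $ j"
    by (simp add: diag1_def)
  have "G ?b (diag1 ?b x j (y $ j)) = G ?b (diag ?b x) + (y $ j - x $ j) * G (\<beta>(j := Suc n)) ?X"
    using step unfolding 1 2 3 b by (simp only: diff_eq_eq add.commute)
  then have "(y $ j - x $ j) ^ n * G ?b (diag1 ?b x j (y $ j))
      = G ?b (diag ?b x) * (y $ j - x $ j) ^ n + (y $ j - x $ j) ^ Suc n * G (\<beta>(j := Suc n)) ?X"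
    by (simp only: distrib_left power_Suc mult_ac)
  then show ?case
    using Suc.IH Suc.prems by (simp del: fun_upd_apply)
qed

text \<open>Continuity at \<open>diag \<beta> x0\<close>, in sequential form: points of the
  shrinking grids converge to it in the function space, because the entries beyond
  \<open>\<beta> j\<close> are all \<open>undefined\<close>.\<close>

lemma grid_locally_bounded:
  fixes G :: "('d::finite \<Rightarrow> nat \<Rightarrow> 'k) \<Rightarrow> 'k"
  assumes G: "continuous_on (grid \<beta> V) G" and R0: "R0 > 0" "\<And>j z. qabs (z - x0 $ j) < R0 \<Longrightarrow> z \<in> V j"
  shows "\<exists>R>0. \<exists>A. \<forall>X\<in>grid \<beta> (\<lambda>j. {z. qabs (z - x0 $ j) < R}). qabs (G X) \<le> A"
proof (rule ccontr)
  assume neg: "\<not> ?thesis"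
  have "\<exists>X. X \<in> grid \<beta> (\<lambda>j. {z. qabs (z - x0 $ j) < R0 / real (Suc n)}) \<and> qabs (G X) > qabs (G (diag \<beta> x0)) + 1" for n
  proof (rule ccontr)
    assume "\<not> ?thesis"
    then have "\<forall>X\<in>grid \<beta> (\<lambda>j. {z. qabs (z - x0 $ j) < R0 / real (Suc n)}). qabs (G X) \<le> qabs (G (diag \<beta> x0)) + 1"
      by (auto simp: not_less)
    moreover have "R0 / real (Suc n) > 0"
      using R0 by simp
    ultimately show False
      using neg by blast
  qed
  then obtain X where X: "\<And>n. X n \<in> grid \<beta> (\<lambda>j. {z. qabs (z - x0 $ j) < R0 / real (Suc n)})"
    "\<And>n. qabs (G (X n)) > qabs (G (diag \<beta> x0)) + 1"
    by metis
  have "X n \<in> grid \<beta> V" for n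
  proof -
    have "R0 / real (Suc n) \<le> R0"
      using R0 by (simp add: field_simps)
    then have "z \<in> V j" if "qabs (z - x0 $ j) < R0 / real (Suc n)" for z j
      using R0(2)[of z j] that by linarith
    then show ?thesis
      by (intro subsetD[OF grid_mono X(1)]) auto
  qed
  moreover have "diag \<beta> x0 \<in> grid \<beta> V"
    using R0 by (auto simp: diag_grid)
  moreover have "X \<longlonglongrightarrow> diag \<beta> x0"
  proof (intro tendsto_funI)
    fix j m
    show "(\<lambda>n. X n j m) \<longlonglongrightarrow> diag \<beta> x0 j m"
    proof (cases "m \<le> \<beta> j")
      case True
      have "(\<lambda>n. X n j m) \<longlonglongrightarrow> x0 $ j"
      proof (rule tendsto_qabs_null)
        show "(\<lambda>n. R0 / real (Suc n)) \<longlonglongrightarrow> 0"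
          using tendsto_mult_left[OF LIMSEQ_inverse_real_of_nat, of R0] by (simp add: divide_inverse)
        show "qabs (X n j m - x0 $ j) \<le> R0 / real (Suc n)" for n
          using X(1)[of n] True by (auto simp: grid_iff less_imp_le split: if_splits)
      qed
      then show ?thesis
        using True by (simp add: diag_def)
    next
      case False
      then have "X n j m = diag \<beta> x0 j m" for n
        using X(1)[of n] by (auto simp: grid_iff diag_def split: if_splits)
      then show ?thesis by simp
    qed
  qed
  ultimately have "(\<lambda>n. G (X n)) \<longlonglongrightarrow> G (diag \<beta> x0)"
    by (intro continuous_on_tendsto_compose[OF G]) auto
  then have "\<forall>\<^sub>F n in sequentially. dist (G (X n)) (G (diag \<beta> x0)) < 1"
    by (rule tendstoD) simp
  then obtain n where "qabs (G (X n) - G (diag \<beta> x0)) < 1"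
    by (auto simp: eventually_sequentially dist_eq_qabs)
  then show False
    using X(2)[of n] qabs_triangle[of "G (X n) - G (diag \<beta> x0)" "G (diag \<beta> x0)"] by simp
qed

text \<open>The metric of \<open>'k ^ 'd\<close> is Euclidean, hence the factor
  \<open>CARD('d)\<close>.\<close>

lemma open_contains_cube:
  assumes "open U" "(x0 :: 'k ^ 'd::finite) \<in> U"
  shows "\<exists>R>0. cube x0 R \<subseteq> U"
proof -
  obtain e where e: "e > 0" "\<And>y. dist y x0 < e \<Longrightarrow> y \<in> U"
    using assms unfolding open_dist by blast
  show ?thesis
  proof (intro exI[of _ "e / real CARD('d)"] conjI subsetI)
    fix y assume y: "y \<in> cube x0 (e / real CARD('d))"
    have "dist y x0 \<le> (\<Sum>k\<in>UNIV. \<bar>dist (y $ k) (x0 $ k)\<bar>)"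
      unfolding dist_vec_def by (rule L2_set_le_sum_abs)
    also have "\<dots> < (\<Sum>k\<in>(UNIV :: 'd set). e / real CARD('d))"
      using y by (intro sum_strict_mono) (auto simp: cube_def max_norm_less_iff dist_eq_qabs)
    finally show "y \<in> U"
      using e by simp
  qed (use e in simp)
qed

text \<open>The Taylor coefficients are the extended difference quotients at the diagonal. Those of
  total order \<open>l + 1\<close> enter only the remainder, where their local boundedness is what
  counts.\<close>

lemma nonarch_taylor:
  fixes f :: "'k ^ 'd::finite \<Rightarrow> 'k"
  assumes f: "Ck_nonarch (l + 1) U f" and x0: "x0 \<in> U"
  shows "\<exists>R>0. \<exists>A\<ge>0. \<exists>F. taylor l (cube x0 R) F A f"
proof -
  obtain V where V: "\<And>j. open (V j)" "\<And>j. x0 $ j \<in> V j" and C: "Ck_product (l + 1) V f"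
    using f x0 unfolding Ck_nonarch_def by blast
  have "\<forall>\<beta>\<in>MI (l + 1). \<exists>G. continuous_on (grid \<beta> V) G \<and>
     (\<forall>X\<in>grid \<beta> V. (\<forall>j. inj_on (X j) {..\<beta> j}) \<longrightarrow> G X = Phi \<beta> f X)"
    using C by (simp add: Ck_product_def MI_def mdeg_def)
  from bchoice[OF this] obtain G where G: "extends_Phi (l + 1) V f G"
    unfolding extends_Phi_def by blast
  have "\<forall>j. \<exists>e>0. \<forall>z. qabs (z - x0 $ j) < e \<longrightarrow> z \<in> V j"
    using V unfolding open_dist dist_eq_qabs by blast
  from choice[OF this] obtain e where e: "\<And>j. e j > 0" "\<And>j z. qabs (z - x0 $ j) < e j \<Longrightarrow> z \<in> V j"
    by blast
  define R0 where "R0 = Min (range e)"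
  have R0: "R0 > 0" "\<And>j z. qabs (z - x0 $ j) < R0 \<Longrightarrow> z \<in> V j"
    using e by (auto simp: R0_def)
  have "\<forall>\<beta>\<in>MI (l + 1). \<exists>R. R > 0 \<and> (\<exists>A. \<forall>X\<in>grid \<beta> (\<lambda>j. {z. qabs (z - x0 $ j) < R}). qabs (G \<beta> X) \<le> A)"
  proof
    fix \<beta> :: "'d \<Rightarrow> nat" assume "\<beta> \<in> MI (l + 1)"
    then have "continuous_on (grid \<beta> V) (G \<beta>)"
      using G by (simp add: extends_Phi_def)
    from grid_locally_bounded[OF this R0]
    show "\<exists>R. R > 0 \<and> (\<exists>A. \<forall>X\<in>grid \<beta> (\<lambda>j. {z. qabs (z - x0 $ j) < R}). qabs (G \<beta> X) \<le> A)"
      by blast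
  qed
  from bchoice[OF this] obtain Rb where Rb: "\<And>\<beta>. \<beta> \<in> MI (l + 1) \<Longrightarrow> Rb \<beta> > 0"
    and "\<forall>\<beta>\<in>MI (l + 1). \<exists>A. \<forall>X\<in>grid \<beta> (\<lambda>j. {z. qabs (z - x0 $ j) < Rb \<beta>}). qabs (G \<beta> X) \<le> A"
    by blast
  from bchoice[OF this(2)] obtain Ab where Ab: "\<And>\<beta> X. \<beta> \<in> MI (l + 1) \<Longrightarrow>
      X \<in> grid \<beta> (\<lambda>j. {z. qabs (z - x0 $ j) < Rb \<beta>}) \<Longrightarrow> qabs (G \<beta> X) \<le> Ab \<beta>"
    by blast
  define R where "R = min R0 (Min (Rb ` MI (l + 1)))"
  have ne: "MI (l + 1) \<noteq> ({} :: ('d \<Rightarrow> nat) set)"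
    using zero_in_MI by blast
  have R: "R > 0"
    using R0 Rb ne by (simp add: R_def)
  have RRb: "R \<le> Rb \<beta>" if "\<beta> \<in> MI (l + 1)" for \<beta>
    using that unfolding R_def by (intro min.coboundedI2 Min_le) auto
  define A where "A = (\<Sum>\<beta>\<in>MI (l + 1). \<bar>Ab \<beta>\<bar>)"
  have A0: "A \<ge> 0"
    by (simp add: A_def sum_nonneg)
  have A: "qabs (G \<beta> X) \<le> A" if "\<beta> \<in> MI (l + 1)" "X \<in> grid \<beta> (\<lambda>j. {z. qabs (z - x0 $ j) < R})" for \<beta> X
  proof -
    have "X \<in> grid \<beta> (\<lambda>j. {z. qabs (z - x0 $ j) < Rb \<beta>})"
      using RRb[OF that(1)] by (intro subsetD[OF grid_mono that(2)]) auto
    from Ab[OF that(1) this] have "qabs (G \<beta> X) \<le> \<bar>Ab \<beta>\<bar>"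
      by linarith
    also have "\<dots> \<le> A"
      unfolding A_def using that(1) by (intro member_le_sum[where f = "\<lambda>\<beta>. \<bar>Ab \<beta>\<bar>"]) auto
    finally show ?thesis .
  qed
  obtain ord where ord: "distinct ord" "set ord = (UNIV :: 'd set)"
    using finite_distinct_list[of "UNIV :: 'd set"] by auto
  define D where "D \<beta> x = G \<beta> (diag \<beta> x)" for \<beta> and x :: "'k ^ 'd"
  have mem: "x $ i \<in> V i" "qabs (x $ i - x0 $ i) < R" if "x \<in> cube x0 R" for x i
    using that R0(2)[of "x $ i" i] by (auto simp: cube_def max_norm_less_iff R_def)
  have "\<exists>A'\<ge>0. taylor l (cube x0 R) D A' (D (\<lambda>_. 0))"
  proof (rule taylor_coordinatewise[OF ord A0])
    fix ps j js and \<beta> :: "'d \<Rightarrow> nat" and x y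
    assume \<beta>: "\<And>i. i \<in> set (j # js) \<Longrightarrow> \<beta> i = 0" "\<beta> \<in> MI l"
      and xy: "x \<in> cube x0 R" "y \<in> cube x0 R" "\<And>i. i \<noteq> j \<Longrightarrow> x $ i = y $ i"
    \<comment> \<open>The expansion in \<open>j\<close> is carried on until the total order reaches
      \<open>l + 1\<close>, the highest one available.\<close>
    let ?n = "l + 1 - mdeg \<beta>"
    let ?b = "\<beta>(j := ?n)"
    have n: "mdeg \<beta> + ?n = l + 1" "{..l - mdeg \<beta>} = {..<?n}" "\<beta> j = 0"
      using \<beta> by (auto simp: MI_def)
    have "D \<beta> y = (\<Sum>m<?n. D (\<beta>(j := m)) x * (y $ j - x $ j) ^ m)
      + (y $ j - x $ j) ^ ?n * G ?b (diag1 ?b x j (y $ j))"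
      unfolding D_def using extends_Phi_taylor[OF V(1) G n(3) eq_imp_le[OF n(1)]] mem xy by blast
    then have "D \<beta> y - (\<Sum>m\<le>l - mdeg \<beta>. D (\<beta>(j := m)) x * (y $ j - x $ j) ^ m)
      = (y $ j - x $ j) ^ ?n * G ?b (diag1 ?b x j (y $ j))"
      by (simp add: n(2))
    moreover have "qabs (G ?b (diag1 ?b x j (y $ j))) \<le> A"
    proof (rule A)
      show "?b \<in> MI (l + 1)"
        using n by (simp add: MI_def mdeg_fun_upd)
      show "diag1 ?b x j (y $ j) \<in> grid ?b (\<lambda>j. {z. qabs (z - x0 $ j) < R})"
        using mem(2) xy by (auto simp: grid_iff diag1_def)
    qed
    ultimately show "qabs (D \<beta> y - (\<Sum>m\<le>l - mdeg \<beta>. D (\<beta>(j := m)) x * (y $ j - x $ j) ^ m))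
      \<le> A * qabs (y $ j - x $ j) ^ ?n"
      by (simp add: qabs_mult qabs_power mult.commute[of A] mult_left_mono)
  qed
  then obtain A' where A': "A' \<ge> 0" "taylor l (cube x0 R) D A' (D (\<lambda>_. 0))"
    by blast
  have "D (\<lambda>_. 0) x = f x" if "x \<in> cube x0 R" for x
  proof -
    have "\<forall>X\<in>grid (\<lambda>_. 0) V. (\<forall>j. inj_on (X j) {..0}) \<longrightarrow> G (\<lambda>_. 0) X = Phi (\<lambda>_. 0) f X"
      using G[unfolded extends_Phi_def, rule_format, OF zero_in_MI] by blast
    moreover have "diag (\<lambda>_. 0) x \<in> grid (\<lambda>_. 0) V"
      using mem[OF that] by (simp add: diag_grid)
    ultimately have "D (\<lambda>_. 0) x = Phi (\<lambda>_. 0) f (diag (\<lambda>_. 0) x)"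
      by (simp add: D_def)
    also have "\<dots> = f (\<chi> j. diag (\<lambda>_. 0) x j 0)"
    proof -
      have "foldr (\<lambda>j. diff_quot j ^^ 0) ord F = F" for F :: "('d \<Rightarrow> nat \<Rightarrow> 'k) \<Rightarrow> 'k"
        by (induction ord) auto
      then show ?thesis
        by (simp add: Phi_foldr[OF ord])
    qed
    finally show ?thesis
      by (simp add: diag_def)
  qed
  then have "taylor l (cube x0 R) D A' f"
    using A'(2) by (simp add: taylor_def)
  with R A'(1) show ?thesis
    by blast
qed

end

section \<open>The archimedean case\<close>

text \<open>Extension of an isometry from a dense set by completeness, phrased as simultaneous
  approximation so that it serves both directions between \<open>'k\<close> and the reals.\<close>

lemma common_approximation:
  fixes j :: "'q \<Rightarrow> 'b::complete_space" and i :: "'q \<Rightarrow> 'a::metric_space"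
  assumes iso: "\<And>p q. dist (j p) (j q) = dist (i p) (i q)"
    and dense: "\<And>e. e > 0 \<Longrightarrow> \<exists>q. dist x (i q) < e"
  shows "\<exists>y. \<forall>e>0. \<exists>q. dist x (i q) < e \<and> dist y (j q) < e"
proof -
  have "\<forall>n. \<exists>q. dist x (i q) < 1 / real (Suc n)"
    by (intro allI dense) simp
  from choice[OF this] obtain q where q: "\<And>n. dist x (i (q n)) < 1 / real (Suc n)"
    by blast
  have small: "\<exists>M. \<forall>n\<ge>M. dist x (i (q n)) < e" if e: "e > 0" for e
  proof -
    obtain M where M: "1 / real (Suc M) < e"
      using nat_approx_posE[OF e] by auto
    have "dist x (i (q n)) < e" if "n \<ge> M" for n
    proof -
      have "1 / real (Suc n) \<le> 1 / real (Suc M)"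
        using that by (simp add: field_simps)
      then show ?thesis
        using q[of n] M by linarith
    qed
    then show ?thesis
      by blast
  qed
  have "Cauchy (\<lambda>n. j (q n))"
  proof (rule metric_CauchyI)
    fix e :: real
    assume "e > 0"
    then obtain M where M: "\<And>n. n \<ge> M \<Longrightarrow> dist x (i (q n)) < e / 2"
      using small[of "e / 2"] by auto
    have "dist (j (q m)) (j (q n)) < e" if "m \<ge> M" "n \<ge> M" for m n
      using M[OF that(1)] M[OF that(2)] dist_triangle3[of "i (q m)" "i (q n)" x] by (simp add: iso)
    then show "\<exists>M. \<forall>m\<ge>M. \<forall>n\<ge>M. dist (j (q m)) (j (q n)) < e"
      by blast
  qed
  then obtain y where y: "(\<lambda>n. j (q n)) \<longlonglongrightarrow> y"
    using Cauchy_convergent convergent_def by blast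
  have "\<exists>q. dist x (i q) < e \<and> dist y (j q) < e" if e: "e > 0" for e
  proof -
    obtain M M' where "\<forall>n\<ge>M. dist x (i (q n)) < e" "\<forall>n\<ge>M'. dist (j (q n)) y < e"
      using small[OF e] y e unfolding lim_sequentially by blast
    then have "dist x (i (q (max M M'))) < e" "dist y (j (q (max M M'))) < e"
      by (simp_all add: dist_commute)
    then show ?thesis
      by blast
  qed
  then show ?thesis
    by blast
qed

locale Q_infinity = Q_nu \<nu> T for \<nu> and T :: "'k::{field_char_0, complete_space} itself" +
  assumes infinite_place: "\<nu> = \<infinity>"
begin

lemma qabs_rat: "qabs (of_rat q :: 'k) = \<bar>of_rat q\<bar>"
  by (simp add: qabs_of_rat infinite_place rat_abs_at_def)

text \<open>The graph of the isomorphism of \<^typ>\<open>'k\<close> with the reals.\<close>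

definition corr :: "'k \<Rightarrow> real \<Rightarrow> bool" where
  "corr x r \<longleftrightarrow> (\<forall>e>0. \<exists>q. qabs (x - of_rat q) < e \<and> \<bar>r - of_rat q\<bar> < e)"

lemma dist_rat: "dist (of_rat p :: 'k) (of_rat q) = dist (of_rat p :: real) (of_rat q)"
  unfolding dist_eq_qabs dist_real_def of_rat_diff[symmetric] by (rule qabs_rat)

lemma corr_of_rat: "corr (of_rat q) (of_rat q)"
  unfolding corr_def by (auto intro!: exI[of _ q])

lemma corr_abs:
  assumes "corr x r"
  shows "qabs x = \<bar>r\<bar>"
proof (rule ccontr)
  assume "qabs x \<noteq> \<bar>r\<bar>"
  define e where "e = \<bar>qabs x - \<bar>r\<bar>\<bar> / 2"
  have "e > 0" "2 * e = \<bar>qabs x - \<bar>r\<bar>\<bar>"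
    using \<open>qabs x \<noteq> \<bar>r\<bar>\<close> by (simp_all add: e_def)
  then obtain q where q: "qabs (x - of_rat q) < e" "\<bar>r - of_rat q\<bar> < e"
    using assms by (auto simp: corr_def)
  have "qabs x \<le> qabs (x - of_rat q) + \<bar>of_rat q\<bar>" "\<bar>of_rat q\<bar> \<le> qabs (x - of_rat q) + qabs x"
    using qabs_triangle[of "x - of_rat q" "of_rat q"] qabs_triangle[of "of_rat q - x" x] 
    by (simp_all add: qabs_rat qabs_minus_commute[of "of_rat q"])
  then show False
    using q \<open>2 * e = \<bar>qabs x - \<bar>r\<bar>\<bar>\<close> by linarith
qed

lemma corr_add:
  assumes "corr x r" "corr y s"
  shows "corr (x + y) (r + s)"
  unfolding corr_def
proof (intro allI impI)
  fix e :: real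
  assume "e > 0"
  then have "e / 2 > 0"
    by simp
  then obtain q q' where q: "qabs (x - of_rat q) < e / 2" "\<bar>r - of_rat q\<bar> < e / 2"
    "qabs (y - of_rat q') < e / 2" "\<bar>s - of_rat q'\<bar> < e / 2"
    using assms unfolding corr_def by meson
  have "qabs (x + y - of_rat (q + q')) \<le> qabs (x - of_rat q) + qabs (y - of_rat q')"
    using qabs_triangle[of "x - of_rat q" "y - of_rat q'"] by (simp add: of_rat_add algebra_simps)
  moreover have "\<bar>r + s - of_rat (q + q')\<bar> \<le> \<bar>r - of_rat q\<bar> + \<bar>s - of_rat q'\<bar>"
    by (simp add: of_rat_add)
  ultimately show "\<exists>q. qabs (x + y - of_rat q) < e \<and> \<bar>r + s - of_rat q\<bar> < e"
    using q by (intro exI[of _ "q + q'"]) auto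
qed

lemma corr_mult:
  assumes "corr x r" "corr y s"
  shows "corr (x * y) (r * s)"
  unfolding corr_def
proof (intro allI impI)
  fix e :: real
  assume e: "e > 0"
  define M where "M = \<bar>r\<bar> + \<bar>s\<bar> + 1"
  define d where "d = min 1 (e / (2 * M))"
  have M: "M > 0"
    by (simp add: M_def add_nonneg_pos)
  then have d: "d > 0" "d \<le> 1" "d * M \<le> e / 2"
    using e by (auto simp: d_def min_def field_simps)
  then obtain q q' where q: "qabs (x - of_rat q) < d" "\<bar>r - of_rat q\<bar> < d"
    "qabs (y - of_rat q') < d" "\<bar>s - of_rat q'\<bar> < d"
    using assms unfolding corr_def by meson
  have q'1: "\<bar>of_rat q'\<bar> \<le> \<bar>s\<bar> + 1"
    using q(4) d(2) by linarith
  have bound: "a * \<bar>s'\<bar> + b * c < e" if "a < d" "b < d" "\<bar>s'\<bar> \<le> \<bar>s\<bar> + 1" "c = \<bar>r\<bar>" "0 \<le> a" "0 \<le> b" for a b c s'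
  proof -
    have "a * \<bar>s'\<bar> + b * c \<le> d * (\<bar>s\<bar> + 1) + d * \<bar>r\<bar>"
      using that by (intro add_mono mult_mono) auto
    also have "\<dots> = d * M"
      by (simp add: M_def algebra_simps)
    also have "\<dots> < e"
      using d e by linarith
    finally show ?thesis .
  qed
  have "x * y - of_rat (q * q') = (x - of_rat q) * of_rat q' + (y - of_rat q') * x"
    by (simp add: of_rat_mult algebra_simps)
  then have "qabs (x * y - of_rat (q * q')) \<le> qabs (x - of_rat q) * \<bar>of_rat q'\<bar> + qabs (y - of_rat q') * qabs x"
    by (metis qabs_triangle qabs_mult qabs_rat)
  also have "\<dots> < e"
    using q q'1 corr_abs[OF assms(1)] by (intro bound) auto
  finally have 1: "qabs (x * y - of_rat (q * q')) < e" .
  have "r * s - of_rat (q * q') = (r - of_rat q) * of_rat q' + (s - of_rat q') * r"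
    by (simp add: of_rat_mult algebra_simps)
  then have "\<bar>r * s - of_rat (q * q')\<bar> \<le> \<bar>r - of_rat q\<bar> * \<bar>of_rat q'\<bar> + \<bar>s - of_rat q'\<bar> * \<bar>r\<bar>"
    by (metis abs_triangle_ineq abs_mult)
  also have "\<dots> < e"
    using q q'1 by (intro bound) auto
  finally show "\<exists>q. qabs (x * y - of_rat q) < e \<and> \<bar>r * s - of_rat q\<bar> < e"
    using 1 by blast
qed

lemma corr_minus: "corr x r \<Longrightarrow> corr (- x) (- r)"
  using corr_mult[OF corr_of_rat[of "-1"]] by fastforce

lemma corr_unique: "corr x r \<Longrightarrow> corr x s \<Longrightarrow> r = s"
  using corr_abs[OF corr_add[OF _ corr_minus]] by fastforce

lemma corr_inj: "corr x r \<Longrightarrow> corr y r \<Longrightarrow> x = y"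
  using corr_abs[OF corr_add[of x r "-y" "-r"]] corr_minus[of y r] by simp

lemma corr_real_exists: "\<exists>r. corr x r"
proof -
  have "\<exists>r. \<forall>e>0. \<exists>q. dist x (of_rat q) < e \<and> dist r (of_rat q :: real) < e"
    by (rule common_approximation[OF dist_rat[symmetric]]) (simp add: dist_eq_qabs rat_dense)
  then show ?thesis
    by (simp add: corr_def dist_eq_qabs dist_real_def)
qed

lemma corr_exists: "\<exists>x. corr x r"
proof -
  have "\<exists>q. dist r (of_rat q) < e" if e: "e > 0" for e
  proof -
    obtain q where "r - e < of_rat q" "of_rat q < r"
      using of_rat_dense[of "r - e" r] e by auto
    then show ?thesis
      by (intro exI[of _ q]) (simp add: dist_real_def)
  qed
  then have "\<exists>x. \<forall>e>0. \<exists>q. dist r (of_rat q) < e \<and> dist x (of_rat q :: 'k) < e"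
    by (rule common_approximation[OF dist_rat])
  then show ?thesis
    by (simp add: corr_def dist_eq_qabs dist_real_def conj_commute)
qed

definition re :: "'k \<Rightarrow> real" where "re x = (THE r. corr x r)"

definition un_re :: "real \<Rightarrow> 'k" where "un_re r = (THE x. corr x r)"

lemma corr_re: "corr x (re x)"
  unfolding re_def by (rule theI') (use corr_real_exists corr_unique in blast)

lemma corr_un_re: "corr (un_re r) r"
  unfolding un_re_def by (rule theI') (use corr_exists corr_inj in blast)

lemma re_eqI: "corr x r \<Longrightarrow> re x = r"
  using corr_re corr_unique by blast

lemma re_un_re [simp]: "re (un_re r) = r"
  by (rule re_eqI) (rule corr_un_re)

lemma un_re_re [simp]: "un_re (re x) = x"
  using corr_un_re corr_re corr_inj by blast

lemma re_add: "re (x + y) = re x + re y"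
  by (intro re_eqI corr_add corr_re)

lemma re_mult: "re (x * y) = re x * re y"
  by (intro re_eqI corr_mult corr_re)

lemma re_minus: "re (- x) = - re x"
  by (intro re_eqI corr_minus corr_re)

lemma re_diff: "re (x - y) = re x - re y"
  using re_add[of x "-y"] by (simp add: re_minus)

lemma qabs_re: "qabs x = \<bar>re x\<bar>"
  by (rule corr_abs) (rule corr_re)

lemma re_0 [simp]: "re 0 = 0"
  using qabs_re[of 0] by simp

lemma re_1 [simp]: "re 1 = 1"
  using re_eqI[OF corr_of_rat[of 1]] by simp

lemma re_of_nat [simp]: "re (of_nat n) = real n"
  by (induction n) (simp_all add: re_add)

lemma re_fact [simp]: "re (fact n) = fact n"
  using re_of_nat[of "fact n"] by simp

lemma re_divide: "re (x / y) = re x / re y"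
proof (cases "y = 0")
  case False
  then have "re y \<noteq> 0"
    using qabs_re[of y] by auto
  moreover have "re (x / y) * re y = re x"
    using False by (simp flip: re_mult)
  ultimately show ?thesis
    by (simp add: field_simps)
qed simp

lemma re_power: "re (x ^ n) = re x ^ n"
  by (induction n) (simp_all add: re_mult)

lemma re_sum: "re (sum f I) = (\<Sum>i\<in>I. re (f i))"
  by (induction I rule: infinite_finite_induct) (simp_all add: re_add)

lemma un_re_add: "un_re (r + s) = un_re r + un_re s"
  by (metis re_add re_un_re un_re_re)

text \<open>The functions are transported to the reals, where Taylor's theorem with Lagrange
  remainder applies; \<open>1 / n!\<close> in the remainder is estimated by 1.\<close>

lemma arch_taylor_1d:
  fixes u :: "nat \<Rightarrow> 'k \<Rightarrow> 'k"
  assumes n: "n > 0"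
    and deriv: "\<And>m z. m < n \<Longrightarrow> qabs (z - c) < R \<Longrightarrow> ((\<lambda>t. (u m (z + t) - u m z) / t) \<longlongrightarrow> u (Suc m) z) (at 0)"
    and bound: "\<And>z. qabs (z - c) < R \<Longrightarrow> qabs (u n z) \<le> A"
    and ab: "qabs (a - c) < R" "qabs (b - c) < R"
  shows "qabs (u 0 b - (\<Sum>m<n. u m a / of_nat (fact m) * (b - a) ^ m)) \<le> A * qabs (b - a) ^ n"
proof (cases "a = b")
  case True
  have "(\<Sum>m<n. u m a / of_nat (fact m) * (b - a) ^ m) = (\<Sum>m<n. if m = 0 then u 0 a else 0)"
    using True by (intro sum.cong) auto
  then show ?thesis
    using True n by (simp add: power_0_left)
next
  case False
  define v where "v m s = re (u m (un_re s))" for m s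
  have der: "DERIV (v m) s :> v (Suc m) s" if "m < n" "\<bar>s - re c\<bar> < R" for m s
    unfolding DERIV_def
  proof (rule tendstoI)
    fix e :: real
    assume e: "e > 0"
    have "qabs (un_re s - c) < R"
      using that by (simp add: qabs_re re_diff)
    from tendstoD[OF deriv[OF that(1) this] e] obtain d where d: "d > 0"
      "\<And>t. t \<noteq> 0 \<Longrightarrow> qabs t < d \<Longrightarrow> dist ((u m (un_re s + t) - u m (un_re s)) / t) (u (Suc m) (un_re s)) < e"
      unfolding eventually_at by (auto simp: qabs_def)
    show "\<forall>\<^sub>F h in at 0. dist ((v m (s + h) - v m s) / h) (v (Suc m) s) < e"
      unfolding eventually_at
    proof (intro exI[of _ d] conjI ballI impI d(1))
      fix h :: real
      assume h: "h \<noteq> 0 \<and> dist h 0 < d"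
      have "un_re h \<noteq> 0" "qabs (un_re h) < d"
        using h re_un_re[of h] by (auto simp: qabs_re simp del: re_un_re)
      from d(2)[OF this] show "dist ((v m (s + h) - v m s) / h) (v (Suc m) s) < e"
        by (simp add: dist_eq_qabs qabs_re re_diff re_divide v_def un_re_add dist_real_def)
    qed
  qed
  \<comment> \<open>An interval is convex: all points between \<open>re a\<close> and
    \<open>re b\<close> stay within distance \<open>R\<close> of \<open>re c\<close>.\<close>
  have R: "\<bar>t - re c\<bar> < R" if "min (re a) (re b) \<le> t" "t \<le> max (re a) (re b)" for t
    using ab that by (auto simp: qabs_re re_diff)
  have "re b \<noteq> re a"
    using False by (metis un_re_re)
  have "\<exists>t. (if re b < re a then re b < t \<and> t < re a else re a < t \<and> t < re b) \<and>
    v 0 (re b) = (\<Sum>m<n. (v m (re a) / fact m) * (re b - re a) ^ m) + (v n t / fact n) * (re b - re a) ^ n"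
    by (rule Taylor[OF n refl, of "min (re a) (re b)" "max (re a) (re b)"])
      (use der R \<open>re b \<noteq> re a\<close> in auto)
  then obtain t where t': "if re b < re a then re b < t \<and> t < re a else re a < t \<and> t < re b"
    and eq: "v 0 (re b) = (\<Sum>m<n. (v m (re a) / fact m) * (re b - re a) ^ m) + (v n t / fact n) * (re b - re a) ^ n"
    by blast
  have t: "min (re a) (re b) \<le> t" "t \<le> max (re a) (re b)"
    using t' by (auto split: if_splits)
  have vn: "\<bar>v n t\<bar> \<le> A"
    using bound[of "un_re t"] R[OF t] by (simp add: qabs_re re_diff v_def)
  have "re (u 0 b - (\<Sum>m<n. u m a / of_nat (fact m) * (b - a) ^ m)) = (v n t / fact n) * (re b - re a) ^ n"
    using eq by (simp add: re_diff re_sum re_mult re_divide re_power v_def)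
  then have "qabs (u 0 b - (\<Sum>m<n. u m a / of_nat (fact m) * (b - a) ^ m)) = (\<bar>v n t\<bar> / fact n) * qabs (b - a) ^ n"
    by (simp add: qabs_re abs_mult power_abs re_diff)
  also have "\<dots> \<le> A * qabs (b - a) ^ n"
  proof (intro mult_right_mono)
    have "\<bar>v n t\<bar> / fact n \<le> \<bar>v n t\<bar> / 1"
      by (intro divide_left_mono) auto
    then show "\<bar>v n t\<bar> / fact n \<le> A"
      using vn by simp
  qed simp
  finally show ?thesis .
qed

lemma Ck_arch_continuous: "Ck_arch k U f \<Longrightarrow> continuous_on U f"
  by (cases k) auto

lemma Ck_arch_iter_partial:
  "Ck_arch k U f \<Longrightarrow> length w \<le> k \<Longrightarrow> Ck_arch (k - length w) U (iter_partial w f)"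
proof (induction w)
  case Nil
  then show ?case by (simp add: iter_partial_def)
next
  case (Cons i w)
  then have "Ck_arch (k - length w) U (iter_partial w f)" "k - length w = Suc (k - length (i # w))"
    by auto
  then show ?case
    by (simp add: iter_partial_def)
qed

lemma Ck_arch_partial_tendsto:
  assumes "Ck_arch k U f" "length w < k" "x \<in> U"
  shows "((\<lambda>t. (iter_partial w f (x + axis i t) - iter_partial w f x) / t) \<longlongrightarrow> iter_partial (i # w) f x) (at (0::'k))"
proof -
  have "Ck_arch (Suc (k - Suc (length w))) U (iter_partial w f)"
    using Ck_arch_iter_partial[OF assms(1), of w] assms(2) by (simp add: Suc_diff_Suc)
  then obtain D where D: "has_partial (iter_partial w f) i x D"
    using assms(3) by auto
  then have "partial i (iter_partial w f) x = D"
    unfolding has_partial_def partial_def by (rule tendsto_Lim[OF at_0_neq_bot])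
  then show ?thesis
    using D by (simp add: has_partial_def iter_partial_def)
qed

text \<open>Derivatives in the coordinates expanded later are the outer ones, hence the reversal.\<close>

definition word :: "'d list \<Rightarrow> ('d \<Rightarrow> nat) \<Rightarrow> 'd list" where
  "word ord \<beta> = concat (map (\<lambda>j. replicate (\<beta> j) j) (rev ord))"

lemma word_upd:
  assumes "ord = ps @ j # js" "distinct ord" "\<And>i. i \<in> set (j # js) \<Longrightarrow> \<beta> i = 0"
  shows "word ord (\<beta>(j := m)) = replicate m j @ word ord \<beta>"
proof -
  have js: "concat (map (\<lambda>i. replicate ((\<beta>(j := n)) i) i) (rev js)) = []" for n
    using assms by auto
  have ps: "map (\<lambda>i. replicate ((\<beta>(j := m)) i) i) (rev ps) = map (\<lambda>i. replicate (\<beta> i) i) (rev ps)"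
    using assms by auto
  have "\<beta> = \<beta>(j := 0)"
    using assms(3)[of j] by auto
  then have js0: "concat (map (\<lambda>i. replicate (\<beta> i) i) (rev js)) = []"
    using js[of 0] by simp
  have w: "word ord \<gamma> = concat (map (\<lambda>i. replicate (\<gamma> i) i) (rev js)) @ replicate (\<gamma> j) j
      @ concat (map (\<lambda>i. replicate (\<gamma> i) i) (rev ps))" for \<gamma>
    by (simp add: word_def assms(1))
  have "\<beta> j = 0"
    using assms(3)[of j] by simp
  then show ?thesis
    unfolding w js js0 ps by (simp del: fun_upd_apply add: fun_upd_same)
qed

lemma length_word:
  assumes "distinct ord" "set ord = UNIV"
  shows "length (word ord \<beta>) = mdeg \<beta>"
  using assms by (simp add: word_def length_concat comp_def mdeg_def sum_list_distinct_conv_sum_set rev_map[symmetric])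

text \<open>The coefficients are partial derivatives in the order fixed by \<open>word\<close>,
  divided by factorials. Continuity bounds the derivatives along the finitely many words of length
  up to \<open>l + 1\<close> on a common cube.\<close>

lemma arch_taylor:
  fixes f :: "'k ^ 'd::finite \<Rightarrow> 'k"
  assumes f: "Ck_arch (l + 1) U f" and U: "open U" "x0 \<in> U"
  shows "\<exists>R>0. \<exists>A\<ge>0. \<exists>F. taylor l (cube x0 R) F A f"
proof -
  define Ws where "Ws = {w :: 'd list. length w \<le> l + 1}"
  have finW: "finite Ws"
    using finite_lists_length_le[of "UNIV :: 'd set" "l + 1"] by (simp add: Ws_def)
  have neW: "[] \<in> Ws"
    by (simp add: Ws_def)
  have "\<forall>w\<in>Ws. \<exists>R. R > 0 \<and> cube x0 R \<subseteq> U \<inter> iter_partial w f -` ball (iter_partial w f x0) 1"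
  proof
    fix w assume "w \<in> Ws"
    then have "continuous_on U (iter_partial w f)"
      using Ck_arch_continuous[OF Ck_arch_iter_partial[OF f]] by (simp add: Ws_def)
    then have "open (U \<inter> iter_partial w f -` ball (iter_partial w f x0) 1)"
      using U by (intro continuous_open_preimage) auto
    moreover have "x0 \<in> U \<inter> iter_partial w f -` ball (iter_partial w f x0) 1"
      using U by simp
    ultimately show "\<exists>R. R > 0 \<and> cube x0 R \<subseteq> U \<inter> iter_partial w f -` ball (iter_partial w f x0) 1"
      by (rule open_contains_cube)
  qed
  from bchoice[OF this] obtain Rw where Rw: "\<And>w. w \<in> Ws \<Longrightarrow> Rw w > 0"
    "\<And>w. w \<in> Ws \<Longrightarrow> cube x0 (Rw w) \<subseteq> U \<inter> iter_partial w f -` ball (iter_partial w f x0) 1"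
    by blast
  define R where "R = Min (Rw ` Ws)"
  have R: "R > 0"
    using Rw(1) finW neW by (subst R_def, subst Min_gr_iff) auto
  have sub: "cube x0 R \<subseteq> U \<inter> iter_partial w f -` ball (iter_partial w f x0) 1" if "w \<in> Ws" for w
  proof -
    have "R \<le> Rw w"
      unfolding R_def using that finW by simp
    then have "cube x0 R \<subseteq> cube x0 (Rw w)"
      by (auto simp: cube_def)
    then show ?thesis
      using Rw(2)[OF that] by blast
  qed
  define A where "A = (\<Sum>w\<in>Ws. qabs (iter_partial w f x0) + 1)"
  have A0: "A \<ge> 0"
    by (simp add: A_def sum_nonneg)
  have A: "qabs (iter_partial w f p) \<le> A" if "w \<in> Ws" "p \<in> cube x0 R" for w p
  proof -
    have "qabs (iter_partial w f x0 - iter_partial w f p) < 1"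
      using sub[OF that(1)] that(2) by (auto simp: dist_eq_qabs)
    then have "qabs (iter_partial w f p) \<le> qabs (iter_partial w f x0) + 1"
      using qabs_diff_triangle[of "iter_partial w f x0" "iter_partial w f x0 - iter_partial w f p"] by simp
    also have "\<dots> \<le> A"
      unfolding A_def using that finW by (intro member_le_sum[where f = "\<lambda>w. qabs (iter_partial w f x0) + 1"]) auto
    finally show ?thesis .
  qed
  have RU: "p \<in> U" if "p \<in> cube x0 R" for p
    using sub[OF neW] that by blast
  obtain ord where ord: "distinct ord" "set ord = (UNIV :: 'd set)"
    using finite_distinct_list[of "UNIV :: 'd set"] by auto
  define D where "D \<beta> x = iter_partial (word ord \<beta>) f x / of_nat (mfact \<beta>)" for \<beta> and x :: "'k ^ 'd"
  have "\<exists>A'\<ge>0. taylor l (cube x0 R) D A' (D (\<lambda>_. 0))"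
  proof (rule taylor_coordinatewise[OF ord A0])
    fix ps j js and \<beta> :: "'d \<Rightarrow> nat" and x y
    assume split: "ord = ps @ j # js" and \<beta>: "\<And>i. i \<in> set (j # js) \<Longrightarrow> \<beta> i = 0" "\<beta> \<in> MI l"
      and xy: "x \<in> cube x0 R" "y \<in> cube x0 R" "\<And>i. i \<noteq> j \<Longrightarrow> x $ i = y $ i"
    define n where "n = l + 1 - mdeg \<beta>"
    have n: "mdeg \<beta> + n = l + 1" "{..l - mdeg \<beta>} = {..<n}" "\<beta> j = 0" "n > 0"
      using \<beta> by (auto simp: MI_def n_def)
    define w where "w = word ord \<beta>"
    have lw: "length w = mdeg \<beta>"
      by (simp add: w_def length_word[OF ord])
    define p where "p z = (\<chi> i. if i = j then z else x $ i)" for z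
    define u where "u m z = iter_partial (replicate m j @ w) f (p z)" for m z
    have p_add: "p (z + t) = p z + axis j t" for z t
      by (auto simp: p_def vec_eq_iff axis_def)
    have p_cube: "p z \<in> cube x0 R" if "qabs (z - x0 $ j) < R" for z
      using that xy(1) by (auto simp: cube_def max_norm_less_iff p_def)
    have px: "p (x $ j) = x" "p (y $ j) = y"
      using xy(3) by (auto simp: p_def vec_eq_iff)
    have taylor1: "qabs (u 0 (y $ j) - (\<Sum>m<n. u m (x $ j) / of_nat (fact m) * (y $ j - x $ j) ^ m)) \<le> A * qabs (y $ j - x $ j) ^ n"
    proof (rule arch_taylor_1d[where c = "x0 $ j" and R = R])
      fix m z
      assume "m < n" and z: "qabs (z - x0 $ j) < R"
      then have "length (replicate m j @ w) < l + 1"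
        using lw n by simp
      from Ck_arch_partial_tendsto[OF f this RU[OF p_cube[OF z]], of j]
      show "((\<lambda>t. (u m (z + t) - u m z) / t) \<longlongrightarrow> u (Suc m) z) (at 0)"
        by (simp add: u_def p_add)
    next
      fix z
      assume z: "qabs (z - x0 $ j) < R"
      show "qabs (u n z) \<le> A"
        unfolding u_def using lw n by (intro A p_cube z) (simp add: Ws_def)
    next
      show "qabs (x $ j - x0 $ j) < R" "qabs (y $ j - x0 $ j) < R"
        using xy by (auto simp: cube_def max_norm_less_iff)
    qed (rule n(4))
    have D: "D (\<beta>(j := m)) z = iter_partial (replicate m j @ w) f z / of_nat (fact m) / of_nat (mfact \<beta>)" for m z
    proof -
      have "mfact (\<beta>(j := m)) = (\<Prod>i\<in>UNIV. fact (\<beta> i) * (if i = j then fact m else 1))"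
        unfolding mfact_def using n(3) by (intro prod.cong) auto
      also have "\<dots> = mfact \<beta> * fact m"
        by (simp add: prod.distrib mfact_def)
      finally have "mfact (\<beta>(j := m)) = mfact \<beta> * fact m" .
      moreover have "word ord (\<beta>(j := m)) = replicate m j @ w"
        unfolding w_def by (rule word_upd[OF split ord(1) \<beta>(1)])
      ultimately show ?thesis
        by (simp add: D_def mult.commute del: fun_upd_apply)
    qed
    have D0: "D \<beta> y = u 0 (y $ j) / of_nat (mfact \<beta>)"
      by (simp add: D_def u_def w_def px)
    have Dx: "D (\<beta>(j := m)) x = u m (x $ j) / of_nat (fact m) / of_nat (mfact \<beta>)" for m
      by (simp add: D u_def px)
    have "D \<beta> y - (\<Sum>m<n. D (\<beta>(j := m)) x * (y $ j - x $ j) ^ m)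
      = (u 0 (y $ j) - (\<Sum>m<n. u m (x $ j) / of_nat (fact m) * (y $ j - x $ j) ^ m)) / of_nat (mfact \<beta>)"
      unfolding D0 Dx by (simp add: diff_divide_distrib sum_divide_distrib)
    then have "qabs (D \<beta> y - (\<Sum>m<n. D (\<beta>(j := m)) x * (y $ j - x $ j) ^ m))
      = qabs (u 0 (y $ j) - (\<Sum>m<n. u m (x $ j) / of_nat (fact m) * (y $ j - x $ j) ^ m)) / real (mfact \<beta>)"
      by (simp only: qabs_divide) (simp add: qabs_re[of "of_nat _"])
    \<comment> \<open>At this place \<open>mfact \<beta>\<close> has absolute value at least 1, so
      the division does not increase the error.\<close>
    also have "\<dots> \<le> qabs (u 0 (y $ j) - (\<Sum>m<n. u m (x $ j) / of_nat (fact m) * (y $ j - x $ j) ^ m)) / 1"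
    proof (intro divide_left_mono)
      have "mfact \<beta> > 0"
        by (simp add: mfact_def prod_pos)
      then show "1 \<le> real (mfact \<beta>)" "0 < real (mfact \<beta>) * 1"
        by auto
    qed simp
    also have "\<dots> \<le> A * qabs (y $ j - x $ j) ^ n"
      using taylor1 by simp
    finally show "qabs (D \<beta> y - (\<Sum>m\<le>l - mdeg \<beta>. D (\<beta>(j := m)) x * (y $ j - x $ j) ^ m))
      \<le> A * qabs (y $ j - x $ j) ^ (l + 1 - mdeg \<beta>)"
      by (simp only: n(2) n_def[symmetric])
  qed
  moreover have "D (\<lambda>_. 0) = f"
  proof -
    have "word ord (\<lambda>_. 0) = []"
      by (simp add: word_def)
    then show ?thesis
      by (intro ext) (simp add: D_def iter_partial_def)
  qed
  ultimately show ?thesis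
    using R by auto
qed

end

lemma (in Q_nu) Ck_map_taylor:
  fixes f :: "'k ^ 'd::finite \<Rightarrow> 'k ^ 'n::finite"
  assumes f: "Ck_map \<nu> (l + 1) U f" and U: "open U" "x0 \<in> U"
  shows "\<exists>R>0. \<exists>A\<ge>0. \<exists>F. cube x0 R \<subseteq> U \<and> (\<forall>k. taylor l (cube x0 R) (F k) A (\<lambda>x. f x $ k))"
proof -
  have "\<exists>R>0. \<exists>A\<ge>0. \<exists>F. taylor l (cube x0 R) F A (\<lambda>x. f x $ k)" for k
  proof (cases "\<nu> = \<infinity>")
    case True
    interpret Q_infinity \<nu> T
      by unfold_locales (rule True)
    show ?thesis
      using f True U by (intro arch_taylor[of l U]) (auto simp: Ck_map_def)
  next
    case False
    then show ?thesis
      using f U by (intro nonarch_taylor[of l U]) (auto simp: Ck_map_def)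
  qed
  then have "\<forall>k. \<exists>R A F. R > 0 \<and> A \<ge> 0 \<and> taylor l (cube x0 R) F A (\<lambda>x. f x $ k)"
    by blast
  then obtain Rk Ak F where k: "\<And>k. Rk k > 0" "\<And>k. Ak k \<ge> 0"
    "\<And>k. taylor l (cube x0 (Rk k)) (F k) (Ak k) (\<lambda>x. f x $ k)"
    by metis
  obtain R0 where R0: "R0 > 0" "cube x0 R0 \<subseteq> U"
    using open_contains_cube[OF U] by blast
  define R where "R = min R0 (Min (range Rk))"
  have R: "R > 0" "R \<le> R0" "\<And>k. R \<le> Rk k"
    using k(1) R0 by (auto simp: R_def min.coboundedI2)
  define A where "A = sum Ak UNIV"
  have A: "A \<ge> 0" "\<And>k. Ak k \<le> A"
    using k(2) by (auto simp: A_def sum_nonneg intro!: member_le_sum)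
  show ?thesis
  proof (rule exI[of _ R], intro conjI R(1), rule exI[of _ A], intro conjI A(1), rule exI[of _ F], intro conjI allI)
    show "cube x0 R \<subseteq> U"
      using R0(2) R(2) by (auto simp: cube_def)
    show "taylor l (cube x0 R) (F k) A (\<lambda>x. f x $ k)" for k
      unfolding taylor_def
    proof (intro ballI)
      fix x y assume "x \<in> cube x0 R" "y \<in> cube x0 R"
      then have "x \<in> cube x0 (Rk k)" "y \<in> cube x0 (Rk k)"
        using R(3)[of k] by (auto simp: cube_def)
      then have "qabs (f y $ k - (\<Sum>\<gamma>\<in>MI l. F k \<gamma> x * monom_at (y - x) \<gamma>)) \<le> Ak k * max_norm (y - x) ^ (l + 1)"
        using k(3)[of k] by (simp add: taylor_def)
      also have "\<dots> \<le> A * max_norm (y - x) ^ (l + 1)"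
        by (intro mult_right_mono A) simp
      finally show "qabs (f y $ k - (\<Sum>\<gamma>\<in>MI l. F k \<gamma> x * monom_at (y - x) \<gamma>)) \<le> A * max_norm (y - x) ^ (l + 1)" .
    qed
  qed
qed

section \<open>Balls, supports and coverings\<close>

context Q_nu
begin

lemma open_cube [simp]: "open (cube (x :: 'k ^ 'd::finite) r)"
  unfolding open_vec_def
proof (intro ballI)
  fix y assume "y \<in> cube x r"
  then show "\<exists>S. (\<forall>i. open (S i) \<and> y $ i \<in> S i) \<and> (\<forall>z. (\<forall>i. z $ i \<in> S i) \<longrightarrow> z \<in> cube x r)"
    by (intro exI[of _ "\<lambda>i. ball (x $ i) r"])
      (auto simp: cube_def max_norm_less_iff dist_eq_qabs qabs_minus_commute)
qed

definition rat_points :: "('k ^ 'd::finite) set" where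
  "rat_points = range (\<lambda>q :: 'd \<Rightarrow> rat. \<chi> i. of_rat (q i))"

lemma countable_rat_points [simp]: "countable (rat_points :: ('k ^ 'd::finite) set)"
  by (simp add: rat_points_def)

lemma rat_points_dense:
  assumes "r > 0"
  shows "\<exists>q\<in>rat_points. q \<in> cube (x :: 'k ^ 'd::finite) r"
proof -
  have "\<forall>i. \<exists>q. qabs (x $ i - of_rat q) < r"
    using rat_dense[OF assms] by blast
  from choice[OF this] obtain q where "\<And>i. qabs (x $ i - of_rat (q i)) < r"
    by blast
  then have "(\<chi> i. of_rat (q i)) \<in> cube x r"
    by (simp add: cube_def max_norm_less_iff qabs_minus_commute)
  then show ?thesis
    by (auto simp: rat_points_def)
qed

lemma open_Compl_msupp: "open (- msupp M)"
proof (rule open_subopen[THEN iffD2], intro ballI)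
  fix x assume "x \<in> - msupp M"
  then obtain W where W: "open W" "x \<in> W" "emeasure M W = 0"
    by (auto simp: msupp_def)
  have "W \<subseteq> - msupp M"
    using W by (auto simp: msupp_def)
  with W show "\<exists>T. open T \<and> x \<in> T \<and> T \<subseteq> - msupp M"
    by blast
qed

text \<open>Second countability: the complement of the support is covered by countably many null
  cubes, with centres in \<open>rat_points\<close> and radii \<open>1 / (n + 1)\<close>.\<close>

lemma Compl_msupp_null:
  fixes M :: "('k ^ 'd::finite) measure"
  assumes M: "sets M = sets borel"
  shows "- msupp M \<in> null_sets M"
proof -
  define I where "I = {(q, n). q \<in> rat_points \<and> cube q (1 / real (Suc n)) \<in> null_sets M}"
  have "I \<subseteq> rat_points \<times> UNIV"
    by (auto simp: I_def)
  then have "countable I"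
    by (rule countable_subset) simp
  then have null: "(\<Union>(q, n)\<in>I. cube q (1 / real (Suc n))) \<in> null_sets M"
    by (intro null_sets_UN') (auto simp: I_def)
  have "- msupp M \<subseteq> (\<Union>(q, n)\<in>I. cube q (1 / real (Suc n)))"
  proof
    fix x assume "x \<in> - msupp M"
    then obtain W where W: "open W" "x \<in> W" "emeasure M W = 0"
      by (auto simp: msupp_def)
    then obtain R where R: "R > 0" "cube x R \<subseteq> W"
      using open_contains_cube by blast
    obtain n where n: "1 / real (Suc n) < R / 2"
      using nat_approx_posE[of "R / 2"] R by auto
    obtain q where q: "q \<in> rat_points" "q \<in> cube x (1 / real (Suc n))"
      using rat_points_dense[of "1 / real (Suc n)" x] by auto
    have "cube q (1 / real (Suc n)) \<subseteq> cube x R"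
    proof
      fix z assume "z \<in> cube q (1 / real (Suc n))"
      then show "z \<in> cube x R"
        using q(2) n max_norm_triangle_via[of z x q] unfolding cube_def mem_Collect_eq by linarith
    qed
    then have "emeasure M (cube q (1 / real (Suc n))) \<le> emeasure M W"
      using R(2) W(1) by (intro emeasure_mono) (auto simp: M)
    then have "(q, n) \<in> I"
      using W(3) q by (auto simp: I_def null_sets_def M)
    moreover have "x \<in> cube q (1 / real (Suc n))"
      using q(2) by (simp add: cube_def max_norm_minus_commute)
    ultimately show "x \<in> (\<Union>(q, n)\<in>I. cube q (1 / real (Suc n)))"
      by blast
  qed
  moreover have "- msupp M \<in> sets M"
    unfolding M by (rule borel_open) (rule open_Compl_msupp)
  ultimately show ?thesis
    using null null_sets_subset by blast
qed

end

section \<open>The norm \<open>N\<close> compared with the maximum norm\<close>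

locale Q_norm = Q_nu \<nu> T for \<nu> and T :: "'k::{field_char_0, complete_space} itself" +
  fixes N :: "'k ^ 'd::finite \<Rightarrow> real"
  assumes standard: "standard_norm \<nu> N"
begin

definition \<kappa> :: real where "\<kappa> = real CARD('d)"

lemma kappa_ge_1: "\<kappa> \<ge> 1"
  by (simp add: \<kappa>_def Suc_le_eq)

lemma max_norm_le_N: "max_norm x \<le> N x"
proof -
  have "max_norm x \<le> euclid_norm x"
    unfolding max_norm_le_iff euclid_norm_def
    by (intro allI member_le_L2_set[of UNIV _ "\<lambda>i. qabs (x $ i)"]) auto
  then show ?thesis
    using standard by (auto simp: standard_norm_def)
qed

lemma N_le_max_norm: "N x \<le> \<kappa> * max_norm x"
proof -
  have "euclid_norm x \<le> (\<Sum>i\<in>UNIV. \<bar>qabs (x $ i)\<bar>)"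
    unfolding euclid_norm_def by (rule L2_set_le_sum_abs)
  also have "\<dots> \<le> real (card (UNIV :: 'd set)) * max_norm x"
    by (intro sum_bounded_above) (simp add: qabs_le_max_norm)
  finally have "euclid_norm x \<le> \<kappa> * max_norm x"
    by (simp add: \<kappa>_def)
  moreover have "max_norm x \<le> \<kappa> * max_norm x"
    using mult_right_mono[OF kappa_ge_1, of "max_norm x"] by simp
  ultimately show ?thesis
    using standard by (auto simp: standard_norm_def)
qed

lemma N_triangle: "N (x + y) \<le> N x + N y"
proof -
  have "euclid_norm (x + y) \<le> L2_set (\<lambda>i. qabs (x $ i) + qabs (y $ i)) UNIV"
    unfolding euclid_norm_def by (intro L2_set_mono) (auto simp: qabs_triangle)
  also have "\<dots> \<le> euclid_norm x + euclid_norm y"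
    unfolding euclid_norm_def by (rule L2_set_triangle_ineq)
  finally show ?thesis
    using standard max_norm_triangle[of x y] by (auto simp: standard_norm_def)
qed

lemma N_minus_commute: "N (x - y) = N (y - x)"
  using standard max_norm_minus_commute[of x y]
  by (auto simp: standard_norm_def euclid_norm_def qabs_minus_commute)

lemma N_via: "N (x - z) \<le> N (x - y) + N (y - z)"
  using N_triangle[of "x - y" "y - z"] by simp

lemma N_zero [simp]: "N 0 = 0"
  using max_norm_le_N[of 0] N_le_max_norm[of 0] by simp

lemma open_nball [simp]: "open (nball N x r)"
proof (rule open_subopen[THEN iffD2], intro ballI)
  fix y assume y: "y \<in> nball N x r"
  define e where "e = (r - N (y - x)) / \<kappa>"
  have e: "e > 0" "\<kappa> * e = r - N (y - x)"
    using y kappa_ge_1 by (auto simp: e_def nball_def)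
  have "cube y e \<subseteq> nball N x r"
  proof
    fix z assume "z \<in> cube y e"
    then have "\<kappa> * max_norm (z - y) < \<kappa> * e"
      using kappa_ge_1 by (intro mult_strict_left_mono) (auto simp: cube_def)
    then show "z \<in> nball N x r"
      using e N_le_max_norm[of "z - y"] N_via[of z x y] unfolding nball_def mem_Collect_eq by linarith
  qed
  moreover have "y \<in> cube y e"
    using e by (simp add: cube_def)
  ultimately show "\<exists>T. open T \<and> y \<in> T \<and> T \<subseteq> nball N x r"
    using open_cube by blast
qed

lemma nball_subset_cube: "nball N x r \<subseteq> cube x r"
  using max_norm_le_N by (force simp: nball_def cube_def intro: le_less_trans)

lemma cube_subset_nball: "cube x (r / \<kappa>) \<subseteq> nball N x r"
proof
  fix y assume "y \<in> cube x (r / \<kappa>)"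
  then have "max_norm (y - x) * \<kappa> < r"
    using kappa_ge_1 by (simp add: cube_def pos_less_divide_eq)
  then show "y \<in> nball N x r"
    using N_le_max_norm[of "y - x"] by (simp add: nball_def mult.commute)
qed

lemma center_in_nball [simp]: "r > 0 \<Longrightarrow> x \<in> nball N x r"
  by (simp add: nball_def)

lemma nball_mono: "N (x - y) + r \<le> s \<Longrightarrow> nball N x r \<subseteq> nball N y s"
proof
  fix z assume "N (x - y) + r \<le> s" "z \<in> nball N x r"
  then show "z \<in> nball N y s"
    using N_via[of z y x] by (simp add: nball_def)
qed

text \<open>Over the p-adic numbers a ball does not determine its radius, so inclusion of balls
  bounds radii only up to a constant: a ball of radius \<open>r\<close> contains a point whose
  distance from the centre is comparable to \<open>r\<close>.\<close>

lemma radius_le: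
  assumes r: "r > 0" and sub: "nball N x r \<subseteq> nball N x0 R"
  shows "r \<le> 2 * \<kappa> / qabs unif * R"
proof -
  obtain z :: 'k where z: "qabs unif * (r / \<kappa>) \<le> qabs z" "qabs z < r / \<kappa>"
    using exists_of_size[of "r / \<kappa>"] r kappa_ge_1 by auto
  have "x + axis undefined z \<in> cube x (r / \<kappa>)"
    using z by (simp add: cube_def)
  then have "x + axis undefined z \<in> nball N x0 R"
    using cube_subset_nball sub by blast
  moreover have "x \<in> nball N x0 R"
    using sub r by auto
  ultimately have "N (axis undefined z) < 2 * R"
    using N_via[of "x + axis undefined z" x x0] N_minus_commute[of x0 x] by (simp add: nball_def)
  then have "qabs z < 2 * R"
    using max_norm_le_N[of "axis undefined z"] by simp
  with z(1) have "qabs unif * (r / \<kappa>) \<le> 2 * R"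
    by linarith
  then show ?thesis
    using unif kappa_ge_1 by (simp add: field_simps)
qed

text \<open>Returns from the quotient in \<open>Federer_on\<close> to a product: the smaller ball
  has positive measure because its centre lies in the support, and if its measure is infinite the
  claim is trivial.\<close>

lemma Federer_double:
  assumes F: "Federer_on N M D U" and x: "x \<in> msupp M" "r > 0" "nball N x (3 * r) \<subseteq> U" and D: "D > 0"
  shows "emeasure M (nball N x (3 * r)) \<le> ennreal D * emeasure M (nball N x r)"
proof -
  let ?a = "emeasure M (nball N x (3 * r))" and ?b = "emeasure M (nball N x r)"
  have "?a / ?b \<le> Sup {emeasure M (nball N x (3 * r)) / emeasure M (nball N x r) | x r.
            x \<in> msupp M \<and> r > 0 \<and> nball N x (3 * r) \<subseteq> U}"
    by (rule Sup_upper) (use x in blast)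
  also have "\<dots> < ennreal D"
    using F by (simp add: Federer_on_def)
  finally have less: "?a / ?b < ennreal D" .
  have b: "?b > 0"
    using x by (auto simp: msupp_def)
  show ?thesis
  proof (cases "?b = \<infinity>")
    case True
    then show ?thesis
      using D by (simp add: ennreal_mult_top)
  next
    case False
    then have "?a = ?a / ?b * ?b"
      using b by (simp add: ennreal_divide_times ennreal_divide_self less_top)
    also have "\<dots> \<le> ennreal D * ?b"
      using less by (intro mult_right_mono) auto
    finally show ?thesis .
  qed
qed

text \<open>Any positive lower bound for a value on the ball may replace the supremum, since the
  estimate decreases in the supremum; an infinite supremum is included.\<close>

lemma abs_good_lower_bound:
  assumes good: "abs_good N M C \<alpha> U g" and x: "x \<in> msupp M" "r > 0" "nball N x r \<subseteq> U"
    and e: "\<epsilon> > 0" and s: "s > 0" "y \<in> nball N x r" "qabs (g y :: 'k) \<ge> s" and C: "C > 0" "\<alpha> > 0"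
  shows "emeasure M {y \<in> nball N x r. qabs (g y) < \<epsilon>} \<le> ennreal (C * (\<epsilon> / s) powr \<alpha>) * emeasure M (nball N x r)"
proof -
  define S where "S = (SUP y\<in>nball N x r. ennreal (qabs (g y)))"
  have sS: "ennreal s \<le> S"
    unfolding S_def using s by (intro SUP_upper2[OF s(2)] ennreal_leI)
  then have S0: "S \<noteq> 0"
    using s(1) by (auto simp: ennreal_eq_0_iff)
  have "enn2real (ennreal \<epsilon> / S) \<le> enn2real (ennreal (\<epsilon> / s))"
  proof (rule enn2real_mono)
    show "ennreal \<epsilon> / S \<le> ennreal (\<epsilon> / s)"
    proof (cases S)
      case (real s')
      then have "s \<le> s'"
        using sS s(1) by (simp add: ennreal_le_iff)
      then show ?thesis
        using real e s(1) by (simp add: divide_ennreal frac_le ennreal_leI)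
    qed simp
  qed simp
  then have le: "enn2real (ennreal \<epsilon> / S) \<le> \<epsilon> / s"
    using e s(1) by simp
  have "emeasure M {y \<in> nball N x r. qabs (g y) < \<epsilon>} \<le> ennreal (C * enn2real (ennreal \<epsilon> / S) powr \<alpha>) * emeasure M (nball N x r)"
    using good x e S0 unfolding abs_good_def S_def Let_def by blast
  also have "\<dots> \<le> ennreal (C * (\<epsilon> / s) powr \<alpha>) * emeasure M (nball N x r)"
    using C le by (intro mult_right_mono ennreal_leI mult_left_mono powr_mono2) auto
  finally show ?thesis .
qed

text \<open>Vitali covering: the balls of radius \<open>3 * \<rho>\<close> about a maximal family of
  centres in \<open>S\<close> with disjoint \<open>\<rho>\<close>-balls cover \<open>S\<close>. One
  factor \<open>D\<close> returns from \<open>3 * \<rho>\<close> to \<open>\<rho>\<close>, the other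
  from \<open>3 * r\<close> to \<open>r\<close>, since the small balls may leave the given one.
  Measurable sets \<open>T\<close> stand in because \<open>S\<close> is not assumed
  measurable.\<close>

lemma covering:
  assumes M: "sets M = sets borel" and F: "Federer_on N M D U" and D: "D > 0"
    and x: "x \<in> msupp M" "nball N x (4 * r) \<subseteq> U" and \<rho>: "0 < \<rho>" "\<rho> \<le> r"
    and S: "S \<subseteq> nball N x r" "S \<subseteq> msupp M"
    and T: "\<And>y. y \<in> S \<Longrightarrow> \<exists>T\<in>sets M. S \<inter> nball N y (3 * \<rho>) \<subseteq> T \<and> emeasure M T \<le> q * emeasure M (nball N y (3 * \<rho>))"
  shows "\<exists>T\<in>sets M. S \<subseteq> T \<and> emeasure M T \<le> q * ennreal (D * D) * emeasure M (nball N x r)"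
proof -
  define \<A> where "\<A> = {Y. Y \<subseteq> S \<and> disjoint_family_on (\<lambda>y. nball N y \<rho>) Y}"
  have "\<exists>Y\<in>\<A>. \<forall>X\<in>\<A>. Y \<subseteq> X \<longrightarrow> X = Y"
  proof (rule subset_Zorn_nonempty)
    show "\<A> \<noteq> {}"
      by (auto simp: \<A>_def disjoint_family_on_def intro: exI[of _ "{}"])
    fix \<C> assume "\<C> \<noteq> {}" and chain: "subset.chain \<A> \<C>"
    have sub: "\<C> \<subseteq> \<A>" and ch: "\<And>A B. A \<in> \<C> \<Longrightarrow> B \<in> \<C> \<Longrightarrow> A \<subseteq> B \<or> B \<subseteq> A"
      using chain by (auto simp: subset_chain_def)
    show "\<Union>\<C> \<in> \<A>"
      unfolding \<A>_def disjoint_family_on_def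
    proof (intro CollectI conjI ballI impI)
      show "\<Union>\<C> \<subseteq> S"
        using sub by (auto simp: \<A>_def)
      fix m n assume mn: "m \<in> \<Union>\<C>" "n \<in> \<Union>\<C>" "m \<noteq> n"
      then obtain A where "A \<in> \<C>" "m \<in> A" "n \<in> A"
        using ch by blast
      moreover have "disjoint_family_on (\<lambda>y. nball N y \<rho>) A"
        using sub \<open>A \<in> \<C>\<close> by (auto simp: \<A>_def)
      ultimately show "nball N m \<rho> \<inter> nball N n \<rho> = {}"
        using mn(3) by (simp add: disjoint_family_on_def)
    qed
  qed
  then obtain Y where "Y \<in> \<A>" and max: "\<And>X. X \<in> \<A> \<Longrightarrow> Y \<subseteq> X \<Longrightarrow> X = Y"
    by blast
  then have Y: "Y \<subseteq> S" "disjoint_family_on (\<lambda>y. nball N y \<rho>) Y"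
    by (simp_all add: \<A>_def)
  have cover: "\<exists>y\<in>Y. s \<in> nball N y (3 * \<rho>)" if s: "s \<in> S" for s
  proof (cases "s \<in> Y")
    case True
    then show ?thesis
      using \<rho> by (intro bexI[of _ s]) auto
  next
    case False
    then have "insert s Y \<notin> \<A>"
      using max[of "insert s Y"] by blast
    then obtain y where y: "y \<in> Y" "nball N s \<rho> \<inter> nball N y \<rho> \<noteq> {}"
      using Y s by (auto simp: \<A>_def disjoint_family_on_insert[OF False])
    then obtain z where "N (z - s) < \<rho>" "N (z - y) < \<rho>"
      by (auto simp: nball_def)
    then have "N (s - y) < 3 * \<rho>"
      using N_via[of s y z] N_minus_commute[of s z] \<rho> by linarith
    then show ?thesis
      using y(1) by (auto simp: nball_def)
  qed
  \<comment> \<open>A rational point in each of the disjoint balls shows that the family is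
    countable.\<close>
  have "\<forall>y\<in>Y. \<exists>q. q \<in> rat_points \<and> q \<in> nball N y \<rho>"
  proof
    fix y assume "y \<in> Y"
    have "\<rho> / \<kappa> > 0"
      using \<rho> kappa_ge_1 by simp
    then obtain q where "q \<in> rat_points" "q \<in> cube y (\<rho> / \<kappa>)"
      using rat_points_dense by blast
    then show "\<exists>q. q \<in> rat_points \<and> q \<in> nball N y \<rho>"
      using cube_subset_nball by blast
  qed
  from bchoice[OF this] obtain h where h: "\<And>y. y \<in> Y \<Longrightarrow> h y \<in> rat_points" "\<And>y. y \<in> Y \<Longrightarrow> h y \<in> nball N y \<rho>"
    by blast
  have "inj_on h Y"
  proof (rule inj_onI, rule ccontr)
    fix a b assume ab: "a \<in> Y" "b \<in> Y" "h a = h b" "a \<noteq> b"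
    then show False
      using h(2)[of a] h(2)[of b] Y(2) by (auto simp: disjoint_family_on_def)
  qed
  moreover have "countable (h ` Y)"
    using h(1) by (intro countable_subset[OF _ countable_rat_points]) auto
  ultimately have cY: "countable Y"
    by (rule countable_image_inj_on[rotated])
  have "\<forall>y\<in>S. \<exists>T. T \<in> sets M \<and> S \<inter> nball N y (3 * \<rho>) \<subseteq> T \<and> emeasure M T \<le> q * emeasure M (nball N y (3 * \<rho>))"
    using T by blast
  from bchoice[OF this] obtain T where T': "\<And>y. y \<in> S \<Longrightarrow> T y \<in> sets M" "\<And>y. y \<in> S \<Longrightarrow> S \<inter> nball N y (3 * \<rho>) \<subseteq> T y"
    "\<And>y. y \<in> S \<Longrightarrow> emeasure M (T y) \<le> q * emeasure M (nball N y (3 * \<rho>))"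
    by blast
  define J where "J = to_nat_on Y ` Y"
  \<comment> \<open>Padding with empty sets turns the countable family, finite or not, into a
    sequence.\<close>
  define Bn where "Bn n = (if n \<in> J then nball N (from_nat_into Y n) \<rho> else {})" for n
  define Tn where "Tn n = (if n \<in> J then T (from_nat_into Y n) else {})" for n
  have J: "from_nat_into Y n \<in> Y" if "n \<in> J" for n
    using that cY by (auto simp: J_def)
  have Jinj: "m = n" if "m \<in> J" "n \<in> J" "from_nat_into Y m = from_nat_into Y n" for m n
    using that cY by (auto simp: J_def)
  have Bsets: "range Bn \<subseteq> sets M" and Tsets: "range Tn \<subseteq> sets M"
    using J Y(1) T'(1) by (auto simp: Bn_def Tn_def M)
  have disj: "disjoint_family Bn"
    unfolding disjoint_family_on_def
  proof (intro ballI impI)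
    fix m n :: nat assume "m \<noteq> n"
    show "Bn m \<inter> Bn n = {}"
    proof (cases "m \<in> J \<and> n \<in> J")
      case True
      then have "from_nat_into Y m \<noteq> from_nat_into Y n"
        using Jinj \<open>m \<noteq> n\<close> by blast
      then show ?thesis
        using True J Y(2) by (simp add: Bn_def disjoint_family_on_def)
    qed (auto simp: Bn_def)
  qed
  have TB: "emeasure M (Tn n) \<le> q * ennreal D * emeasure M (Bn n)" for n
  proof (cases "n \<in> J")
    case True
    define y where "y = from_nat_into Y n"
    have y: "y \<in> S"
      using J[OF True] Y(1) by (auto simp: y_def)
    then have Nyx: "N (y - x) < r"
      using S by (auto simp: nball_def)
    have "nball N y (3 * \<rho>) \<subseteq> U"
      by (rule order_trans[OF nball_mono x(2)]) (use Nyx \<rho> in linarith)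
    then have "emeasure M (nball N y (3 * \<rho>)) \<le> ennreal D * emeasure M (nball N y \<rho>)"
      using y S \<rho> D by (intro Federer_double[OF F]) auto
    then have "emeasure M (T y) \<le> q * (ennreal D * emeasure M (nball N y \<rho>))"
      by (intro order_trans[OF T'(3)[OF y]] mult_left_mono) auto
    then show ?thesis
      using True by (simp add: Tn_def Bn_def y_def mult.assoc)
  qed (simp add: Tn_def)
  have r: "r > 0"
    using \<rho> by linarith
  have "(\<Union>n. Tn n) \<in> sets M"
    using Tsets by (simp add: sets.countable_UN)
  moreover have "S \<subseteq> (\<Union>n. Tn n)"
  proof
    fix s assume s: "s \<in> S"
    then obtain y where y: "y \<in> Y" "s \<in> nball N y (3 * \<rho>)"
      using cover by blast
    then have "s \<in> T y"
      using T'(2)[of y] Y(1) s by blast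
    then have "s \<in> Tn (to_nat_on Y y)"
      using y(1) cY by (simp add: Tn_def J_def)
    then show "s \<in> (\<Union>n. Tn n)"
      by blast
  qed
  moreover have "emeasure M (\<Union>n. Tn n) \<le> q * ennreal (D * D) * emeasure M (nball N x r)"
  proof -
    have "emeasure M (\<Union>n. Tn n) \<le> (\<Sum>n. emeasure M (Tn n))"
      by (rule emeasure_subadditive_countably[OF Tsets])
    also have "\<dots> \<le> (\<Sum>n. q * ennreal D * emeasure M (Bn n))"
      by (intro suminf_le TB) auto
    also have "\<dots> = q * ennreal D * (\<Sum>n. emeasure M (Bn n))"
      by (simp add: ennreal_suminf_cmult)
    also have "(\<Sum>n. emeasure M (Bn n)) = emeasure M (\<Union>n. Bn n)"
      by (rule suminf_emeasure[OF Bsets disj])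
    also have "\<dots> \<le> emeasure M (nball N x (3 * r))"
    proof (rule emeasure_mono)
      show "(\<Union>n. Bn n) \<subseteq> nball N x (3 * r)"
      proof (rule UN_least)
        fix n
        show "Bn n \<subseteq> nball N x (3 * r)"
        proof (cases "n \<in> J")
          case True
          then have "N (from_nat_into Y n - x) < r"
            using J Y(1) S by (auto simp: nball_def)
          then show ?thesis
            using True \<rho> by (simp add: Bn_def nball_mono)
        qed (simp add: Bn_def)
      qed
    qed (simp add: M)
    also have "\<dots> \<le> ennreal D * emeasure M (nball N x r)"
    proof (rule Federer_double[OF F x(1) r _ D])
      show "nball N x (3 * r) \<subseteq> U"
        by (rule order_trans[OF nball_mono x(2)]) (use r in simp)
    qed
    also have "q * ennreal D * (ennreal D * emeasure M (nball N x r)) = q * ennreal (D * D) * emeasure M (nball N x r)"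
      using D by (simp add: ennreal_mult mult_ac)
    finally show ?thesis
      by (simp add: mult_left_mono)
  qed
  ultimately show ?thesis
    by blast
qed

end

section \<open>Sublevel sets on a single ball\<close>

definition theta :: "nat \<Rightarrow> real" where
  "theta l = 1 / (2 ^ (l + 1) - 2)"

text \<open>The solution of \<open>t 0 = 1\<close>, \<open>t l = 0\<close>, \<open>t j / 2 - t (j + 1) = theta l\<close>.\<close>

definition level_exp :: "nat \<Rightarrow> nat \<Rightarrow> real" where
  "level_exp l j = (1 + 2 * theta l) / 2 ^ j - 2 * theta l"

lemma two_power_gt_2: "l \<ge> 1 \<Longrightarrow> (2::real) ^ (l + 1) > 2"
  using power_strict_increasing[of 1 "l + 1" "2::real"] by simp

lemma theta_pos: "l \<ge> 1 \<Longrightarrow> theta l > 0"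
  using two_power_gt_2[of l] by (simp add: theta_def)

lemma level_exp_0: "level_exp l 0 = 1"
  by (simp add: level_exp_def)

lemma level_exp_step: "level_exp l j / 2 - level_exp l (Suc j) = theta l"
  by (simp add: level_exp_def field_simps)

lemma level_exp_end:
  assumes "l \<ge> 1"
  shows "level_exp l l = 0"
proof -
  have "theta l * (2 ^ (l + 1) - 2) = 1"
    using two_power_gt_2[OF assms] by (simp add: theta_def)
  then have "1 + 2 * theta l = theta l * 2 * 2 ^ l"
    by (simp add: algebra_simps)
  then show ?thesis
    by (simp add: level_exp_def)
qed

lemma level_exp_nonneg:
  assumes "l \<ge> 1" "j \<le> l"
  shows "level_exp l j \<ge> 0"
proof -
  have "(1 + 2 * theta l) / 2 ^ l \<le> (1 + 2 * theta l) / 2 ^ j"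
    using theta_pos[OF assms(1)] assms(2) by (intro divide_left_mono power_increasing) auto
  then show ?thesis
    using level_exp_end[OF assms(1)] by (simp add: level_exp_def)
qed

context Q_norm
begin

text \<open>Differentiation brings in factors \<open>\<beta> i + 1\<close>, which can be small at a
  prime place. Only those up to \<open>l + 1\<close> occur, and none of them is 0.\<close>

definition suc_min :: "nat \<Rightarrow> real" where
  "suc_min l = Min ((\<lambda>n. qabs (of_nat (Suc n) :: 'k)) ` {..l})"

lemma suc_min_pos: "suc_min l > 0"
  unfolding suc_min_def by (subst Min_gr_iff) (auto simp del: of_nat_Suc)

lemma suc_min_le: "n \<le> l \<Longrightarrow> suc_min l \<le> qabs (of_nat (Suc n) :: 'k)"
  unfolding suc_min_def by (intro Min_le) auto

text \<open>Numerator: threshold plus quadratic error, and the loss \<open>2 * \<kappa>\<close> in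
  \<open>affine_lower_bound\<close>; denominator: the losses through integer factors and through the
  discrete value group.\<close>

definition ratio_const :: "nat \<Rightarrow> real \<Rightarrow> real" where
  "ratio_const l H = (1 + jet_const TYPE('d) l * H) * (2 * \<kappa>) / (suc_min l * qabs unif)"

text \<open>The values at \<open>y\<close> and at \<open>y + axis i t\<close> differ by
  \<open>a i * t\<close>, so one of them is at least half as large.\<close>

lemma affine_lower_bound:
  fixes a :: "'d \<Rightarrow> 'k"
  assumes r: "r > 0"
  shows "\<exists>z\<in>nball N y r. qabs (c + (\<Sum>k\<in>UNIV. a k * z $ k)) \<ge> qabs (a i) * (qabs unif * r / (2 * \<kappa>))"
proof -
  obtain t :: 'k where t: "qabs unif * (r / \<kappa>) \<le> qabs t" "qabs t < r / \<kappa>"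
    using exists_of_size[of "r / \<kappa>"] r kappa_ge_1 by auto
  let ?L = "\<lambda>z. c + (\<Sum>k\<in>UNIV. a k * z $ k)"
  have "y + axis i t \<in> cube y (r / \<kappa>)"
    using t by (simp add: cube_def)
  then have mem: "y + axis i t \<in> nball N y r" "y \<in> nball N y r"
    using cube_subset_nball r by auto
  have "(\<Sum>k\<in>UNIV. a k * axis i t $ k) = (\<Sum>k\<in>UNIV. if k = i then a i * t else 0)"
    by (intro sum.cong) (auto simp: axis_def)
  then have "?L (y + axis i t) - ?L y = a i * t"
    by (simp add: distrib_left sum.distrib)
  then have "qabs (a i) * qabs t \<le> qabs (?L (y + axis i t)) + qabs (?L y)"
    using qabs_diff_triangle[of "?L (y + axis i t)" "?L y"] by (simp add: qabs_mult)
  moreover have "qabs (a i) * (qabs unif * (r / \<kappa>)) \<le> qabs (a i) * qabs t"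
    using t by (intro mult_left_mono) auto
  moreover have eq: "qabs (a i) * (qabs unif * r / (2 * \<kappa>)) = qabs (a i) * (qabs unif * (r / \<kappa>)) / 2"
    by simp
  ultimately have "qabs (a i) * (qabs unif * r / (2 * \<kappa>)) \<le> qabs (?L (y + axis i t))
    \<or> qabs (a i) * (qabs unif * r / (2 * \<kappa>)) \<le> qabs (?L y)"
    unfolding eq by linarith
  then show ?thesis
    using mem by blast
qed

text \<open>Provides the measurable supersets required by \<open>covering\<close>.\<close>

lemma open_affine_sublevel:
  fixes a :: "'d \<Rightarrow> 'k"
  shows "open {z \<in> nball N y r. qabs (c + (\<Sum>k\<in>UNIV. a k * z $ k)) < \<epsilon>}"
proof -
  let ?L = "\<lambda>z. c + (\<Sum>k\<in>UNIV. a k * z $ k)"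
  have "open {z. qabs (?L z) < \<epsilon>}"
  proof (rule open_subopen[THEN iffD2], intro ballI)
    fix z assume z: "z \<in> {z. qabs (?L z) < \<epsilon>}"
    define A where "A = 1 + (\<Sum>k\<in>UNIV. qabs (a k))"
    have A: "A > 0"
      by (simp add: A_def add_pos_nonneg sum_nonneg)
    define e where "e = (\<epsilon> - qabs (?L z)) / A"
    have e: "e > 0" "A * e = \<epsilon> - qabs (?L z)"
      using z A by (auto simp: e_def)
    have "cube z e \<subseteq> {z. qabs (?L z) < \<epsilon>}"
    proof
      fix w assume w: "w \<in> cube z e"
      have "?L w - ?L z = (\<Sum>k\<in>UNIV. a k * (w - z) $ k)"
        by (simp add: right_diff_distrib sum_subtractf)
      then have "qabs (?L w - ?L z) \<le> (\<Sum>k\<in>UNIV. qabs (a k) * qabs ((w - z) $ k))"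
        using qabs_sum[of "\<lambda>k. a k * (w - z) $ k" UNIV] by (simp add: qabs_mult)
      also have "\<dots> \<le> (\<Sum>k\<in>UNIV. qabs (a k) * max_norm (w - z))"
        by (intro sum_mono mult_left_mono qabs_le_max_norm) auto
      also have "\<dots> \<le> A * max_norm (w - z)"
        by (simp add: A_def distrib_right flip: sum_distrib_right)
      also have "\<dots> < A * e"
        using w A by (intro mult_strict_left_mono) (auto simp: cube_def)
      finally have "qabs (?L w - ?L z) < \<epsilon> - qabs (?L z)"
        by (simp only: e(2))
      moreover have "qabs (?L w) \<le> qabs (?L w - ?L z) + qabs (?L z)"
        using qabs_triangle[of "?L w - ?L z" "?L z"] by (simp only: diff_add_cancel)
      ultimately show "w \<in> {z. qabs (?L z) < \<epsilon>}"
        unfolding mem_Collect_eq by linarith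
    qed
    moreover have "z \<in> cube z e"
      using e by (simp add: cube_def)
    ultimately show "\<exists>T. open T \<and> z \<in> T \<and> T \<subseteq> {z. qabs (?L z) < \<epsilon>}"
      using open_cube by blast
  qed
  then have "open (nball N y r \<inter> {z. qabs (?L z) < \<epsilon>})"
    by (intro open_Int) auto
  then show ?thesis
    by (simp add: Collect_conj_eq)
qed

text \<open>
  Near a point where \<open>G \<beta>\<close> is small and \<open>G (bump \<beta> i)\<close> is large, \<open>G \<beta>\<close> is, on the scale
  \<open>r * sqrt \<delta>\<close>, an affine function up to an error of its own size; \<open>\<delta>\<close> and \<open>\<delta>'\<close> are
  thresholds relative to \<open>s\<close>.
\<close>

lemma stratum_bound:
  fixes G :: "('d \<Rightarrow> nat) \<Rightarrow> 'k ^ 'd \<Rightarrow> 'k" and i :: 'd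
  assumes M: "sets M = sets borel" and F: "Federer_on N M D U" and D: "D > 0"
    and dec: "abs_decaying N M C \<alpha> U" and C: "C > 0" "\<alpha> > 0"
    and jet: "jet l W G B" and B: "B \<ge> 0" "B * r ^ (l + 1) \<le> H * s"
    and x: "x \<in> msupp M" "r > 0" "nball N x (4 * r) \<subseteq> U" "nball N x (4 * r) \<subseteq> W"
    and H: "\<And>y \<gamma>. y \<in> nball N x r \<Longrightarrow> \<gamma> \<in> MI l \<Longrightarrow> qabs (G \<gamma> y) * r ^ mdeg \<gamma> \<le> H * s"
    and s: "s > 0" and H0: "H \<ge> 0" and \<beta>: "mdeg \<beta> < l"
    and \<delta>: "0 < \<delta>" "\<delta> \<le> 1" "0 < \<delta>'"
  defines "Q \<equiv> ratio_const l H"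
    and "S \<equiv> {y \<in> nball N x r \<inter> msupp M. qabs (G \<beta> y) * r ^ mdeg \<beta> < s * \<delta> \<and>
           qabs (G (bump \<beta> i) y) * r ^ Suc (mdeg \<beta>) \<ge> s * \<delta>'}"
  shows "\<exists>T\<in>sets M. S \<subseteq> T \<and>
    emeasure M T \<le> ennreal (C * (Q * (sqrt \<delta> / \<delta>')) powr \<alpha> * (D * D)) * emeasure M (nball N x r)"
proof -
  define J where "J = jet_const TYPE('d) l"
  have J: "J > 0"
    by (simp add: J_def jet_const_pos)
  \<comment> \<open>On the scale \<open>3 * \<rho> = r * sqrt \<delta>\<close> the quadratic error
    is of the order of the threshold \<open>\<delta>\<close> itself.\<close>
  define \<rho> where "\<rho> = r * sqrt \<delta> / 3"
  define q where "q = C * (Q * (sqrt \<delta> / \<delta>')) powr \<alpha>"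
  have sqrt1: "sqrt \<delta> \<le> 1"
    using \<delta> by simp
  have "r * sqrt \<delta> \<le> r * 1"
    using sqrt1 x(2) by (intro mult_left_mono) auto
  then have "r * sqrt \<delta> / 3 \<le> r"
    using x(2) by linarith
  then have \<rho>: "0 < \<rho>" "\<rho> \<le> r"
    using x(2) \<delta> unfolding \<rho>_def by simp_all
  have "\<exists>T\<in>sets M. S \<inter> nball N y (3 * \<rho>) \<subseteq> T \<and> emeasure M T \<le> ennreal q * emeasure M (nball N y (3 * \<rho>))"
    if y: "y \<in> S" for y
  proof -
    have yB: "y \<in> nball N x r" and yM: "y \<in> msupp M"
      and y0: "qabs (G \<beta> y) * r ^ mdeg \<beta> < s * \<delta>"
      and y1: "qabs (G (bump \<beta> i) y) * r ^ Suc (mdeg \<beta>) \<ge> s * \<delta>'"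
      using y by (auto simp: S_def)
    define a where "a k = of_nat (Suc (\<beta> k)) * G (bump \<beta> k) y" for k
    define c where "c = G \<beta> y - (\<Sum>k\<in>UNIV. a k * y $ k)"
    define L where "L z = c + (\<Sum>k\<in>UNIV. a k * z $ k)" for z :: "'k ^ 'd"
    \<comment> \<open>The threshold \<open>s * \<delta>\<close> for \<open>G \<beta>\<close> plus
      the error \<open>J * H * s * \<delta>\<close> of its affine approximation, with the weight of
      degree \<open>mdeg \<beta>\<close> removed.\<close>
    define \<epsilon> where "\<epsilon> = (1 + J * H) * s * \<delta> / r ^ mdeg \<beta>"
    have sub: "nball N y (3 * \<rho>) \<subseteq> nball N x (4 * r)"
      using yB \<rho> by (intro nball_mono) (simp add: nball_def)
    have "y \<in> nball N y (3 * \<rho>)"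
      using \<rho> by simp
    then have yW: "y \<in> W"
      using sub x(4) by blast
    have L: "L z = G \<beta> y + (\<Sum>k\<in>UNIV. of_nat (Suc (\<beta> k)) * G (bump \<beta> k) y * (z - y) $ k)" for z
      by (simp add: L_def c_def a_def right_diff_distrib sum_subtractf)
    define T where "T = {z \<in> nball N y (3 * \<rho>). qabs (L z) < \<epsilon>}"
    have "T \<in> sets M"
      unfolding M T_def L_def by (intro borel_open open_affine_sublevel)
    moreover have "S \<inter> nball N y (3 * \<rho>) \<subseteq> T"
    proof
      fix z assume z: "z \<in> S \<inter> nball N y (3 * \<rho>)"
      then have zs: "qabs (G \<beta> z) * r ^ mdeg \<beta> < s * \<delta>"
        by (simp add: S_def)
      have zW: "z \<in> W"
        using z sub x(4) by blast
      have "max_norm (z - y) < 3 * \<rho>"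
        using z nball_subset_cube[of y "3 * \<rho>"] by (auto simp: cube_def)
      then have zq: "max_norm (z - y) \<le> sqrt \<delta> * r"
        by (simp add: \<rho>_def mult.commute)
      have sq: "sqrt \<delta> \<le> 3"
        using sqrt1 by linarith
      have "qabs (G \<beta> z - L z) * r ^ mdeg \<beta> \<le> J * (H * s) * (sqrt \<delta>)\<^sup>2"
        unfolding J_def L diff_diff_eq[symmetric]
        by (rule jet_second_order[OF jet \<beta> yW zW x(2) H[OF yB] B zq sq])
      then have "qabs (G \<beta> z - L z) * r ^ mdeg \<beta> \<le> J * H * s * \<delta>"
        using \<delta> by simp
      moreover have "qabs (L z) \<le> qabs (G \<beta> z) + qabs (G \<beta> z - L z)"
        using qabs_diff_triangle[of "G \<beta> z" "G \<beta> z - L z"] by simp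
      then have "qabs (L z) * r ^ mdeg \<beta> \<le> qabs (G \<beta> z) * r ^ mdeg \<beta> + qabs (G \<beta> z - L z) * r ^ mdeg \<beta>"
        using x(2) by (simp flip: distrib_right)
      ultimately have "qabs (L z) * r ^ mdeg \<beta> < (1 + J * H) * s * \<delta>"
        using zs by (simp add: algebra_simps)
      then show "z \<in> T"
        using z x(2) by (simp add: T_def \<epsilon>_def pos_less_divide_eq)
    qed
    moreover have "emeasure M T \<le> ennreal q * emeasure M (nball N y (3 * \<rho>))"
    proof -
      \<comment> \<open>A lower bound for a value of \<open>L\<close>: the coefficient
        \<open>a i\<close> is large because \<open>G (bump \<beta> i) y\<close> is, and
        \<open>affine_lower_bound\<close> is applied with radius \<open>3 * \<rho>\<close>.\<close>
      define sl where "sl = suc_min l * (s * \<delta>' / r ^ Suc (mdeg \<beta>)) * (qabs unif * (3 * \<rho>) / (2 * \<kappa>))"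
      have sl: "sl > 0"
        using suc_min_pos[of l] s \<delta> x(2) unif \<rho> kappa_ge_1 by (simp add: sl_def)
      obtain z where z: "z \<in> nball N y (3 * \<rho>)" "qabs (a i) * (qabs unif * (3 * \<rho>) / (2 * \<kappa>)) \<le> qabs (L z)"
        using affine_lower_bound[where r = "3 * \<rho>" and a = a and i = i and y = y and c = c] \<rho> unfolding L_def by auto
      have "suc_min l * (s * \<delta>' / r ^ Suc (mdeg \<beta>)) \<le> qabs (a i)"
        unfolding a_def qabs_mult
      proof (intro mult_mono)
        show "suc_min l \<le> qabs (of_nat (Suc (\<beta> i)) :: 'k)"
          using mdeg_component_le[of \<beta> i] \<beta> by (intro suc_min_le) simp
        show "s * \<delta>' / r ^ Suc (mdeg \<beta>) \<le> qabs (G (bump \<beta> i) y)"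
          using y1 x(2) by (simp add: pos_divide_le_eq)
        show "0 \<le> s * \<delta>' / r ^ Suc (mdeg \<beta>)"
          using s \<delta> x(2) by simp
      qed simp
      then have "sl \<le> qabs (a i) * (qabs unif * (3 * \<rho>) / (2 * \<kappa>))"
        unfolding sl_def using \<rho> kappa_ge_1 by (intro mult_right_mono) auto
      with z(2) have zs: "sl \<le> qabs (L z)"
        by linarith
      have eps: "\<epsilon> > 0"
        using J H0 s \<delta> x(2) by (simp add: \<epsilon>_def add_pos_nonneg)
      have "is_affine_function L"
        unfolding is_affine_function_def L_def by (intro exI[of _ c] exI[of _ "\<chi> k. a k"]) simp
      then have "abs_good N M C \<alpha> U L"
        using dec by (simp add: abs_decaying_def)
      then have "emeasure M T \<le> ennreal (C * (\<epsilon> / sl) powr \<alpha>) * emeasure M (nball N y (3 * \<rho>))"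
        unfolding T_def using sub x(3) \<rho> yM eps sl z(1) zs C
        by (intro abs_good_lower_bound[where y = z and U = U]) auto
      also have "\<epsilon> / sl = Q * (sqrt \<delta> / \<delta>')"
      proof -
        have "sqrt \<delta> * sqrt \<delta> = \<delta>"
          using \<delta> by simp
        then have d: "\<delta> / sqrt \<delta> = sqrt \<delta>"
          using \<delta> by (simp add: real_div_sqrt)
        have "\<epsilon> / sl = (1 + J * H) * (2 * \<kappa>) / (suc_min l * qabs unif) * ((\<delta> / sqrt \<delta>) / \<delta>')"
          using suc_min_pos[of l] s \<delta> x(2) unif kappa_ge_1
          by (simp add: \<epsilon>_def sl_def \<rho>_def field_simps)
        then show ?thesis
          by (simp add: d Q_def ratio_const_def J_def)
      qed
      finally show ?thesis
        by (simp add: q_def)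
    qed
    ultimately show ?thesis
      by blast
  qed
  then have "\<exists>T\<in>sets M. S \<subseteq> T \<and> emeasure M T \<le> ennreal q * ennreal (D * D) * emeasure M (nball N x r)"
    by (intro covering[OF M F D x(1,3) \<rho>]) (auto simp: S_def)
  then show ?thesis
    using C D by (simp add: q_def ennreal_mult)
qed

lemma sublevel_bound:
  fixes G :: "('d \<Rightarrow> nat) \<Rightarrow> 'k ^ 'd \<Rightarrow> 'k"
  assumes l: "l \<ge> 1"
    and M: "sets M = sets borel" and F: "Federer_on N M D U" and D: "D > 0"
    and dec: "abs_decaying N M C \<alpha> U" and C: "C > 0" "\<alpha> > 0"
    and jet: "jet l W G B" and B: "B \<ge> 0" "B * r ^ (l + 1) \<le> H * s"
    and x: "x \<in> msupp M" "r > 0" "nball N x (4 * r) \<subseteq> U" "nball N x (4 * r) \<subseteq> W"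
    and H: "\<And>y \<gamma>. y \<in> nball N x r \<Longrightarrow> \<gamma> \<in> MI l \<Longrightarrow> qabs (G \<gamma> y) * r ^ mdeg \<gamma> \<le> H * s"
    and s: "s > 0" and H0: "H \<ge> 0"
    and big: "\<And>y. y \<in> nball N x r \<Longrightarrow> \<exists>\<gamma>\<in>MI l. qabs (G \<gamma> y) * r ^ mdeg \<gamma> \<ge> s"
    and e: "0 < e" "e \<le> 1"
  defines "Q \<equiv> ratio_const l H"
  shows "emeasure M {y \<in> nball N x r. qabs (G (\<lambda>_. 0) y) < s * e}
    \<le> ennreal (real (card (MI l \<times> UNIV :: (('d \<Rightarrow> nat) \<times> 'd) set)) * (C * Q powr \<alpha> * (D * D)) * e powr (\<alpha> * theta l)) * emeasure M (nball N x r)"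
proof -
  define \<delta> where "\<delta> j = e powr level_exp l j" for j
  define S where "S = (\<lambda>(\<beta>, i). {y \<in> nball N x r \<inter> msupp M. qabs (G \<beta> y) * r ^ mdeg \<beta> < s * \<delta> (mdeg \<beta>) \<and>
           qabs (G (bump \<beta> i) y) * r ^ Suc (mdeg \<beta>) \<ge> s * \<delta> (Suc (mdeg \<beta>))})"
  define I where "I = {\<beta> :: 'd \<Rightarrow> nat. mdeg \<beta> < l} \<times> (UNIV :: 'd set)"
  define b where "b = C * Q powr \<alpha> * (D * D) * e powr (\<alpha> * theta l)"
  have IM: "I \<subseteq> MI l \<times> UNIV"
    by (auto simp: I_def MI_def)
  then have fI: "finite I"
    by (rule finite_subset) simp
  have Q: "Q \<ge> 0"
    using H0 suc_min_pos[of l] kappa_ge_1 jet_const_pos[of "TYPE('d)" l] by (simp add: Q_def ratio_const_def)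
  have b0: "b \<ge> 0"
    using C D by (simp add: b_def)
  have \<delta>: "0 < \<delta> j" for j
    using e by (simp add: \<delta>_def)
  have \<delta>1: "\<delta> j \<le> 1" if "j \<le> l" for j
    unfolding \<delta>_def using e level_exp_nonneg[OF l that] by (simp add: powr_le1)
  have "\<forall>p\<in>I. \<exists>T. T \<in> sets M \<and> S p \<subseteq> T \<and> emeasure M T \<le> ennreal b * emeasure M (nball N x r)"
  proof
    fix p assume "p \<in> I"
    then obtain \<beta> i where p: "p = (\<beta>, i)" "mdeg \<beta> < l"
      by (auto simp: I_def)
    let ?j = "mdeg \<beta>"
    \<comment> \<open>The exponents are chosen to make this ratio the same in every degree.\<close>
    have "sqrt (\<delta> ?j) / \<delta> (Suc ?j) = e powr theta l"
      using e by (simp add: \<delta>_def powr_half_sqrt[symmetric] powr_powr flip: powr_diff level_exp_step[of l ?j])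
    then have "(Q * (sqrt (\<delta> ?j) / \<delta> (Suc ?j))) powr \<alpha> = Q powr \<alpha> * e powr (\<alpha> * theta l)"
      using Q e by (simp add: powr_mult powr_powr mult.commute)
    then have "C * (Q * (sqrt (\<delta> ?j) / \<delta> (Suc ?j))) powr \<alpha> * (D * D) = b"
      by (simp add: b_def)
    then show "\<exists>T. T \<in> sets M \<and> S p \<subseteq> T \<and> emeasure M T \<le> ennreal b * emeasure M (nball N x r)"
      using stratum_bound[OF M F D dec C jet B x H s H0 p(2) \<delta> \<delta>1 \<delta>, of ?j "Suc ?j" i] p
      by (auto simp: S_def Q_def)
  qed
  from bchoice[OF this] obtain T where T: "\<And>p. p \<in> I \<Longrightarrow> T p \<in> sets M" "\<And>p. p \<in> I \<Longrightarrow> S p \<subseteq> T p"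
    "\<And>p. p \<in> I \<Longrightarrow> emeasure M (T p) \<le> ennreal b * emeasure M (nball N x r)"
    by blast
  \<comment> \<open>Points outside the support belong to no stratum; they form a null set.\<close>
  have sub: "{y \<in> nball N x r. qabs (G (\<lambda>_. 0) y) < s * e} \<subseteq> - msupp M \<union> (\<Union>p\<in>I. T p)"
  proof
    fix y assume y: "y \<in> {y \<in> nball N x r. qabs (G (\<lambda>_. 0) y) < s * e}"
    show "y \<in> - msupp M \<union> (\<Union>p\<in>I. T p)"
    proof (cases "y \<in> msupp M")
      case True
      \<comment> \<open>The least degree \<open>k\<close> with a coefficient above its threshold
        exists because some coefficient is at least \<open>s\<close>, and it is positive because
        \<open>level_exp l 0 = 1\<close> makes \<open>s * e\<close> the threshold in degree 0. A
        multi-index of degree \<open>k\<close> is then a \<open>bump\<close> of one of degree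
        \<open>k - 1\<close>, which is below its threshold.\<close>
      define P where "P k \<longleftrightarrow> (\<exists>\<gamma>. mdeg \<gamma> = k \<and> k \<le> l \<and> qabs (G \<gamma> y) * r ^ mdeg \<gamma> \<ge> s * \<delta> k)" for k
      obtain \<gamma>' where \<gamma>': "\<gamma>' \<in> MI l" "qabs (G \<gamma>' y) * r ^ mdeg \<gamma>' \<ge> s"
        using big y by blast
      then have "s * \<delta> (mdeg \<gamma>') \<le> s"
        using \<delta>1[of "mdeg \<gamma>'"] s by (simp add: MI_def)
      with \<gamma>' have "P (mdeg \<gamma>')"
        unfolding P_def by (intro exI[of _ \<gamma>']) (auto simp: MI_def)
      define k where "k = (LEAST k. P k)"
      have Pk: "P k"
        unfolding k_def using \<open>P (mdeg \<gamma>')\<close> by (rule LeastI)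
      have min: "\<not> P j" if "j < k" for j
        using that unfolding k_def by (rule not_less_Least)
      have "k \<noteq> 0"
      proof
        assume "k = 0"
        with Pk have "s * \<delta> 0 \<le> qabs (G (\<lambda>_. 0) y)"
          by (auto simp: P_def mdeg_eq_0_iff)
        then show False
          using y e by (simp add: \<delta>_def level_exp_0)
      qed
      then obtain j where j: "k = Suc j"
        by (cases k) auto
      obtain \<gamma> where \<gamma>: "mdeg \<gamma> = Suc j" "Suc j \<le> l" "s * \<delta> (Suc j) \<le> qabs (G \<gamma> y) * r ^ Suc j"
        using Pk unfolding P_def j by auto
      from mdeg_SucE[OF \<gamma>(1)] obtain \<beta> i where \<beta>: "\<gamma> = bump \<beta> i" "mdeg \<beta> = j"
        by blast
      have "\<not> s * \<delta> j \<le> qabs (G \<beta> y) * r ^ j"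
        using min[of j] \<beta> \<gamma>(2) unfolding P_def j by auto
      then have "y \<in> S (\<beta>, i)" "(\<beta>, i) \<in> I"
        using \<beta> \<gamma> y True by (auto simp: S_def I_def)
      then show ?thesis
        using T(2) by blast
    qed simp
  qed
  have UT: "(\<Union>p\<in>I. T p) \<in> sets M"
    using fI T(1) by blast
  have null: "- msupp M \<in> null_sets M"
    by (rule Compl_msupp_null[OF M])
  have "emeasure M {y \<in> nball N x r. qabs (G (\<lambda>_. 0) y) < s * e} \<le> emeasure M (- msupp M \<union> (\<Union>p\<in>I. T p))"
    using sub UT null by (intro emeasure_mono sets.Un) auto
  also have "\<dots> = emeasure M (\<Union>p\<in>I. T p)"
    using emeasure_Un_null_set[OF UT null] by (simp add: Un_commute)
  also have "\<dots> \<le> (\<Sum>p\<in>I. emeasure M (T p))"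
    using T(1) fI by (intro emeasure_subadditive_finite) auto
  also have "\<dots> \<le> (\<Sum>p\<in>I. ennreal b * emeasure M (nball N x r))"
    by (intro sum_mono T(3))
  also have "\<dots> = ennreal (real (card I) * b) * emeasure M (nball N x r)"
    using b0 by (simp add: ennreal_mult ennreal_of_nat_eq_real_of_nat mult.assoc)
  also have "\<dots> \<le> ennreal (real (card (MI l \<times> UNIV :: (('d \<Rightarrow> nat) \<times> 'd) set)) * b) * emeasure M (nball N x r)"
  proof -
    have "card I \<le> card (MI l \<times> UNIV :: (('d \<Rightarrow> nat) \<times> 'd) set)"
      using IM by (intro card_mono) simp_all
    then show ?thesis
      using b0 by (intro mult_right_mono ennreal_leI mult_right_mono of_nat_mono) auto
  qed
  finally show ?thesis
    by (simp only: b_def mult.assoc)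
qed

end

section \<open>Linear combinations of nondegenerate maps\<close>

lemma card_MI_pos: "card (MI n) > 0"
proof -
  have "MI n \<noteq> {}"
    using zero_in_MI by blast
  then show ?thesis
    by (simp add: card_gt_0_iff)
qed

text \<open>All terms but the constant one have positive degree, so at distance at most 1 they are
  bounded by the first power. This carries the lower bound from \<open>x0\<close> to nearby
  points.\<close>

lemma (in Q_nu) jet_lipschitz:
  fixes F :: "('d::finite \<Rightarrow> nat) \<Rightarrow> 'k ^ 'd \<Rightarrow> 'k"
  assumes jet: "jet l W F B" and B: "B \<ge> 0" and x0: "x0 \<in> W" and \<beta>: "\<beta> \<in> MI l"
  shows "\<exists>L\<ge>0. \<forall>x\<in>W. max_norm (x - x0) \<le> 1 \<longrightarrow> qabs (F \<beta> x - F \<beta> x0) \<le> L * max_norm (x - x0)"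
proof -
  let ?I = "MI (l - mdeg \<beta>) :: ('d \<Rightarrow> nat) set"
  let ?c = "\<lambda>\<gamma>. of_nat (mbinom \<beta> \<gamma>) * F (\<lambda>i. \<beta> i + \<gamma> i) x0"
  define L where "L = B + (\<Sum>\<gamma>\<in>?I. qabs (?c \<gamma>))"
  have pow: "h ^ n \<le> h" if "0 \<le> h" "h \<le> 1" "n \<noteq> 0" for h :: real and n
    using that power_decreasing[of 1 n h] by simp
  show ?thesis
  proof (intro exI[of _ L] conjI ballI impI)
    show "L \<ge> 0"
      using B by (simp add: L_def sum_nonneg)
    fix x assume x: "x \<in> W" "max_norm (x - x0) \<le> 1"
    let ?h = "max_norm (x - x0)"
    let ?P = "\<Sum>\<gamma>\<in>?I. ?c \<gamma> * monom_at (x - x0) \<gamma>"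
    let ?R = "\<Sum>\<gamma>\<in>?I - {\<lambda>_. 0}. ?c \<gamma> * monom_at (x - x0) \<gamma>"
    have P: "?P = F \<beta> x0 + ?R"
      by (subst sum.remove[of _ "\<lambda>_. 0"]) simp_all
    have 1: "qabs (F \<beta> x - ?P) \<le> B * ?h"
    proof -
      have "qabs (F \<beta> x - ?P) \<le> B * ?h ^ (l + 1 - mdeg \<beta>)"
        using jet[unfolded jet_def, rule_format, OF \<beta> x0 x(1)] .
      also have "\<dots> \<le> B * ?h"
        using B x(2) \<beta> by (intro mult_left_mono pow) (auto simp: MI_def)
      finally show ?thesis .
    qed
    have "qabs ?R \<le> (\<Sum>\<gamma>\<in>?I - {\<lambda>_. 0}. qabs (?c \<gamma> * monom_at (x - x0) \<gamma>))"
      by (rule qabs_sum)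
    also have "\<dots> \<le> (\<Sum>\<gamma>\<in>?I - {\<lambda>_. 0}. qabs (?c \<gamma>) * ?h)"
    proof (rule sum_mono)
      fix \<gamma> :: "'d \<Rightarrow> nat" assume "\<gamma> \<in> ?I - {\<lambda>_. 0}"
      then have "mdeg \<gamma> \<noteq> 0"
        by (simp add: mdeg_eq_0_iff)
      then have "qabs (monom_at (x - x0) \<gamma>) \<le> ?h"
        using qabs_monom_at_le[of "x - x0" \<gamma>] pow[of ?h "mdeg \<gamma>"] x(2) by simp
      then show "qabs (?c \<gamma> * monom_at (x - x0) \<gamma>) \<le> qabs (?c \<gamma>) * ?h"
        unfolding qabs_mult[of "?c \<gamma>"] by (intro mult_left_mono) auto
    qed
    also have "\<dots> \<le> (\<Sum>\<gamma>\<in>?I. qabs (?c \<gamma>) * ?h)"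
      by (intro sum_mono2) auto
    finally have 2: "qabs ?R \<le> (\<Sum>\<gamma>\<in>?I. qabs (?c \<gamma>)) * ?h"
      by (simp add: sum_distrib_right)
    have eq: "F \<beta> x - F \<beta> x0 = (F \<beta> x - ?P) + ?R"
      unfolding P by simp
    have "qabs (F \<beta> x - F \<beta> x0) \<le> qabs (F \<beta> x - ?P) + qabs ?R"
      unfolding eq by (rule qabs_triangle)
    also have "\<dots> \<le> L * ?h"
      using 1 2 by (simp add: L_def distrib_right)
    finally show "qabs (F \<beta> x - F \<beta> x0) \<le> L * ?h" .
  qed
qed

context Q_norm
begin

text \<open>The cube of radius \<open>r / \<kappa>\<close> lies in the ball of radius
  \<open>r\<close>; rescaling by \<open>\<kappa>\<close> costs at most
  \<open>\<kappa> ^ l\<close>.\<close>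

definition ball_const :: "nat \<Rightarrow> real" where
  "ball_const l = coeff_const TYPE('d) l * \<kappa> ^ l"

lemma ball_const_pos: "ball_const l > 0"
  using kappa_ge_1 by (simp add: ball_const_def coeff_const)

text \<open>Chosen so that weighted coefficients below \<open>low_const l * s\<close> make a Taylor
  polynomial of size at most \<open>s / 8\<close> at distance \<open>2 * r\<close>.\<close>

definition low_const :: "nat \<Rightarrow> real" where
  "low_const l = 1 / (8 * 2 ^ l * real (card (MI l :: ('d \<Rightarrow> nat) set)))"

lemma low_const_pos: "low_const l > 0"
  by (simp add: low_const_def card_MI_pos)

text \<open>The weighted coefficients at the centre are at most
  \<open>(2 * ball_const l + 1) * s\<close>; the factor \<open>jet_const\<close> spreads this over
  the ball, and its summand 1 leaves room for the remainder. Division by \<open>low_const l\<close>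
  makes the bound relative to the lower one.\<close>

definition high_const :: "nat \<Rightarrow> real" where
  "high_const l = (jet_const TYPE('d) l + 1) * (2 * ball_const l + 1) / low_const l"

text \<open>The summand 1 covers \<open>\<epsilon>\<close> above \<open>low_const l * s\<close>,
  where the measure of the whole ball serves as the bound; the last factor rescales
  \<open>\<epsilon>\<close> by \<open>low_const l\<close>.\<close>

definition good_const :: "real \<Rightarrow> real \<Rightarrow> real \<Rightarrow> nat \<Rightarrow> real" where
  "good_const C D \<alpha> l =
     (real (card (MI l \<times> UNIV :: (('d \<Rightarrow> nat) \<times> 'd) set)) * (C * ratio_const l (high_const l) powr \<alpha> * (D * D)) + 1)
     * (1 / low_const l) powr (\<alpha> * theta l)"

lemma good_const_pos:
  assumes "C > 0"
  shows "good_const C D \<alpha> l > 0"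
  using assms low_const_pos[of l] by (simp add: good_const_def add_nonneg_pos)

text \<open>On the cube of radius \<open>r / \<kappa>\<close> the Taylor polynomial at
  \<open>x\<close> differs from \<open>g\<close> by at most the remainder;
  \<open>coeff_const\<close> then bounds its coefficients.\<close>

lemma jet_upper_bound:
  fixes G :: "('d \<Rightarrow> nat) \<Rightarrow> 'k ^ 'd \<Rightarrow> 'k"
  assumes t: "taylor l W G B g" and B: "B \<ge> 0" and r: "r > 0" and W: "nball N x r \<subseteq> W"
    and s: "\<And>y. y \<in> nball N x r \<Longrightarrow> qabs (g y) \<le> s" and \<gamma>: "\<gamma> \<in> MI l"
  shows "qabs (G \<gamma> x) * r ^ mdeg \<gamma> \<le> ball_const l * (s + B * r ^ (l + 1))"
proof -
  define r' where "r' = r / \<kappa>"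
  have r': "r' > 0" "r = \<kappa> * r'"
    using r kappa_ge_1 by (auto simp: r'_def)
  have xW: "x \<in> W"
    using W r by auto
  have "qabs (G \<gamma> x) * r' ^ mdeg \<gamma> \<le> coeff_const TYPE('d) l * (s + B * r ^ (l + 1))"
  proof (rule coeff_const(2)[OF r'(1) _ \<gamma>])
    fix h :: "'k ^ 'd"
    assume h: "max_norm h < r'"
    have "x + h \<in> cube x (r / \<kappa>)"
      using h by (simp add: cube_def r'_def)
    then have mem: "x + h \<in> nball N x r"
      using cube_subset_nball by blast
    let ?P = "\<Sum>\<delta>\<in>MI l. G \<delta> x * monom_at h \<delta>"
    have "r' \<le> r"
      using r' kappa_ge_1 mult_right_mono[of 1 \<kappa> r'] by simp
    have "qabs (g (x + h) - ?P) \<le> B * max_norm h ^ (l + 1)"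
      using t[unfolded taylor_def, rule_format, OF xW, of "x + h"] mem W by auto
    also have "\<dots> \<le> B * r ^ (l + 1)"
      using h \<open>r' \<le> r\<close> B by (intro mult_left_mono power_mono) auto
    finally show "qabs ?P \<le> s + B * r ^ (l + 1)"
      using s[OF mem] qabs_diff_triangle[of "g (x + h)" "g (x + h) - ?P"] by simp
  qed
  then have "\<kappa> ^ mdeg \<gamma> * (qabs (G \<gamma> x) * r' ^ mdeg \<gamma>) \<le> \<kappa> ^ mdeg \<gamma> * (coeff_const TYPE('d) l * (s + B * r ^ (l + 1)))"
    using kappa_ge_1 by (intro mult_left_mono) auto
  also have "\<dots> \<le> \<kappa> ^ l * (coeff_const TYPE('d) l * (s + B * r ^ (l + 1)))"
  proof (intro mult_right_mono power_increasing)
    show "0 \<le> coeff_const TYPE('d) l * (s + B * r ^ (l + 1))"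
      using coeff_const(1)[where 'd = 'd and l = l] B r order_trans[OF qabs_nonneg s[of x]] by (intro mult_nonneg_nonneg add_nonneg_nonneg) auto
  qed (use \<gamma> kappa_ge_1 in \<open>auto simp: MI_def\<close>)
  also have "\<kappa> ^ mdeg \<gamma> * (qabs (G \<gamma> x) * r' ^ mdeg \<gamma>) = qabs (G \<gamma> x) * r ^ mdeg \<gamma>"
    unfolding r'(2) by (simp add: power_mult_distrib)
  finally show ?thesis
    by (simp add: mult_ac ball_const_def)
qed

text \<open>If all coefficients at \<open>y\<close> were smaller, the value at \<open>z\<close>
  would be at most \<open>s / 8\<close> from the polynomial plus \<open>s / 4\<close> from the
  remainder, less than the \<open>s / 2\<close> attained.\<close>

lemma jet_lower_bound:
  fixes G :: "('d \<Rightarrow> nat) \<Rightarrow> 'k ^ 'd \<Rightarrow> 'k"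
  assumes t: "taylor l W G B g" and B: "B \<ge> 0" "B * (2 * r) ^ (l + 1) \<le> s / 4" and r: "r > 0"
    and W: "nball N x r \<subseteq> W" and s: "s > 0"
    and z: "z \<in> nball N x r" "s / 2 \<le> qabs (g z)" and y: "y \<in> nball N x r"
  shows "\<exists>\<gamma>\<in>MI l. qabs (G \<gamma> y) * r ^ mdeg \<gamma> \<ge> low_const l * s"
proof (rule ccontr)
  assume neg: "\<not> ?thesis"
  define n where "n = real (card (MI l :: ('d \<Rightarrow> nat) set))"
  have n: "n > 0"
    by (simp add: n_def card_MI_pos)
  have small: "qabs (G \<gamma> y) * r ^ mdeg \<gamma> \<le> s / (8 * 2 ^ l * n)" if "\<gamma> \<in> MI l" for \<gamma>
    using neg that by (force simp: n_def low_const_def)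
  let ?P = "\<Sum>\<gamma>\<in>MI l. G \<gamma> y * monom_at (z - y) \<gamma>"
  have "N (z - y) < 2 * r"
    using y z N_via[of z y x] N_minus_commute[of x y] by (simp add: nball_def)
  then have zy: "max_norm (z - y) \<le> 2 * r"
    using max_norm_le_N[of "z - y"] by simp
  have "qabs (g z - ?P) \<le> B * max_norm (z - y) ^ (l + 1)"
    using t[unfolded taylor_def, rule_format, of y z] y z W by blast
  also have "\<dots> \<le> B * (2 * r) ^ (l + 1)"
    using B zy by (intro mult_left_mono power_mono) auto
  finally have 1: "qabs (g z - ?P) \<le> s / 4"
    using B by simp
  have "qabs ?P \<le> real (card (MI l :: ('d \<Rightarrow> nat) set)) * (s / (8 * n))"
  proof (rule qabs_sum_bound)
    fix \<gamma> :: "'d \<Rightarrow> nat"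
    assume \<gamma>: "\<gamma> \<in> MI l"
    have "qabs (G \<gamma> y * monom_at (z - y) \<gamma>) \<le> qabs (G \<gamma> y) * (2 * r) ^ mdeg \<gamma>"
      unfolding qabs_mult
      by (intro mult_left_mono order_trans[OF qabs_monom_at_le] power_mono zy) auto
    also have "\<dots> = (qabs (G \<gamma> y) * r ^ mdeg \<gamma>) * 2 ^ mdeg \<gamma>"
      by (simp add: power_mult_distrib)
    also have "\<dots> \<le> (s / (8 * 2 ^ l * n)) * 2 ^ l"
      using \<gamma> s n by (intro mult_mono small power_increasing) (auto simp: MI_def)
    also have "\<dots> = s / (8 * n)"
      by simp
    finally show "qabs (G \<gamma> y * monom_at (z - y) \<gamma>) \<le> s / (8 * n)" .
  qed
  also have "\<dots> = s / 8"
    using n unfolding n_def[symmetric] by simp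
  finally have "qabs ?P \<le> s / 8" .
  with 1 have "qabs (g z) \<le> s / 4 + s / 8"
    using qabs_triangle[of "g z - ?P" ?P] by simp
  with z(2) s show False
    by simp
qed

text \<open>All estimates are taken relative to the supremum of \<open>g\<close> on the ball;
  \<open>A\<close>, \<open>m\<close> and \<open>c\<close> enter only through the smallness of
  \<open>r\<close>, so the constant in the conclusion does not involve them.\<close>

lemma good_on_ball:
  fixes G :: "('d \<Rightarrow> nat) \<Rightarrow> 'k ^ 'd \<Rightarrow> 'k" and A c C D \<alpha> :: real
  assumes l: "l \<ge> 1"
    and M: "sets M = sets borel" and F: "Federer_on N M D U" and D: "D > 0"
    and dec: "abs_decaying N M C \<alpha> U" and C: "C > 0" "\<alpha> > 0"
    and t: "taylor l W G (A * m) g" and jet: "jet l W G (A * m)" and Am: "A \<ge> 0" "m \<ge> 0"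
    and x: "x \<in> msupp M" "nball N x (4 * r) \<subseteq> U" "nball N x (4 * r) \<subseteq> W"
    and r: "r > 0" "r \<le> 1" "8 * 2 ^ (l + 1) * A * ball_const l * r \<le> c"
    and c: "c > 0" "\<gamma>0 \<in> MI l" "c * m \<le> qabs (G \<gamma>0 x)"
    and \<epsilon>: "\<epsilon> > 0" and sup: "(SUP y\<in>nball N x r. ennreal (qabs (g y))) \<noteq> 0"
  shows "emeasure M {y \<in> nball N x r. qabs (g y) < \<epsilon>}
    \<le> ennreal (good_const C D \<alpha> l * enn2real (ennreal \<epsilon> / (SUP y\<in>nball N x r. ennreal (qabs (g y)))) powr (\<alpha> * theta l))
      * emeasure M (nball N x r)"
proof -
  define K c2 H where "K = ball_const l" and "c2 = low_const l" and "H = high_const l"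
  define S where "S = (SUP y\<in>nball N x r. ennreal (qabs (g y)))"
  define B where "B = A * m"
  define J where "J = jet_const TYPE('d) l"
  define \<tau> where "\<tau> = \<alpha> * theta l"
  have \<tau>: "\<tau> > 0"
    using C theta_pos[OF l] by (simp add: \<tau>_def)
  have B: "B \<ge> 0"
    using Am by (simp add: B_def)
  have J: "J > 0"
    by (simp add: J_def jet_const_pos)
  have K: "K > 0"
    by (simp add: K_def ball_const_pos)
  have c2: "c2 > 0"
    by (simp add: c2_def low_const_pos)
  have H_eq: "H = (J + 1) * (2 * K + 1) / c2"
    by (simp add: H_def high_const_def J_def K_def c2_def)
  have H: "H > 0"
    using J K c2 by (simp add: H_eq)
  have sub: "nball N x r \<subseteq> nball N x (4 * r)"
    using r(1) by (intro nball_mono) simp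
  have W: "nball N x r \<subseteq> W"
    using sub x(3) by blast
  have xB: "x \<in> nball N x r" "x \<in> W"
    using r(1) W by auto
  have taylor: "taylor l W G B g" and jet': "jet l W G B"
    using t jet by (simp_all add: B_def)
  have max: "max_norm (y - x) \<le> 3 * r" if "y \<in> nball N x r" for y
    using that max_norm_le_N[of "y - x"] r(1) unfolding nball_def mem_Collect_eq by linarith
  have g: "g y = G (\<lambda>_. 0) y" if "y \<in> nball N x r" for y
    using taylor_at_0[OF taylor] W that by auto
  \<comment> \<open>Finiteness of the supremum comes from the coefficients at the centre.\<close>
  have "S < top"
  proof -
    define s0 where "s0 = B * r ^ (l + 1) + (\<Sum>\<gamma>\<in>MI l. qabs (G \<gamma> x) * r ^ mdeg \<gamma>)"
    have "0 \<le> B * r ^ (l + 1)"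
      using B r by simp
    then have "qabs (G \<gamma> x) * r ^ mdeg \<gamma> \<le> s0" if "\<gamma> \<in> MI l" for \<gamma>
      using member_le_sum[OF that, of "\<lambda>\<gamma>. qabs (G \<gamma> x) * r ^ mdeg \<gamma>"] r(1) unfolding s0_def by fastforce
    moreover have "B * r ^ (l + 1) \<le> s0"
      using r by (simp add: s0_def sum_nonneg)
    ultimately have "qabs (G (\<lambda>_. 0) y) * r ^ mdeg (\<lambda>_::'d. 0) \<le> jet_const TYPE('d) l * s0" if "y \<in> nball N x r" for y
      using that W by (intro jet_bound[OF jet' _ xB(2) _ r(1) _ B _ max]) auto
    then have "S \<le> ennreal (jet_const TYPE('d) l * s0)"
      unfolding S_def by (intro SUP_least ennreal_leI) (simp add: g)
    then show ?thesis
      by (rule le_less_trans) simp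
  qed
  define s where "s = enn2real S"
  have S: "S = ennreal s"
    using \<open>S < top\<close> by (simp add: s_def less_top)
  have s: "s > 0"
    using sup S by (cases "s > 0") (auto simp: S_def ennreal_neg)
  have up: "qabs (g y) \<le> s" if "y \<in> nball N x r" for y
  proof -
    have "ennreal (qabs (g y)) \<le> S"
      unfolding S_def using that by (rule SUP_upper)
    then show ?thesis
      using s by (simp add: S)
  qed
  have "ennreal (s / 2) < S"
    using s by (simp add: S ennreal_less_iff)
  \<comment> \<open>The supremum need not be attained, but a value of at least half its size
    is.\<close>
  then obtain z where z: "z \<in> nball N x r" "s / 2 \<le> qabs (g z)"
    unfolding S_def less_SUP_iff using s by (auto simp: ennreal_less_iff)
  have coeff: "qabs (G \<gamma> x) * r ^ mdeg \<gamma> \<le> K * (s + B * r ^ (l + 1))" if "\<gamma> \<in> MI l" for \<gamma>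
    using jet_upper_bound[OF taylor B r(1) W up that] by (simp add: K_def)
  \<comment> \<open>With \<open>X = m * r ^ l\<close>, the coefficient \<open>\<gamma>0\<close>
    gives \<open>c * X \<le> K * s + K * A * r * X\<close>. By the bound on \<open>r\<close> the
    last term is absorbed on the left, so \<open>s\<close> dominates \<open>X\<close> and therefore
    the remainder, which is smaller by a further factor \<open>r\<close>.\<close>
  have mr: "c * (m * r ^ l) \<le> 2 * K * s" and Br: "B * (2 * r) ^ (l + 1) \<le> s / 4"
  proof -
    define X where "X = m * r ^ l"
    have X: "X \<ge> 0"
      using Am r by (simp add: X_def)
    have "r ^ l \<le> r ^ mdeg \<gamma>0"
      using r c(2) by (intro power_decreasing) (auto simp: MI_def)
    then have "(c * m) * r ^ l \<le> qabs (G \<gamma>0 x) * r ^ mdeg \<gamma>0"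
      using c Am r by (intro mult_mono) auto
    also have "\<dots> \<le> K * (s + B * r ^ (l + 1))"
      by (rule coeff[OF c(2)])
    finally have 1: "c * X \<le> K * s + K * A * r * X"
      by (simp add: X_def B_def algebra_simps)
    have 2: "2 ^ (l + 1) * (8 * (K * A * r * X)) \<le> c * X"
      using mult_right_mono[OF r(3) X] by (simp add: K_def mult_ac)
    have "1 * (8 * (K * A * r * X)) \<le> 2 ^ (l + 1) * (8 * (K * A * r * X))"
      using K Am r X by (intro mult_right_mono one_le_power) auto
    with 1 2 have 3: "c * X \<le> 2 * (K * s)"
      using K s by (smt (verit) mult_pos_pos)
    then show "c * (m * r ^ l) \<le> 2 * K * s"
      by (simp add: X_def)
    have "K * (B * (2 * r) ^ (l + 1)) = 2 ^ (l + 1) * (K * A * r * X)"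
      by (simp add: X_def B_def power_mult_distrib mult_ac)
    also have "\<dots> \<le> K * (s / 4)"
      using 2 3 by simp
    finally show "B * (2 * r) ^ (l + 1) \<le> s / 4"
      using K by (simp del: power_Suc)
  qed
  have "B * r ^ (l + 1) \<le> B * (2 * r) ^ (l + 1)"
    using B r by (intro mult_left_mono power_mono) auto
  then have Brs: "B * r ^ (l + 1) \<le> s"
    using Br s by linarith
  have S1: "qabs (G \<gamma> x) * r ^ mdeg \<gamma> \<le> (2 * K + 1) * s" if "\<gamma> \<in> MI l" for \<gamma>
  proof -
    have "K * (s + B * r ^ (l + 1)) \<le> K * (s + s)"
      using K Brs by (intro mult_left_mono) auto
    with coeff[OF that] s show ?thesis
      by (simp add: distrib_right)
  qed
  have "0 \<le> 2 * K * s"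
    using K s by simp
  then have S2: "B * r ^ (l + 1) \<le> (2 * K + 1) * s"
    using Brs by (simp add: distrib_right)
  define s2 where "s2 = c2 * s"
  have s2: "s2 > 0"
    using c2 s by (simp add: s2_def)
  have Hs: "H * s2 = (J + 1) * ((2 * K + 1) * s)"
    using c2 by (simp add: H_eq s2_def)
  have Ks: "(2 * K + 1) * s \<ge> 0"
    using K s by simp
  have upper: "qabs (G \<gamma> y) * r ^ mdeg \<gamma> \<le> H * s2" if "y \<in> nball N x r" "\<gamma> \<in> MI l" for y \<gamma>
  proof -
    have "qabs (G \<gamma> y) * r ^ mdeg \<gamma> \<le> J * ((2 * K + 1) * s)"
      unfolding J_def using that W by (intro jet_bound[OF jet' that(2) xB(2) _ r(1) S1 B S2 max]) auto
    also have "\<dots> \<le> H * s2"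
      unfolding Hs using Ks by (intro mult_right_mono) auto
    finally show ?thesis .
  qed
  have BH: "B * r ^ (l + 1) \<le> H * s2"
    unfolding Hs using S2 mult_right_mono[OF _ Ks, of 1 "J + 1"] J by simp
  have lower: "\<exists>\<gamma>\<in>MI l. s2 \<le> qabs (G \<gamma> y) * r ^ mdeg \<gamma>" if "y \<in> nball N x r" for y
    using jet_lower_bound[OF taylor B Br r(1) W s z that] by (simp add: s2_def c2_def)
  define P where "P = real (card (MI l \<times> UNIV :: (('d \<Rightarrow> nat) \<times> 'd) set)) * (C * ratio_const l H powr \<alpha> * (D * D))"
  have P: "P \<ge> 0"
    using C D by (simp add: P_def)
  have C': "good_const C D \<alpha> l = (P + 1) * (1 / c2) powr \<tau>"
    by (simp add: good_const_def P_def \<tau>_def H_def c2_def)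
  define e where "e = \<epsilon> / s2"
  have e: "e > 0" "s2 * e = \<epsilon>"
    using \<epsilon> s2 by (simp_all add: e_def)
  have ratio: "enn2real (ennreal \<epsilon> / S) = \<epsilon> / s"
    using \<epsilon> s by (simp add: S divide_ennreal)
  have epow: "(1 / c2) powr \<tau> * (\<epsilon> / s) powr \<tau> = e powr \<tau>"
    using c2 \<epsilon> s by (simp add: e_def s2_def powr_mult[symmetric])
  have "emeasure M {y \<in> nball N x r. qabs (g y) < \<epsilon>} \<le> ennreal ((P + 1) * e powr \<tau>) * emeasure M (nball N x r)"
  proof (cases "e \<le> 1")
    case True
    have "{y \<in> nball N x r. qabs (g y) < \<epsilon>} = {y \<in> nball N x r. qabs (G (\<lambda>_. 0) y) < s2 * e}"
      using g e by auto
    then have "emeasure M {y \<in> nball N x r. qabs (g y) < \<epsilon>} \<le> ennreal (P * e powr \<tau>) * emeasure M (nball N x r)"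
      using sublevel_bound[OF l M F D dec C jet' B BH x(1) r(1) x(2,3) upper s2 less_imp_le[OF H] lower e(1) True]
      by (simp add: P_def \<tau>_def)
    also have "\<dots> \<le> ennreal ((P + 1) * e powr \<tau>) * emeasure M (nball N x r)"
      by (intro mult_right_mono ennreal_leI) auto
    finally show ?thesis .
  next
    case False
    have "1 \<le> e powr \<tau>"
      using False \<tau> by (intro ge_one_powr_ge_zero) auto
    then have "1 * 1 \<le> (P + 1) * e powr \<tau>"
      using P by (intro mult_mono) auto
    then have one: "1 \<le> ennreal ((P + 1) * e powr \<tau>)"
      by simp
    have "emeasure M {y \<in> nball N x r. qabs (g y) < \<epsilon>} \<le> emeasure M (nball N x r)"
      by (intro emeasure_mono) (auto simp: M)
    also have "\<dots> \<le> ennreal ((P + 1) * e powr \<tau>) * emeasure M (nball N x r)"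
      using mult_right_mono[OF one, of "emeasure M (nball N x r)"] by simp
    finally show ?thesis .
  qed
  then show ?thesis
    unfolding S_def[symmetric] ratio \<tau>_def[symmetric] C' mult.assoc epow .
qed

text \<open>The coefficients of \<open>g\<close> other than \<open>c0\<close> enter only through
  \<open>m = max_norm cc\<close>: both the Taylor constant \<open>A * m\<close> and the lower bound
  \<open>c * m\<close> are proportional to it. So one neighbourhood and one constant serve all
  \<open>g\<close>, constant ones included.\<close>

lemma combinations_good:
  fixes f :: "'k ^ 'd \<Rightarrow> 'k ^ 'n::finite"
  assumes l: "l \<ge> 1" and U: "open U" "x0 \<in> U" and f: "Ck_map \<nu> (l + 1) U f"
    and nd: "nondegenerate_at l f x0"
    and M: "sets M = sets borel" and F: "Federer_on N M D U" and D: "D > 0"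
    and dec: "abs_decaying N M C \<alpha> U" and C: "C > 0" "\<alpha> > 0"
  shows "\<exists>V C'. open V \<and> x0 \<in> V \<and> V \<subseteq> U \<and> C' > 0 \<and>
    (\<forall>g \<in> affine_combinations f. abs_good N M C' (\<alpha> * theta l) V g)"
proof -
  obtain R0 A0 \<Phi> where R0: "R0 > 0" "cube x0 R0 \<subseteq> U" and A0: "A0 \<ge> 0"
    and taylor: "\<And>k. taylor l (cube x0 R0) (\<Phi> k) A0 (\<lambda>x. f x $ k)"
    using Ck_map_taylor[OF f U] by blast
  define K0 where "K0 = coeff_const TYPE('d) l * (2 * 2 ^ (l + 1))"
  have K0: "K0 > 0"
    by (simp add: K0_def coeff_const)
  note to_jet = taylor_imp_jet[where l = l and 'd = 'd, folded K0_def]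
  define R where "R = R0 / 3"
  have R: "R > 0" "3 * R = R0"
    using R0 by (simp_all add: R_def)
  define W where "W = cube x0 R"
  have W: "open W" "x0 \<in> W" "W \<subseteq> cube x0 R0"
    using R unfolding W_def by (simp, simp add: cube_def, auto simp: cube_def)
  have jet: "jet l W (\<Phi> k) (K0 * A0)" for k
    unfolding W_def by (rule to_jet[OF A0]) (use taylor R in simp)
  have KA0: "K0 * A0 \<ge> 0"
    using K0 A0 by simp
  have \<Phi>0: "\<Phi> k (\<lambda>_. 0) y = f y $ k" if "y \<in> W" for k y
    using taylor_at_0[OF taylor] W that by blast
  obtain c1 where c1: "c1 > 0"
    and nondeg: "\<And>c :: 'k ^ 'n. \<exists>\<gamma>\<in>MI l. mdeg \<gamma> \<ge> 1 \<and>
      qabs (\<Sum>k\<in>UNIV. c $ k * \<Phi> k \<gamma> x0) \<ge> c1 * max_norm c"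
    using nondegenerate_lower_bound[OF l nd jet KA0 W(1,2) \<Phi>0] by blast
  have "\<forall>p\<in>UNIV \<times> MI l. \<exists>L. L \<ge> 0 \<and> (\<forall>x\<in>W. max_norm (x - x0) \<le> 1 \<longrightarrow>
      qabs (\<Phi> (fst p) (snd p) x - \<Phi> (fst p) (snd p) x0) \<le> L * max_norm (x - x0))"
    using jet_lipschitz[OF jet KA0 W(2)] by auto
  from bchoice[OF this] obtain L where L': "\<forall>p\<in>UNIV \<times> MI l. L p \<ge> 0 \<and> (\<forall>x\<in>W. max_norm (x - x0) \<le> 1 \<longrightarrow>
      qabs (\<Phi> (fst p) (snd p) x - \<Phi> (fst p) (snd p) x0) \<le> L p * max_norm (x - x0))"
    by blast
  have L: "L (k, \<gamma>) \<ge> 0" "\<And>x. x \<in> W \<Longrightarrow> max_norm (x - x0) \<le> 1 \<Longrightarrow>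
      qabs (\<Phi> k \<gamma> x - \<Phi> k \<gamma> x0) \<le> L (k, \<gamma>) * max_norm (x - x0)" if "\<gamma> \<in> MI l" for k \<gamma>
    using bspec[OF L', of "(k, \<gamma>)"] that by auto
  define Ls where "Ls = sum L (UNIV \<times> MI l)"
  have Ls: "Ls \<ge> 0" "\<And>k \<gamma>. \<gamma> \<in> MI l \<Longrightarrow> L (k, \<gamma>) \<le> Ls"
    using L(1) by (auto simp: Ls_def intro!: sum_nonneg member_le_sum)
  define n where "n = real CARD('n)"
  have n: "n \<ge> 1"
    by (simp add: n_def Suc_le_eq)
  \<comment> \<open>\<open>K0\<close> for the jet and 1 for the Taylor expansion itself, so that
    \<open>A * m\<close> serves both.\<close>
  define A where "A = (K0 + 1) * n * A0"
  have A: "A \<ge> 0"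
    using K0 n A0 by (simp add: A_def)
  define K where "K = ball_const l"
  have K: "K > 0"
    by (simp add: K_def ball_const_pos)
  define \<Lambda> where "\<Lambda> = 2 * \<kappa> / qabs unif"
  have \<Lambda>: "\<Lambda> > 0"
    using kappa_ge_1 unif by (simp add: \<Lambda>_def)
  \<comment> \<open>Half of the lower bound at \<open>x0\<close> survives on all of
    \<open>V\<close>.\<close>
  define c where "c = c1 / 2"
  have c: "c > 0"
    using c1 by (simp add: c_def)
  define E where "E = 8 * 2 ^ (l + 1) * A * K * \<Lambda>"
  have E: "E \<ge> 0"
    using A K \<Lambda> by (simp add: E_def)
  \<comment> \<open>In this order, the entries allow \<open>jet_lipschitz\<close>, give
    \<open>r \<le> 1\<close>, make \<open>r\<close> small enough for \<open>good_on_ball\<close>,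
    keep the balls of radius \<open>4 * r\<close> in \<open>W\<close>, and limit the variation of
    \<open>G \<gamma>\<close> to \<open>c * m\<close>. The summands 1 beside \<open>E\<close> and
    \<open>n * Ls\<close> guard against division by 0.\<close>
  define Rv where "Rv = Min {1, 1 / \<Lambda>, c / (E + 1), R / (1 + 4 * \<Lambda>), c / (n * Ls + 1)}"
  have den: "E + 1 > 0" "1 + 4 * \<Lambda> > 0" "n * Ls + 1 > 0"
    using E \<Lambda> n Ls(1) by (simp_all add: add_nonneg_pos)
  have Rv: "Rv > 0"
    unfolding Rv_def using \<Lambda> c R den by (subst Min_gr_iff) auto
  have Rv1: "Rv \<le> 1" "Rv \<le> 1 / \<Lambda>" "Rv \<le> c / (E + 1)" "Rv \<le> R / (1 + 4 * \<Lambda>)" "Rv \<le> c / (n * Ls + 1)"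
    unfolding Rv_def by (auto intro: Min_le)
  have Rv2: "\<Lambda> * Rv \<le> 1" "E * Rv \<le> c" "(1 + 4 * \<Lambda>) * Rv \<le> R" "n * Ls * Rv \<le> c"
  proof -
    show "\<Lambda> * Rv \<le> 1" "(1 + 4 * \<Lambda>) * Rv \<le> R"
      using Rv1 \<Lambda> den by (simp_all add: pos_le_divide_eq mult.commute)
    have "(E + 1) * Rv \<le> c" "(n * Ls + 1) * Rv \<le> c"
      using Rv1 den by (simp_all add: pos_le_divide_eq mult.commute)
    then show "E * Rv \<le> c" "n * Ls * Rv \<le> c"
      using Rv by (simp_all add: distrib_right)
  qed
  define V where "V = nball N x0 Rv"
  define C' where "C' = good_const C D \<alpha> l"
  have C': "C' > 0"
    using C by (simp add: C'_def good_const_pos)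
  have "abs_good N M C' (\<alpha> * theta l) V g" if g: "g \<in> affine_combinations f" for g
  proof -
    obtain c0 cc where gdef: "g = (\<lambda>x. c0 + (\<Sum>i\<in>UNIV. cc $ i * f x $ i))"
      using g by (auto simp: affine_combinations_def)
    define m where "m = max_norm cc"
    have m: "m \<ge> 0"
      by (simp add: m_def)
    \<comment> \<open>The constant \<open>c0\<close> changes only the coefficient of degree 0,
      whereas the coefficient bounded below has positive degree.\<close>
    define G where "G \<gamma> x = (\<Sum>k\<in>UNIV. cc $ k * \<Phi> k \<gamma> x) + (if \<gamma> = (\<lambda>_. 0) then c0 else 0)" for \<gamma> x
    have tG: "taylor l (cube x0 R0) G (n * (m * A0)) g"
      unfolding taylor_def
    proof (intro ballI)
      fix x y assume xy: "x \<in> cube x0 R0" "y \<in> cube x0 R0"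
      let ?P = "\<lambda>k. \<Sum>\<gamma>\<in>MI l. \<Phi> k \<gamma> x * monom_at (y - x) \<gamma>"
      have "(\<Sum>\<gamma>\<in>MI l. G \<gamma> x * monom_at (y - x) \<gamma>)
        = (\<Sum>\<gamma>\<in>MI l. \<Sum>k\<in>UNIV. cc $ k * \<Phi> k \<gamma> x * monom_at (y - x) \<gamma>) + (\<Sum>\<gamma>\<in>MI l. if \<gamma> = (\<lambda>_::'d. 0) then c0 else 0)"
        unfolding G_def distrib_right sum.distrib sum_distrib_right
        by (intro arg_cong2[where f = "(+)"] sum.cong) auto
      also have "\<dots> = (\<Sum>k\<in>UNIV. cc $ k * ?P k) + c0"
        by (subst sum.swap) (simp add: sum_distrib_left mult.assoc)
      finally have "g y - (\<Sum>\<gamma>\<in>MI l. G \<gamma> x * monom_at (y - x) \<gamma>) = (\<Sum>k\<in>UNIV. cc $ k * (f y $ k - ?P k))"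
        by (simp add: gdef right_diff_distrib sum_subtractf)
      also have "qabs \<dots> \<le> real (card (UNIV :: 'n set)) * (m * (A0 * max_norm (y - x) ^ (l + 1)))"
      proof (rule qabs_sum_bound)
        fix k :: 'n
        have "qabs (f y $ k - ?P k) \<le> A0 * max_norm (y - x) ^ (l + 1)"
          using taylor[unfolded taylor_def, rule_format, OF xy] .
        then show "qabs (cc $ k * (f y $ k - ?P k)) \<le> m * (A0 * max_norm (y - x) ^ (l + 1))"
          unfolding qabs_mult using qabs_le_max_norm[of cc k] m by (intro mult_mono) (auto simp: m_def)
      qed
      finally show "qabs (g y - (\<Sum>\<gamma>\<in>MI l. G \<gamma> x * monom_at (y - x) \<gamma>)) \<le> n * (m * A0) * max_norm (y - x) ^ (l + 1)"
        by (simp add: n_def mult.assoc)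
    qed
    have nmA0: "n * (m * A0) \<ge> 0"
      using n m A0 by simp
    have AmK: "A * m = K0 * (n * (m * A0)) + n * (m * A0)"
      by (simp add: A_def algebra_simps)
    have jG: "jet l W G (A * m)"
    proof -
      have j: "jet l W G (K0 * (n * (m * A0)))"
        unfolding W_def by (rule to_jet[OF nmA0]) (use tG R in simp)
      have "K0 * (n * (m * A0)) \<le> A * m"
        using nmA0 by (simp add: AmK)
      then have "K0 * (n * (m * A0)) * max_norm (y - x) ^ k \<le> A * m * max_norm (y - x) ^ k" for x y :: "'k ^ 'd" and k
        by (intro mult_right_mono) auto
      with j show ?thesis
        unfolding jet_def by (blast intro: order_trans)
    qed
    have tGW: "taylor l W G (A * m) g"
    proof -
      have "n * (m * A0) \<le> A * m"
        using nmA0 K0 by (simp add: AmK)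
      then have "n * (m * A0) * max_norm (y - x) ^ k \<le> A * m * max_norm (y - x) ^ k" for x y :: "'k ^ 'd" and k
        by (intro mult_right_mono) auto
      with tG W(3) show ?thesis
        unfolding taylor_def by (blast intro: order_trans)
    qed
    obtain \<gamma> where \<gamma>: "\<gamma> \<in> MI l" "mdeg \<gamma> \<ge> 1" "c1 * m \<le> qabs (\<Sum>k\<in>UNIV. cc $ k * \<Phi> k \<gamma> x0)"
      using nondeg[of cc] by (auto simp: m_def)
    then have "\<gamma> \<noteq> (\<lambda>_. 0)"
      by auto
    then have G\<gamma>: "G \<gamma> x = (\<Sum>k\<in>UNIV. cc $ k * \<Phi> k \<gamma> x)" for x
      by (simp add: G_def)
    have low: "c * m \<le> qabs (G \<gamma> x)" if x: "x \<in> V" for x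
    proof -
      have h: "max_norm (x - x0) \<le> Rv"
        using x max_norm_le_N[of "x - x0"] by (simp add: V_def nball_def)
      have "Rv \<le> (1 + 4 * \<Lambda>) * Rv"
        using \<Lambda> Rv by simp
      with Rv2(3) have "N (x - x0) < R"
        using x by (simp add: V_def nball_def)
      then have xW: "x \<in> W"
        using max_norm_le_N[of "x - x0"] by (simp add: W_def cube_def)
      have "qabs (G \<gamma> x0 - G \<gamma> x) \<le> real (card (UNIV :: 'n set)) * (m * (Ls * Rv))"
      proof -
        have "G \<gamma> x0 - G \<gamma> x = (\<Sum>k\<in>UNIV. cc $ k * (\<Phi> k \<gamma> x0 - \<Phi> k \<gamma> x))"
          by (simp add: G\<gamma> right_diff_distrib sum_subtractf)
        also have "qabs \<dots> \<le> real (card (UNIV :: 'n set)) * (m * (Ls * Rv))"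
        proof (rule qabs_sum_bound)
          fix k :: 'n
          have "qabs (\<Phi> k \<gamma> x - \<Phi> k \<gamma> x0) \<le> L (k, \<gamma>) * max_norm (x - x0)"
            using h Rv1(1) by (intro L(2)[OF \<gamma>(1) xW]) simp
          also have "\<dots> \<le> Ls * Rv"
            using L(1) Ls \<gamma>(1) h by (intro mult_mono) auto
          finally show "qabs (cc $ k * (\<Phi> k \<gamma> x0 - \<Phi> k \<gamma> x)) \<le> m * (Ls * Rv)"
            unfolding qabs_mult using qabs_le_max_norm[of cc k] m
            by (intro mult_mono) (auto simp: m_def qabs_minus_commute)
        qed
        finally show ?thesis .
      qed
      also have "\<dots> = m * (n * Ls * Rv)"
        by (simp add: n_def)
      also have "\<dots> \<le> m * c"
        using Rv2(4) m by (intro mult_left_mono) auto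
      finally have d: "qabs (G \<gamma> x0 - G \<gamma> x) \<le> m * c" .
      have "qabs (G \<gamma> x0) \<le> qabs (G \<gamma> x0 - G \<gamma> x) + qabs (G \<gamma> x)"
        using qabs_triangle[of "G \<gamma> x0 - G \<gamma> x" "G \<gamma> x"] by simp
      moreover have "c1 * m = c * m + m * c"
        by (simp add: c_def)
      ultimately show ?thesis
        using d \<gamma>(3) unfolding G\<gamma>[symmetric] by linarith
    qed
    show ?thesis
      unfolding abs_good_def Let_def
    proof (intro allI impI)
      fix x and r \<epsilon> :: real
      assume *: "x \<in> msupp M \<and> r > 0 \<and> nball N x r \<subseteq> V \<and> \<epsilon> > 0"
        and sup: "(SUP y\<in>nball N x r. ennreal (qabs (g y))) \<noteq> 0"
      have rR: "r \<le> \<Lambda> * Rv"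
        using radius_le[of r x x0 Rv] * by (simp add: V_def \<Lambda>_def)
      have xV: "x \<in> V"
        using * by auto
      have W4: "nball N x (4 * r) \<subseteq> W"
      proof -
        have "N (x - x0) + 4 * r \<le> (1 + 4 * \<Lambda>) * Rv"
          using xV rR by (simp add: V_def nball_def distrib_right)
        also have "\<dots> \<le> R"
          by (rule Rv2)
        finally have "nball N x (4 * r) \<subseteq> nball N x0 R"
          by (rule nball_mono)
        then show ?thesis
          using nball_subset_cube[of x0 R] by (auto simp: W_def)
      qed
      have U4: "nball N x (4 * r) \<subseteq> U"
        using W4 W(3) R0(2) by blast
      have r1: "r \<le> 1"
        using rR Rv2(1) by linarith
      have rc: "8 * 2 ^ (l + 1) * A * K * r \<le> c"
      proof -
        have "8 * 2 ^ (l + 1) * A * K * r \<le> 8 * 2 ^ (l + 1) * A * K * (\<Lambda> * Rv)"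
          using A K rR by (intro mult_left_mono) auto
        also have "\<dots> = E * Rv"
          by (simp add: E_def)
        finally show ?thesis
          using Rv2(2) by linarith
      qed
      show "emeasure M {y \<in> nball N x r. qabs (g y) < \<epsilon>}
          \<le> ennreal (C' * enn2real (ennreal \<epsilon> / (SUP y\<in>nball N x r. ennreal (qabs (g y)))) powr (\<alpha> * theta l)) * emeasure M (nball N x r)"
        using * unfolding C'_def
        by (intro good_on_ball[OF l M F D dec C tGW jG A m _ U4 W4 _ r1 rc[unfolded K_def] c \<gamma>(1) low[OF xV] _ sup]) auto
    qed
  qed
  moreover have "V \<subseteq> U"
  proof -
    have "Rv \<le> (1 + 4 * \<Lambda>) * Rv"
      using \<Lambda> Rv by simp
    then have "nball N x0 Rv \<subseteq> nball N x0 R"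
      using Rv2(3) by (intro nball_mono) simp
    then show ?thesis
      using nball_subset_cube[of x0 R] W(3) R0(2) by (auto simp: V_def W_def)
  qed
  moreover have "open V" "x0 \<in> V"
    using Rv by (simp_all add: V_def)
  ultimately show ?thesis
    using C' by blast
qed

end

theorem proposition4p1:
  fixes \<nu> :: enat
    and l :: nat
    and N :: "'k::{field_char_0, complete_space} ^ 'd::finite \<Rightarrow> real"
    and U :: "('k ^ 'd) set"
    and f :: "'k ^ 'd \<Rightarrow> 'k ^ 'n::finite"
    and x0 :: "'k ^ 'd"
    and \<mu> :: "('k ^ 'd) measure"
    and D C \<alpha> :: real
  assumes "is_Q_nu \<nu> TYPE('k)"
    and "standard_norm \<nu> N"
    and "l \<ge> 1"
    and "open U"
    and "Ck_map \<nu> (l + 1) U f"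
    and "x0 \<in> U"
    and "nondegenerate_at l f x0"
    and "locally_finite_borel \<mu>"
    and "D > 0" and "C > 0" and "\<alpha> > 0"
    and "Federer_on N \<mu> D U"
    and "abs_decaying N \<mu> C \<alpha> U"
  shows "\<exists>V C'. open V \<and> x0 \<in> V \<and> V \<subseteq> U \<and> C' > 0 \<and>
           (\<forall>g \<in> affine_combinations f. abs_good N \<mu> C' (\<alpha> / (2 ^ (l + 1) - 2)) V g)"
proof -
  interpret Q_norm \<nu> "TYPE('k)" N
    by unfold_locales fact+
  have "sets \<mu> = sets borel"
    using assms by (simp add: locally_finite_borel_def)
  then show ?thesis
    using combinations_good[of l U x0 f \<mu> D C \<alpha>] assms by (simp add: theta_def)
qed

end
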